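(* Let $d\ge 3$ and $g=\lfloor (d-1)/2\rfloor$, and let $V$, $\mathfrak S_d\subseteq \mathrm{Sp}(V/2V)$, $\varpi_{2^n}$ and $\Gamma(2^n)$ be as in the context. Let $G\subseteq \mathrm{Sp}(V)$ be a closed subgroup (for the $2$-adic topology) such that $\varpi_2(G)\supseteq \mathfrak S_d$. (a) If $d\ge 6$ is even, then $G=\varpi_2^{-1}(\varpi_2(G))$; in particular $G$ is an open subgroup of $\mathrm{Sp}(V)$ containing $\Gamma(2)$. (b) If $d\ge 5$ is odd, then $G\supseteq \Gamma(8)$, so $G$ is an open subgroup of $\mathrm{Sp}(V)$. If moreover $\varpi_2(G)=\mathfrak S_d$ and $G\not\supseteq \Gamma(4)$, then the order of $\varpi_8(G)$ is exactly $d!\cdot 2^{4g^2-2g}$, and any two closed subgroups $G$ with these properties ($\varpi_2(G)=\mathfrak S_d$, $G\not\supseteq\Gamma(4)$) are conjugate by an element of $\varpi_2^{-1}(\mathfrak S_d)$.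
   Context: Let $d\ge 3$ be an integer and put $g=\lfloor (d-1)/2\rfloor$. Let $W$ be an $\mathbb F_2$-vector space with basis $e_1,\dots,e_d$, on which $S_d$ acts by ${}^{\sigma}e_i=e_{\sigma(i)}$, and let $W_0\subseteq W$ be the subspace of vectors whose coordinates sum to $0$. Put $\bar V=W_0$ if $d$ is odd and $\bar V=W_0/\langle e_1+\cdots+e_d\rangle$ if $d$ is even; then $\dim\bar V=2g$. For an even-cardinality subset $I\subseteq\{1,\dots,d\}$ let $v_I\in\bar V$ be the image of $\sum_{i\in I}e_i$. The rule $\langle v_I,v_{I'}\rangle=\#(I\cap I')\bmod 2$ defines a nondegenerate alternating form on $\bar V$ preserved by $S_d$; the resulting homomorphism $\rho:S_d\to\mathrm{Sp}(\bar V)$ is the standard representation and its image is denoted $\mathfrak S_d$. Let $V$ be a free $\mathbb Z_2$-module of rank $2g$ with an alternating $\mathbb Z_2$-bilinear form $\langle\cdot,\cdot\rangle$, together with an identification $V/2V=\bar V$ under which the reduction mod $2$ of this form is the form on $\bar V$. $\mathrm{Sp}(V)$ (resp. $\mathrm{Sp}(V/2^nV)$) is the group of automorphisms preserving the form, with the $2$-adic topology on $\mathrm{Sp}(V)$. For $n\ge1$, $\varpi_{2^n}:\mathrm{Sp}(V)\to\mathrm{Sp}(V/2^nV)$ is the reduction map and $\Gamma(2^n)=\ker\varpi_{2^n}$. *)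

theory Defs
  imports
    "HOL-Algebra.Bij"
    "HOL-Algebra.Coset"
    "HOL-Analysis.Abstract_Topology"
    "HOL-Combinatorics.Permutations"
    "HOL-Library.Poly_Mapping"
    "HOL-Library.Set_Algebras"
    "HOL-Library.Z2"
begin

section \<open>The ring of 2-adic integers\<close>

text \<open>
  The inverse limit of the rings \<open>\<int>/2\<^sup>n\<close>, the class at level \<open>n\<close> being represented by its
  residue in \<open>{0..<2^n}\<close>; the compatibility condition already forces \<open>x n\<close> to be such a residue.
\<close>

typedef two_adic = "{x :: nat \<Rightarrow> int. \<forall>n. x (Suc n) mod 2 ^ n = x n}"
  by (rule exI[of _ "\<lambda>_. 0"]) simp

setup_lifting type_definition_two_adic

lemma mod_two_power_Suc: "(a mod 2 ^ Suc n) mod 2 ^ n = a mod (2 ^ n :: int)"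
  by (rule mod_mod_cancel) simp

lemma Rep_two_adic_mod [simp]: "Rep_two_adic x n mod 2 ^ n = Rep_two_adic x n"
proof -
  have "Rep_two_adic x (Suc n) mod 2 ^ n = Rep_two_adic x n"
    using Rep_two_adic[of x] by simp
  then show ?thesis by (metis mod_mod_trivial)
qed

lemma Rep_two_adic_Suc_mod [simp]: "Rep_two_adic x (Suc n) mod 2 ^ n = Rep_two_adic x n"
  using Rep_two_adic[of x] by simp

instantiation two_adic :: comm_ring_1
begin

lift_definition zero_two_adic :: two_adic is "\<lambda>n. 0" by simp

lift_definition one_two_adic :: two_adic is "\<lambda>n. 1 mod 2 ^ n"
  using mod_two_power_Suc by blast

lift_definition plus_two_adic :: "two_adic \<Rightarrow> two_adic \<Rightarrow> two_adic"
  is "\<lambda>x y n. (x n + y n) mod 2 ^ n"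
  by (metis mod_two_power_Suc mod_add_eq)

lift_definition uminus_two_adic :: "two_adic \<Rightarrow> two_adic" is "\<lambda>x n. (- x n) mod 2 ^ n"
  by (metis mod_two_power_Suc mod_minus_eq)

lift_definition minus_two_adic :: "two_adic \<Rightarrow> two_adic \<Rightarrow> two_adic"
  is "\<lambda>x y n. (x n - y n) mod 2 ^ n"
  by (metis mod_two_power_Suc mod_diff_eq)

lift_definition times_two_adic :: "two_adic \<Rightarrow> two_adic \<Rightarrow> two_adic"
  is "\<lambda>x y n. (x n * y n) mod 2 ^ n"
  by (metis mod_two_power_Suc mod_mult_eq)

instance
proof
  fix a b c :: two_adic
  note rep = plus_two_adic.rep_eq minus_two_adic.rep_eq uminus_two_adic.rep_eq times_two_adic.rep_eq
    zero_two_adic.rep_eq one_two_adic.rep_eq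
  have eqI: "x = y" if "\<And>n. Rep_two_adic x n = Rep_two_adic y n" for x y
    using that Rep_two_adic_inject by blast
  have [simp]: "Rep_two_adic x 0 = 0" for x
    using Rep_two_adic_mod[of x 0] by simp
  show "a * b * c = a * (b * c)"
    by (rule eqI) (simp add: rep mod_simps ac_simps)
  show "a * b = b * a"
    by (rule eqI) (simp add: rep ac_simps)
  show "1 * a = a"
    by (rule eqI) (simp add: rep mod_mult_left_eq)
  show "a + b + c = a + (b + c)"
    by (rule eqI) (simp add: rep mod_simps ac_simps)
  show "a + b = b + a"
    by (rule eqI) (simp add: rep ac_simps)
  show "0 + a = a"
    by (rule eqI) (simp add: rep)
  show "- a + a = 0"
    by (rule eqI) (simp add: rep mod_simps)
  show "a - b = a + - b"
    by (rule eqI) (simp add: rep mod_simps)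
  show "(a + b) * c = a * c + b * c"
    by (rule eqI) (simp add: rep mod_simps distrib_right)
  show "(0::two_adic) \<noteq> 1"
  proof
    assume "(0::two_adic) = 1"
    then have "Rep_two_adic 0 1 = Rep_two_adic 1 1" by simp
    then show False by (simp add: zero_two_adic.rep_eq one_two_adic.rep_eq)
  qed
qed

end

definition residue_bit :: "two_adic \<Rightarrow> bit" where
  "residue_bit x = of_int (Rep_two_adic x 1)"


section \<open>The space \<open>V\<^sub>b\<^sub>a\<^sub>r\<close> and the standard representation of \<open>S\<^sub>d\<close>\<close>

definition genus :: "nat \<Rightarrow> nat" where
  "genus d = (d - 1) div 2"

abbreviation e_basis :: "nat \<Rightarrow> nat \<Rightarrow>\<^sub>0 bit" where
  "e_basis i \<equiv> Poly_Mapping.single i 1"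

definition W_space :: "nat \<Rightarrow> (nat \<Rightarrow>\<^sub>0 bit) set" where
  "W_space d = {w. Poly_Mapping.keys w \<subseteq> {1..d}}"

definition W0_space :: "nat \<Rightarrow> (nat \<Rightarrow>\<^sub>0 bit) set" where
  "W0_space d = {w \<in> W_space d. (\<Sum>i = 1..d. Poly_Mapping.lookup w i) = 0}"

definition W0_radical :: "nat \<Rightarrow> (nat \<Rightarrow>\<^sub>0 bit) set" where
  "W0_radical d = (if even d then {0, \<Sum>i = 1..d. e_basis i} else {0})"

text \<open>
  Elements of \<open>V\<^sub>b\<^sub>a\<^sub>r\<close> are cosets in \<open>W\<^sub>0\<close>; for odd \<open>d\<close> they are the singletons \<open>{w}\<close> with \<open>w \<in> W\<^sub>0\<close>.
  Addition of cosets is the elementwise sum of sets from \<^theory>\<open>HOL-Library.Set_Algebras\<close>.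
\<close>

definition Vbar :: "nat \<Rightarrow> (nat \<Rightarrow>\<^sub>0 bit) set set" where
  "Vbar d = (\<lambda>w. w +o W0_radical d) ` W0_space d"

definition vbar :: "nat \<Rightarrow> nat set \<Rightarrow> (nat \<Rightarrow>\<^sub>0 bit) set" where
  "vbar d I = (\<Sum>i\<in>I. e_basis i) +o W0_radical d"

definition Vbar_form :: "nat \<Rightarrow> (nat \<Rightarrow>\<^sub>0 bit) set \<Rightarrow> (nat \<Rightarrow>\<^sub>0 bit) set \<Rightarrow> bit" where
  "Vbar_form d A B =
     (THE r. \<forall>I J. I \<subseteq> {1..d} \<and> even (card I) \<and> J \<subseteq> {1..d} \<and> even (card J) \<and>
        vbar d I = A \<and> vbar d J = B \<longrightarrow> r = of_nat (card (I \<inter> J)))"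

lemma lookup_sum_e_basis:
  "finite I \<Longrightarrow> Poly_Mapping.lookup (\<Sum>i\<in>I. e_basis i) k = (if k \<in> I then 1 else 0)"
  by (simp add: lookup_sum lookup_single when_def)

lemma vbar_eq_iff:
  assumes "I \<subseteq> {1..d}" "J \<subseteq> {1..d}"
  shows "vbar d I = vbar d J \<longleftrightarrow> I = J \<or> even d \<and> J = {1..d} - I"
proof -
  have fin: "finite I" "finite J" using assms finite_subset by blast+
  let ?s = "\<lambda>I. \<Sum>i\<in>I. e_basis i"
  have eq: "?s A = ?s B \<longleftrightarrow> A = B" if "finite A" "finite B" for A B
    using that by (metis lookup_sum_e_basis Set.set_eqI zero_neq_one)
  have compl: "?s A + ?s {1..d} = ?s ({1..d} - A)" if "A \<subseteq> {1..d}" for A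
    using that finite_subset[OF that]
    by (intro poly_mapping_eqI) (auto simp: lookup_add lookup_sum_e_basis)
  show ?thesis
  proof (cases "even d")
    case False
    then show ?thesis using eq[OF fin]
      by (auto simp: vbar_def W0_radical_def elt_set_plus_def)
  next
    case True
    have v: "vbar d A = {?s A, ?s ({1..d} - A)}" if "A \<subseteq> {1..d}" for A
      using True compl[OF that] by (auto simp: vbar_def W0_radical_def elt_set_plus_def)
    have "vbar d I = vbar d J \<longleftrightarrow> I = J \<or> J = {1..d} - I"
      unfolding v[OF assms(1)] v[OF assms(2)] doubleton_eq_iff
      using eq fin assms by (auto simp: double_diff)
    then show ?thesis using True by simp
  qed
qed

lemma Vbar_form_vbar:
  assumes "I \<subseteq> {1..d}" "even (card I)" "J \<subseteq> {1..d}" "even (card J)"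
  shows "Vbar_form d (vbar d I) (vbar d J) = of_nat (card (I \<inter> J))"
proof -
  have par: "even (card (({1..d} - A) \<inter> B)) \<longleftrightarrow> even (card (A \<inter> B))"
    if "A \<subseteq> {1..d}" "B \<subseteq> {1..d}" "even (card B)" for A B
  proof -
    have "B = (({1..d} - A) \<inter> B) \<union> (A \<inter> B)" using that by blast
    then have "card B = card (({1..d} - A) \<inter> B) + card (A \<inter> B)"
      using that by (subst card_Un_disjoint[symmetric]) (auto intro: finite_subset)
    then show ?thesis using that(3) by presburger
  qed
  have ofn: "(of_nat a :: bit) = of_nat b" if "even a \<longleftrightarrow> even b" for a b
    using that by (cases "even b") (auto elim!: evenE oddE)
  have "(of_nat (card (I' \<inter> J')) :: bit) = of_nat (card (I \<inter> J))"
    if "I' \<subseteq> {1..d}" "even (card I')" "J' \<subseteq> {1..d}" "even (card J')"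
      "vbar d I' = vbar d I" "vbar d J' = vbar d J" for I' J'
  proof (rule ofn)
    have I: "I' = I \<or> I' = {1..d} - I" and J: "J' = J \<or> J' = {1..d} - J"
      using that vbar_eq_iff[of I d I'] vbar_eq_iff[of J d J'] assms by auto
    have "even (card (I' \<inter> J')) \<longleftrightarrow> even (card (I \<inter> J'))"
      using I par[of I J'] assms that by auto
    also have "\<dots> \<longleftrightarrow> even (card (I \<inter> J))"
      using J par[of J I] assms that by (auto simp: Int_commute)
    finally show "even (card (I' \<inter> J')) \<longleftrightarrow> even (card (I \<inter> J))" .
  qed
  note val = this
  show ?thesis
    unfolding Vbar_form_def
  proof (rule the_equality, intro allI impI)
    fix I' J'
    assume "I' \<subseteq> {1..d} \<and> even (card I') \<and> J' \<subseteq> {1..d} \<and> even (card J') \<and>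
      vbar d I' = vbar d I \<and> vbar d J' = vbar d J"
    then show "of_nat (card (I \<inter> J)) = (of_nat (card (I' \<inter> J')) :: bit)"
      using val[of I' J'] by simp
  qed (use assms in blast)
qed

definition perm_act :: "nat \<Rightarrow> (nat \<Rightarrow> nat) \<Rightarrow> (nat \<Rightarrow>\<^sub>0 bit) \<Rightarrow> (nat \<Rightarrow>\<^sub>0 bit)" where
  "perm_act d \<sigma> w = (\<Sum>i = 1..d. Poly_Mapping.single (\<sigma> i) (Poly_Mapping.lookup w i))"

definition std_rep :: "nat \<Rightarrow> (nat \<Rightarrow> nat) \<Rightarrow> (nat \<Rightarrow>\<^sub>0 bit) set \<Rightarrow> (nat \<Rightarrow>\<^sub>0 bit) set" where
  "std_rep d \<sigma> = (\<lambda>A\<in>Vbar d. perm_act d \<sigma> ` A)"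


section \<open>Quotients, symplectic groups and reduction maps\<close>

definition multiples :: "(two_adic \<Rightarrow> 'v \<Rightarrow> 'v::ab_group_add) \<Rightarrow> nat \<Rightarrow> 'v set" where
  "multiples scale m = range (scale (of_nat m))"

definition quot_mod :: "(two_adic \<Rightarrow> 'v \<Rightarrow> 'v::ab_group_add) \<Rightarrow> nat \<Rightarrow> 'v set set" where
  "quot_mod scale m = range (\<lambda>v. v +o multiples scale m)"

definition quot_scale ::
  "(two_adic \<Rightarrow> 'v \<Rightarrow> 'v::ab_group_add) \<Rightarrow> nat \<Rightarrow> two_adic \<Rightarrow> 'v set \<Rightarrow> 'v set" where
  "quot_scale scale m r A = scale r ` A + multiples scale m"

text \<open>The form on \<open>V/mV\<close>, with values in \<open>\<int>\<^sub>2/m\<int>\<^sub>2\<close>.\<close>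

definition quot_form ::
  "('v::ab_group_add \<Rightarrow> 'v \<Rightarrow> two_adic) \<Rightarrow> nat \<Rightarrow> 'v set \<Rightarrow> 'v set \<Rightarrow> two_adic set" where
  "quot_form form m A B =
     (THE C. \<forall>a\<in>A. \<forall>b\<in>B. C = form a b +o multiples (*) m)"

definition Sp ::
  "(two_adic \<Rightarrow> 'v \<Rightarrow> 'v::ab_group_add) \<Rightarrow> ('v \<Rightarrow> 'v \<Rightarrow> two_adic) \<Rightarrow> ('v \<Rightarrow> 'v) monoid" where
  "Sp scale form = BijGroup UNIV
     \<lparr>carrier := {f \<in> Bij UNIV. module_hom scale scale f \<and> (\<forall>x y. form (f x) (f y) = form x y)}\<rparr>"

definition Sp_quot ::
  "(two_adic \<Rightarrow> 'v \<Rightarrow> 'v::ab_group_add) \<Rightarrow> ('v \<Rightarrow> 'v \<Rightarrow> two_adic) \<Rightarrow> nat \<Rightarrow> ('v set \<Rightarrow> 'v set) monoid"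
  where
  "Sp_quot scale form m = BijGroup (quot_mod scale m)
     \<lparr>carrier := {f \<in> Bij (quot_mod scale m).
        (\<forall>A\<in>quot_mod scale m. \<forall>B\<in>quot_mod scale m. f (A + B) = f A + f B) \<and>
        (\<forall>r. \<forall>A\<in>quot_mod scale m. f (quot_scale scale m r A) = quot_scale scale m r (f A)) \<and>
        (\<forall>A\<in>quot_mod scale m. \<forall>B\<in>quot_mod scale m.
           quot_form form m (f A) (f B) = quot_form form m A B)}\<rparr>"

text \<open>
  The parameter \<open>m\<close> is the modulus itself (not the exponent \<open>n\<close> with \<open>m = 2\<^sup>n\<close>).
\<close>

definition reduction ::
  "(two_adic \<Rightarrow> 'v \<Rightarrow> 'v::ab_group_add) \<Rightarrow> nat \<Rightarrow> ('v \<Rightarrow> 'v) \<Rightarrow> ('v set \<Rightarrow> 'v set)" where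
  "reduction scale m f = (\<lambda>A\<in>quot_mod scale m. f ` A)"

definition cong_subgroup ::
  "(two_adic \<Rightarrow> 'v \<Rightarrow> 'v::ab_group_add) \<Rightarrow> ('v \<Rightarrow> 'v \<Rightarrow> two_adic) \<Rightarrow> nat \<Rightarrow> ('v \<Rightarrow> 'v) set" where
  "cong_subgroup scale form m = kernel (Sp scale form) (Sp_quot scale form m) (reduction scale m)"

definition reduction_preimage ::
  "(two_adic \<Rightarrow> 'v \<Rightarrow> 'v::ab_group_add) \<Rightarrow> ('v \<Rightarrow> 'v \<Rightarrow> two_adic) \<Rightarrow> nat \<Rightarrow>
   ('v set \<Rightarrow> 'v set) set \<Rightarrow> ('v \<Rightarrow> 'v) set" where
  "reduction_preimage scale form m X = {f \<in> carrier (Sp scale form). reduction scale m f \<in> X}"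

definition Sp_topology ::
  "(two_adic \<Rightarrow> 'v \<Rightarrow> 'v::ab_group_add) \<Rightarrow> ('v \<Rightarrow> 'v \<Rightarrow> two_adic) \<Rightarrow> ('v \<Rightarrow> 'v) topology" where
  "Sp_topology scale form = topology (\<lambda>U. U \<subseteq> carrier (Sp scale form) \<and>
     (\<forall>f\<in>U. \<exists>n. {h \<in> carrier (Sp scale form). \<forall>x. h x - f x \<in> multiples scale (2 ^ n)} \<subseteq> U))"


locale two_adic_module = module scale
  for scale :: "two_adic \<Rightarrow> 'v::ab_group_add \<Rightarrow> 'v"
begin

lemma zero_in_multiples: "0 \<in> multiples scale m"
  unfolding multiples_def by (rule range_eqI[of _ _ 0]) simp

lemma add_in_multiples: "x \<in> multiples scale m \<Longrightarrow> y \<in> multiples scale m \<Longrightarrow> x + y \<in> multiples scale m"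
  by (auto simp: multiples_def simp flip: scale_right_distrib)

lemma minus_in_multiples: "x \<in> multiples scale m \<Longrightarrow> - x \<in> multiples scale m"
  by (auto simp: multiples_def simp flip: scale_minus_right)

lemma multiples_coset_eq_iff:
  "x +o multiples scale m = y +o multiples scale m \<longleftrightarrow> x - y \<in> multiples scale m" (is "?l \<longleftrightarrow> ?r")
proof
  assume eq: ?l
  have "x + 0 \<in> x +o multiples scale m"
    by (rule set_plus_intro2[OF zero_in_multiples])
  then have "x \<in> y +o multiples scale m" using eq by simp
  then show ?r by (auto simp: elt_set_plus_def)
next
  assume r: ?r
  show ?l
  proof (intro Set.set_eqI iffI)
    fix z assume "z \<in> x +o multiples scale m"
    then obtain b where "b \<in> multiples scale m" "z = x + b" by (auto simp: elt_set_plus_def)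
    then have "(x - y) + b \<in> multiples scale m" "z = y + ((x - y) + b)"
      using r add_in_multiples by auto
    then show "z \<in> y +o multiples scale m" by blast
  next
    fix z assume "z \<in> y +o multiples scale m"
    then obtain b where "b \<in> multiples scale m" "z = y + b" by (auto simp: elt_set_plus_def)
    then have "- (x - y) + b \<in> multiples scale m" "z = x + (- (x - y) + b)"
      using r add_in_multiples minus_in_multiples by (blast, simp)
    then show "z \<in> x +o multiples scale m" by blast
  qed
qed

lemma multiples_antimono:
  assumes "m dvd n" shows "multiples scale n \<subseteq> multiples scale m"
proof -
  from assms obtain k where "n = m * k" by blast
  then show ?thesis by (auto simp: multiples_def simp flip: scale_scale)
qed

lemma openin_Sp_topology:
  "openin (Sp_topology scale form) U \<longleftrightarrow> U \<subseteq> carrier (Sp scale form) \<and>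
     (\<forall>f\<in>U. \<exists>n. {h \<in> carrier (Sp scale form). \<forall>x. h x - f x \<in> multiples scale (2 ^ n)} \<subseteq> U)"
proof -
  let ?N = "\<lambda>f n. {h \<in> carrier (Sp scale form). \<forall>x. h x - f x \<in> multiples scale (2 ^ n)}"
  have mono: "?N f n \<subseteq> ?N f m" if "m \<le> n" for f m n
    using multiples_antimono[OF le_imp_power_dvd[OF that, of 2]] by blast
  have "istopology (\<lambda>U. U \<subseteq> carrier (Sp scale form) \<and> (\<forall>f\<in>U. \<exists>n. ?N f n \<subseteq> U))"
    unfolding istopology_def
  proof (intro conjI allI impI)
    fix S T
    assume S: "S \<subseteq> carrier (Sp scale form) \<and> (\<forall>f\<in>S. \<exists>n. ?N f n \<subseteq> S)"
      and T: "T \<subseteq> carrier (Sp scale form) \<and> (\<forall>f\<in>T. \<exists>n. ?N f n \<subseteq> T)"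
    show "S \<inter> T \<subseteq> carrier (Sp scale form)" using S by blast
    show "\<forall>f\<in>S \<inter> T. \<exists>n. ?N f n \<subseteq> S \<inter> T"
    proof
      fix f assume "f \<in> S \<inter> T"
      then obtain k l where "?N f k \<subseteq> S" "?N f l \<subseteq> T" using S T by blast
      then have "?N f (max k l) \<subseteq> S \<inter> T"
        using mono[of k "max k l" f] mono[of l "max k l" f] by simp blast
      then show "\<exists>n. ?N f n \<subseteq> S \<inter> T" by blast
    qed
  next
    fix K
    assume K: "\<forall>U\<in>K. U \<subseteq> carrier (Sp scale form) \<and> (\<forall>f\<in>U. \<exists>n. ?N f n \<subseteq> U)"
    then show "\<Union>K \<subseteq> carrier (Sp scale form)" by blast
    show "\<forall>f\<in>\<Union>K. \<exists>n. ?N f n \<subseteq> \<Union>K"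
    proof
      fix f assume "f \<in> \<Union>K"
      then obtain U where "U \<in> K" "f \<in> U" by blast
      with K obtain n where "?N f n \<subseteq> U" by blast
      with \<open>U \<in> K\<close> show "\<exists>n. ?N f n \<subseteq> \<Union>K" by blast
    qed
  qed
  then show ?thesis
    unfolding Sp_topology_def by (simp add: topology_inverse')
qed

lemma quot_form_coset:
  fixes form :: "'v \<Rightarrow> 'v \<Rightarrow> two_adic" and x y :: 'v
  assumes "\<And>y. module_hom scale (*) (\<lambda>x. form x y)" "\<And>x. module_hom scale (*) (\<lambda>y. form x y)"
  shows "quot_form form m (x +o multiples scale m) (y +o multiples scale m) =
    form x y +o multiples (*) m"
proof -
  interpret Z: two_adic_module "(*)"
    by unfold_locales (simp_all add: distrib_left distrib_right mult.assoc)
  interpret l: module_hom scale "(*)" "\<lambda>s. form s t" for t by (fact assms(1))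
  interpret r: module_hom scale "(*)" "\<lambda>t. form s t" for s by (fact assms(2))
  have "form a b +o multiples (*) m = form x y +o multiples (*) m"
    if "a \<in> x +o multiples scale m" "b \<in> y +o multiples scale m" for a b
  proof -
    from that obtain u v where uv: "a = x + scale (of_nat m) u" "b = y + scale (of_nat m) v"
      by (auto simp: elt_set_plus_def multiples_def)
    have "form a b - form x y = of_nat m * (form x v + form u b)"
      unfolding uv l.add r.add l.scale r.scale by (simp add: distrib_left mult.left_commute)
    then show ?thesis
      unfolding Z.multiples_coset_eq_iff by (simp add: multiples_def)
  qed
  note coset = this
  have mem: "x \<in> x +o multiples scale m" "y \<in> y +o multiples scale m"
    using set_plus_intro2[OF zero_in_multiples, of x m] set_plus_intro2[OF zero_in_multiples, of y m]
    by simp_all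
  have "\<forall>a\<in>x +o multiples scale m. \<forall>b\<in>y +o multiples scale m.
      form x y +o multiples (*) m = form a b +o multiples (*) m"
    using coset by simp
  moreover have "C = form x y +o multiples (*) m"
    if "\<forall>a\<in>x +o multiples scale m. \<forall>b\<in>y +o multiples scale m. C = form a b +o multiples (*) m"
    for C
    using that mem by blast
  ultimately show ?thesis
    unfolding quot_form_def by (intro the_equality)
qed

end


section \<open>Symplectic lattices lifting \<open>V\<^sub>b\<^sub>a\<^sub>r\<close>\<close>

text \<open>
  The identification \<open>ident\<close> of \<open>V/2V\<close> with \<open>V\<^sub>b\<^sub>a\<^sub>r\<close> is an additive bijection, hence
  an isomorphism of vector spaces over the field with two elements.
\<close>

locale symplectic_lattice = two_adic_module scale
  for scale :: "two_adic \<Rightarrow> 'v::ab_group_add \<Rightarrow> 'v" +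
  fixes d :: nat
    and form :: "'v \<Rightarrow> 'v \<Rightarrow> two_adic"
    and ident :: "'v set \<Rightarrow> (nat \<Rightarrow>\<^sub>0 bit) set"
  assumes free_of_rank_2g:
      "\<exists>B. finite B \<and> card B = 2 * genus d \<and> independent B \<and> span B = UNIV"
    and form_linear_left: "module_hom scale (*) (\<lambda>x. form x y)"
    and form_linear_right: "module_hom scale (*) (\<lambda>y. form x y)"
    and form_alternating: "form x x = 0"
    and ident_bij: "bij_betw ident (quot_mod scale 2) (Vbar d)"
    and ident_add: "A \<in> quot_mod scale 2 \<Longrightarrow> B \<in> quot_mod scale 2 \<Longrightarrow>
      ident (A + B) = ident A + ident B"
    and ident_form: "Vbar_form d (ident (x +o multiples scale 2)) (ident (y +o multiples scale 2))
      = residue_bit (form x y)"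

text \<open>The image of \<open>S\<^sub>d\<close> under the standard representation, transported from \<open>V\<^sub>b\<^sub>a\<^sub>r\<close> to \<open>V/2V\<close>.\<close>

definition perm_image ::
  "(two_adic \<Rightarrow> 'v \<Rightarrow> 'v::ab_group_add) \<Rightarrow> nat \<Rightarrow> ('v set \<Rightarrow> (nat \<Rightarrow>\<^sub>0 bit) set) \<Rightarrow>
   ('v set \<Rightarrow> 'v set) set" where
  "perm_image scale d ident =
     (\<lambda>\<sigma>. \<lambda>A\<in>quot_mod scale 2. inv_into (quot_mod scale 2) ident (std_rep d \<sigma> (ident A)))
       ` {\<sigma>. \<sigma> permutes {1..d}}"

end

(*
  For odd D = 2g + 1 the images E i of e_1 + ... + e_D - e_i span V/2V, with pairing
  <E i, E j> = 1 exactly when i and j differ, and they are permuted by S_D (for even d one uses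
  D = d - 1 and S_(d-1)). The quotient Gamma(2^n)/Gamma(2^(n+1)) is identified with the symmetric
  bilinear forms on V/2V: 1 + 2^n A corresponds to <A x, y>. Let L n be the subspace of forms coming
  from G. It is S_D-stable, and every stable subspace which contains the alternating forms and
  a non-alternating one is everything.

  Squaring a lift of a transposition shows that L 1 contains all alternating forms. If L 1 contains
  more, then so do all L n, and G contains Gamma(2), as G is closed. If d is even, then
  L 1 cannot be alternating: squares and commutators of lifts of transpositions impose
  contradictory conditions on their components in V/2V, because e_1 + ... + e_d vanishes there.
  If d is odd and L 1 is alternating, squares of elements of Gamma(2) and the commutator of lifts of two
  disjoint transpositions give all alternating forms in L 2, and the fourth power of a lift of
  a transposition gives a non-alternating form in L 3, hence Gamma(8) is contained in G. If moreover
  G does not contain Gamma(4), then L 1 and L 2 consist of the alternating forms, which gives the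
  order. Two such groups are compared modulo 4 and then modulo 8 by a cocycle with values in W_0; it is
  a coboundary since H^1(S_D, W_0) = 0 and since there is no nonzero S_D-homomorphism from the
  alternating forms to W_0.
*)
theory Submission
  imports Defs "HOL-Library.Function_Algebras"
begin

text \<open>Everything on \<open>V/2V\<close> is written on \<open>V\<close> itself: forms are
  functions on \<open>V\<close>, and congruence modulo \<open>2V\<close> is equality of all pairings
  \<open>pr x y\<close>. Modulo alternating forms a symmetric form is its diagonal
  \<open>x -> \<beta> x x\<close>, which is additive in characteristic 2 and hence a vector of
  \<open>V/2V\<close>. Whether a level form is alternating thus becomes a question about coordinates
  that sum to zero over an odd index set, and parity decides it. The obstacle is the passage from
  level 1 to level 2. There \<open>(1 + 2 A)^2 = 1 + 4 (A + A^2)\<close>, and the quadratic term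
  counts as much as the linear one; from level 2 on, squaring preserves level forms. So an
  alternating \<open>L 1\<close> need not produce a non-alternating \<open>L 2\<close>. For the
  square of a lift of a transposition, \<open>A\<close> is then idempotent modulo 2, so
  \<open>A + A^2\<close> is even and the fourth power drops straight to level 3; this is the origin
  of the 8. Its diagonal cannot be found from data modulo 2 and is extracted from 2-adic pairings.
  The exponent in the order is twice \<open>g (2g - 1)\<close>, the dimension of the alternating
  forms.\<close>

section \<open>Bits and 2-adic integers\<close>

text \<open>The library rewrites bit arithmetic to \<open>XOR\<close> and \<open>AND\<close>. With \<open>a + a = 0\<close> and \<open>a * a = a\<close>
  instead, ring normalisation decides identities.\<close>

declare add_bit_eq_xor [simp del] mult_bit_eq_and [simp del] minus_bit_def [simp del]
  divide_bit_def [simp del] uminus_bit_def [simp del]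

lemma bit_add_self [simp]: "a + a = (0 :: bit)"
  by (cases a) simp_all

lemma bit_add_self_left [simp]: "a + (a + b) = (b :: bit)"
  by (simp flip: add.assoc)

lemma bit_mult_self [simp]: "a * a = (a :: bit)"
  by (cases a) simp_all

lemma bit_mult_self_left [simp]: "a * (a * b) = a * (b :: bit)"
  by (simp flip: mult.assoc)

lemma bit_minus [simp]: "a - b = a + (b :: bit)" "- a = (a :: bit)"
  by (simp_all add: minus_bit_def uminus_bit_def)

lemma bit_add_eq_0_iff: "a + b = 0 \<longleftrightarrow> a = (b :: bit)"
  by (cases a; cases b) simp_all

lemma bit_add_eq_1_iff: "a + b = 1 \<longleftrightarrow> a \<noteq> (b :: bit)"
  by (cases a; cases b) simp_all

lemma of_nat_bit: "(of_nat n :: bit) = (if even n then 0 else 1)"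
  by (induction n) auto

lemma of_int_bit: "(of_int n :: bit) = (if even n then 0 else 1)"
  by (cases n) (auto simp: of_nat_bit)

lemma sum_fun_apply: "sum f A x = (\<Sum>i\<in>A. f i x)"
  by (induction A rule: infinite_finite_induct) simp_all

lemma residue_bit_add [simp]: "residue_bit (x + y) = residue_bit x + residue_bit y"
  unfolding residue_bit_def plus_two_adic.rep_eq of_int_bit by auto

lemma residue_bit_mult [simp]: "residue_bit (x * y) = residue_bit x * residue_bit y"
  unfolding residue_bit_def times_two_adic.rep_eq of_int_bit by (auto simp: even_mod_4_div_2 mod2_eq_if)

lemma residue_bit_0 [simp]: "residue_bit 0 = 0"
  by (simp add: residue_bit_def zero_two_adic.rep_eq)

lemma residue_bit_1 [simp]: "residue_bit 1 = 1"
  by (simp add: residue_bit_def one_two_adic.rep_eq)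

lemma residue_bit_minus [simp]: "residue_bit (- x) = residue_bit x"
  using residue_bit_add[of x "- x"] by (simp add: bit_add_eq_0_iff)

lemma residue_bit_diff [simp]: "residue_bit (x - y) = residue_bit x + residue_bit y"
  using residue_bit_add[of x "- y"] by simp

lemma residue_bit_2 [simp]: "residue_bit 2 = 0"
  using residue_bit_add[of 1 1] by simp

lemma residue_bit_power: "n > 0 \<Longrightarrow> residue_bit (2 ^ n) = 0"
  by (cases n) simp_all

lemma two_adic_eqI: "(\<And>n. Rep_two_adic x n = Rep_two_adic y n) \<Longrightarrow> x = y"
  using Rep_two_adic_inject by blast

lemma Rep_two_adic_double: "Rep_two_adic (2 * x) n = (2 * Rep_two_adic x n) mod 2 ^ n"
proof -
  have "Rep_two_adic (x + x) n = (2 * Rep_two_adic x n) mod 2 ^ n"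
    by (simp only: plus_two_adic.rep_eq mult_2)
  moreover have "2 * x = x + x" by (rule mult_2)
  ultimately show ?thesis by metis
qed

text \<open>Halving loses one level of precision: the half of \<open>x\<close> at level
  \<open>n\<close> is read off from level \<open>Suc n\<close>, where \<open>x\<close> is even by
  induction from level 1.\<close>

lemma residue_bit_eq_0_iff: "residue_bit x = 0 \<longleftrightarrow> (\<exists>y. x = 2 * y)"
proof
  assume r: "residue_bit x = 0"
  let ?y = "\<lambda>n. Rep_two_adic x (Suc n) div 2"
  have R1: "Rep_two_adic x 1 mod 2 = 0"
    using r by (simp add: residue_bit_def of_int_bit split: if_splits)
  have ev: "even (Rep_two_adic x (Suc n))" for n
  proof (induction n)
    case 0
    then show ?case using R1 by auto
  next
    case (Suc n)
    have "Rep_two_adic x (Suc (Suc n)) mod 2 ^ Suc n = Rep_two_adic x (Suc n)"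
      by (rule Rep_two_adic_Suc_mod)
    then show ?case using Suc by (metis dvd_mod_iff dvd_triv_left power_Suc)
  qed
  have "?y (Suc n) mod 2 ^ n = ?y n" for n
  proof -
    have "2 * (?y (Suc n) mod 2 ^ n) = (2 * ?y (Suc n)) mod 2 ^ Suc n"
      by (simp only: mult_mod_right power_Suc)
    also have "2 * ?y (Suc n) = Rep_two_adic x (Suc (Suc n))"
      by (rule dvd_mult_div_cancel[OF ev])
    also have "\<dots> mod 2 ^ Suc n = 2 * ?y n"
      by (simp only: Rep_two_adic_Suc_mod dvd_mult_div_cancel[OF ev])
    finally show ?thesis by linarith
  qed
  then obtain y where y: "Rep_two_adic y = ?y"
    using Abs_two_adic_inverse[of ?y] by blast
  have "x = 2 * y"
  proof (rule two_adic_eqI)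
    fix n
    have "Rep_two_adic (2 * y) n = Rep_two_adic x (Suc n) mod 2 ^ n"
      by (simp only: Rep_two_adic_double y dvd_mult_div_cancel[OF ev])
    then show "Rep_two_adic x n = Rep_two_adic (2 * y) n"
      by (simp only: Rep_two_adic_Suc_mod)
  qed
  then show "\<exists>y. x = 2 * y" ..
qed auto

lemma two_adic_double_eq_0:
  assumes "2 * x = (0 :: two_adic)" shows "x = 0"
proof (rule two_adic_eqI)
  fix n
  have "(2 * Rep_two_adic x (Suc n)) mod 2 ^ Suc n = 0"
    using Rep_two_adic_double[of x "Suc n"] assms by (simp add: zero_two_adic.rep_eq)
  then have "2 * (Rep_two_adic x (Suc n) mod 2 ^ n) = 0"
    by (simp only: mult_mod_right power_Suc)
  then show "Rep_two_adic x n = Rep_two_adic 0 n"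
    by (simp only: Rep_two_adic_Suc_mod zero_two_adic.rep_eq)
qed

lemma two_adic_power_mult_cancel:
  assumes "2 ^ n * x = 2 ^ n * (y :: two_adic)" shows "x = y"
proof -
  have "2 ^ n * z = 0 \<Longrightarrow> z = 0" for z :: two_adic
    by (induction n) (auto simp: mult.assoc dest!: two_adic_double_eq_0)
  from this[of "x - y"] assms show ?thesis by (simp add: right_diff_distrib)
qed

section \<open>Symmetric forms over the field with two elements\<close>

text \<open>Each induction step appends a transposition that moves \<open>\<sigma> x\<close> to
  \<open>y\<close> and fixes the points already placed.\<close>

lemma permutes_map_distinct:
  assumes "distinct xs" "distinct ys" "length xs = length ys" "set xs \<subseteq> S" "set ys \<subseteq> S"
  shows "\<exists>\<sigma>. \<sigma> permutes S \<and> map \<sigma> xs = ys"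
  using assms
proof (induction xs ys rule: list_induct2')
  case 1
  then show ?case by (intro exI[of _ id] conjI permutes_id) simp
next
  case (4 x xs y ys)
  then obtain \<sigma> where \<sigma>: "\<sigma> permutes S" "map \<sigma> xs = ys" by auto
  let ?\<tau> = "Transposition.transpose (\<sigma> x) y \<circ> \<sigma>"
  have xS: "\<sigma> x \<in> S" "y \<in> S" using 4 \<sigma> permutes_in_image by fastforce+
  have "\<sigma> x \<notin> \<sigma> ` set xs"
    using 4 by (simp add: inj_image_mem_iff[OF permutes_inj[OF \<sigma>(1)]])
  then have nx: "\<sigma> x \<notin> set ys" using \<sigma>(2) by auto
  have ny: "y \<notin> set ys" using 4 by auto
  have "?\<tau> z = \<sigma> z" if "z \<in> set xs" for z
  proof -
    have "\<sigma> z \<in> set ys" using that \<sigma>(2) by auto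
    then have "\<sigma> z \<noteq> \<sigma> x" "\<sigma> z \<noteq> y" using nx ny by metis+
    then show ?thesis by (simp add: transpose_apply_other)
  qed
  then have "map ?\<tau> xs = map \<sigma> xs" by (intro map_cong refl) auto
  then have "map ?\<tau> xs = ys" by (simp only: \<sigma>(2))
  then have "map ?\<tau> (x # xs) = y # ys"
    by (simp only: list.map o_apply transpose_apply_first)
  moreover have "?\<tau> permutes S"
    by (intro permutes_compose \<sigma>(1) permutes_swap_id xS)
  ultimately show ?case by (intro exI[of _ ?\<tau>] conjI)
qed auto

text \<open>An additive map to the bits kills \<open>2V\<close>, because \<open>2z = z + z\<close>.
  It is therefore a linear functional on \<open>V/2V\<close>, without forming the quotient.\<close>

definition bit_functional :: "('v::ab_group_add \<Rightarrow> bit) \<Rightarrow> bool" where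
  "bit_functional \<phi> \<longleftrightarrow> (\<forall>x y. \<phi> (x + y) = \<phi> x + \<phi> y)"

definition sym_form :: "('v::ab_group_add \<Rightarrow> 'v \<Rightarrow> bit) \<Rightarrow> bool" where
  "sym_form \<beta> \<longleftrightarrow> (\<forall>x. bit_functional (\<beta> x)) \<and> (\<forall>x y. \<beta> x y = \<beta> y x)"

definition alt_form :: "('v::ab_group_add \<Rightarrow> 'v \<Rightarrow> bit) \<Rightarrow> bool" where
  "alt_form \<beta> \<longleftrightarrow> sym_form \<beta> \<and> (\<forall>x. \<beta> x x = 0)"

lemma bit_functional_add: "bit_functional \<phi> \<Longrightarrow> \<phi> (x + y) = \<phi> x + \<phi> y"
  by (simp add: bit_functional_def)

lemma bit_functional_0: "bit_functional \<phi> \<Longrightarrow> \<phi> 0 = 0"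
  using bit_functional_add[of \<phi> 0 0] by simp

lemma bit_functional_minus: "bit_functional \<phi> \<Longrightarrow> \<phi> (- x) = \<phi> x"
  using bit_functional_add[of \<phi> x "- x"] bit_functional_0[of \<phi>] by (simp add: bit_add_eq_0_iff)

lemma bit_functional_diff: "bit_functional \<phi> \<Longrightarrow> \<phi> (x - y) = \<phi> x + \<phi> y"
  using bit_functional_add[of \<phi> x "- y"] bit_functional_minus[of \<phi> y] by simp

lemma bit_functional_sum: "bit_functional \<phi> \<Longrightarrow> \<phi> (sum f A) = (\<Sum>i\<in>A. \<phi> (f i))"
  by (induction A rule: infinite_finite_induct) (simp_all add: bit_functional_0 bit_functional_add)

lemma sym_form_add:
  assumes "sym_form \<beta>"
  shows "\<beta> x (y + z) = \<beta> x y + \<beta> x z" "\<beta> (y + z) x = \<beta> y x + \<beta> z x"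
  using assms unfolding sym_form_def bit_functional_def by metis+

lemma sym_form_functional: "sym_form \<beta> \<Longrightarrow> bit_functional (\<beta> x)"
  by (simp add: sym_form_def)

lemma sym_form_commute: "sym_form \<beta> \<Longrightarrow> \<beta> x y = \<beta> y x"
  by (simp add: sym_form_def)

lemma sym_form_plus: "sym_form \<beta> \<Longrightarrow> sym_form \<gamma> \<Longrightarrow> sym_form (\<beta> + \<gamma>)"
  by (simp add: sym_form_def bit_functional_def ac_simps)

lemma alt_form_plus: "alt_form \<beta> \<Longrightarrow> alt_form \<gamma> \<Longrightarrow> alt_form (\<beta> + \<gamma>)"
  by (simp add: alt_form_def sym_form_plus)

lemma alt_formD: "alt_form \<beta> \<Longrightarrow> sym_form \<beta>" "alt_form \<beta> \<Longrightarrow> \<beta> x x = 0"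
  by (simp_all add: alt_form_def)

lemma alt_form_plusI:
  assumes "sym_form \<beta>" "sym_form \<gamma>" "\<And>x. \<beta> x x = \<gamma> x x" shows "alt_form (\<beta> + \<gamma>)"
  using assms by (simp add: alt_form_def sym_form_plus)

lemma sym_form_0: "sym_form 0"
  by (simp add: sym_form_def bit_functional_def)

lemma sym_form_sum: "(\<And>i. i \<in> A \<Longrightarrow> sym_form (f i)) \<Longrightarrow> sym_form (sum f A)"
  by (induction A rule: infinite_finite_induct) (simp_all add: sym_form_0 sym_form_plus)

lemma alt_form_0: "alt_form 0"
  by (simp add: alt_form_def sym_form_0)

lemma alt_form_sum: "(\<And>i. i \<in> A \<Longrightarrow> alt_form (f i)) \<Longrightarrow> alt_form (sum f A)"
  by (induction A rule: infinite_finite_induct) (simp_all add: alt_form_0 alt_form_plus)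

lemma form_add_self [simp]: "\<beta> + \<beta> = (0 :: 'v \<Rightarrow> 'v \<Rightarrow> bit)"
  by (simp add: fun_eq_iff)

lemma form_add_self_left [simp]: "\<beta> + (\<beta> + \<gamma>) = (\<gamma> :: 'v \<Rightarrow> 'v \<Rightarrow> bit)"
  by (simp add: fun_eq_iff)

text \<open>The two cross terms agree and cancel. The resulting functional is the obstruction to
  being alternating.\<close>

lemma sym_form_diag: "sym_form \<beta> \<Longrightarrow> bit_functional (\<lambda>x. \<beta> x x)"
  unfolding bit_functional_def
  using sym_form_add[of \<beta>] sym_form_commute[of \<beta>] by (simp add: ac_simps)

text \<open>Both parities of \<open>d\<close> are treated at once: the Gram matrix modulo 2 is all
  ones off a zero diagonal, and its size \<open>D\<close> is odd. Nondegeneracy is stated modulo 2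
  and against the \<open>E i\<close> only, which makes them span \<open>V/2V\<close>.\<close>

locale odd_frame = two_adic_module scale
  for scale :: "two_adic \<Rightarrow> 'v::ab_group_add \<Rightarrow> 'v" +
  fixes form :: "'v \<Rightarrow> 'v \<Rightarrow> two_adic" and D :: nat and E :: "nat \<Rightarrow> 'v"
  assumes form_linear_left: "module_hom scale (*) (\<lambda>x. form x y)"
    and form_linear_right: "module_hom scale (*) (\<lambda>y. form x y)"
    and form_alternating: "form x x = 0"
    and torsion_free: "scale 2 x = 0 \<Longrightarrow> x = 0"
    and odd_D: "odd D" and D_ge: "D \<ge> 5"
    and form_E: "i \<in> {1..D} \<Longrightarrow> j \<in> {1..D} \<Longrightarrow>
      residue_bit (form (E i) (E j)) = (if i = j then 0 else 1)"
    and form_nondegenerate: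
      "(\<And>i. i \<in> {1..D} \<Longrightarrow> residue_bit (form x (E i)) = 0) \<Longrightarrow> \<exists>z. x = scale 2 z"
begin

definition pr :: "'v \<Rightarrow> 'v \<Rightarrow> bit" where
  "pr x y = residue_bit (form x y)"

text \<open>\<open>sq u\<close> and \<open>wedge u w\<close> are the forms of the endomorphisms \<open>x \<mapsto> \<langle>x, u\<rangle> u\<close> and
  \<open>x \<mapsto> \<langle>x, u\<rangle> w + \<langle>x, w\<rangle> u\<close>; \<open>shear v \<beta>\<close> is the sum of \<open>\<beta>\<close> and its pullback along the transvection
  at \<open>v\<close> (see \<open>shear_eq_tv\<close>).\<close>

definition sq :: "'v \<Rightarrow> 'v \<Rightarrow> 'v \<Rightarrow> bit" where
  "sq u = (\<lambda>x y. pr x u * pr y u)"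

definition wedge :: "'v \<Rightarrow> 'v \<Rightarrow> 'v \<Rightarrow> 'v \<Rightarrow> bit" where
  "wedge u w = (\<lambda>x y. pr x u * pr y w + pr x w * pr y u)"

definition shear :: "'v \<Rightarrow> ('v \<Rightarrow> 'v \<Rightarrow> bit) \<Rightarrow> 'v \<Rightarrow> 'v \<Rightarrow> bit" where
  "shear v \<beta> = (\<lambda>x y. pr x v * \<beta> v y + pr y v * \<beta> x v + pr x v * pr y v * \<beta> v v)"

lemma form_add [simp]:
  "form (x + y) z = form x z + form y z" "form z (x + y) = form z x + form z y"
  by (fact module_hom.add[OF form_linear_left] module_hom.add[OF form_linear_right])+

lemma form_scale [simp]:
  "form (scale r x) z = r * form x z" "form z (scale r x) = r * form z x"
  by (fact module_hom.scale[OF form_linear_left] module_hom.scale[OF form_linear_right])+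

lemma form_0 [simp]: "form 0 z = 0" "form z 0 = 0"
  by (fact module_hom.zero[OF form_linear_left] module_hom.zero[OF form_linear_right])+

lemma form_diff [simp]:
  "form (x - y) z = form x z - form y z" "form z (x - y) = form z x - form z y"
  by (fact module_hom.diff[OF form_linear_left] module_hom.diff[OF form_linear_right])+

lemma form_commute: "form x y = - form y x"
proof -
  have "form x y + form y x = form (x + y) (x + y)"
    unfolding form_add by (simp add: form_alternating)
  then have "form x y + form y x = 0" by (simp only: form_alternating)
  then show ?thesis by (simp only: eq_neg_iff_add_eq_0)
qed

lemma pr_add [simp]: "pr (x + y) z = pr x z + pr y z" "pr z (x + y) = pr z x + pr z y"
  and pr_diff [simp]: "pr (x - y) z = pr x z + pr y z" "pr z (x - y) = pr z x + pr z y"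
  and pr_0 [simp]: "pr 0 z = 0" "pr z 0 = 0"
  and pr_scale [simp]: "pr (scale r x) z = residue_bit r * pr x z"
    "pr z (scale r x) = residue_bit r * pr z x"
  and pr_self [simp]: "pr x x = 0"
  by (simp_all add: pr_def form_alternating)

lemma pr_commute: "pr x y = pr y x"
  unfolding pr_def by (subst form_commute) simp

lemma pr_functional: "bit_functional (pr x)" "bit_functional (\<lambda>y. pr y x)"
  by (simp_all add: bit_functional_def)

lemma pr_E: "i \<in> {1..D} \<Longrightarrow> j \<in> {1..D} \<Longrightarrow> pr (E i) (E j) = (if i = j then 0 else 1)"
  by (simp add: pr_def form_E)

lemma nondegenerate: "(\<And>i. i \<in> {1..D} \<Longrightarrow> pr x (E i) = 0) \<Longrightarrow> \<exists>z. x = scale 2 z"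
  unfolding pr_def by (rule form_nondegenerate)

text \<open>Each \<open>E k\<close> pairs to 1 with the \<open>D - 1\<close> other vectors, an even
  number, so the sum lies in \<open>2V\<close>. This is the only linear relation among the
  \<open>E i\<close> modulo 2.\<close>

lemma pr_sum_E: "pr x (sum E {1..D}) = 0"
proof -
  have "pr (sum E {1..D}) (E k) = 0" if k: "k \<in> {1..D}" for k
  proof -
    have "pr (sum E {1..D}) (E k) = (\<Sum>i\<in>{1..D}. pr (E i) (E k))"
      by (rule bit_functional_sum[OF pr_functional(2)])
    also have "\<dots> = (\<Sum>i\<in>{1..D}. if i = k then 0 else 1)"
      using k by (intro sum.cong) (simp_all add: pr_E)
    also have "\<dots> = (\<Sum>i\<in>{1..D} - {k}. 1)"
      using k by (simp add: sum.remove[of _ k])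
    also have "\<dots> = of_nat (D - 1)" using k by simp
    finally show ?thesis using odd_D by (simp add: of_nat_bit)
  qed
  then obtain z where "sum E {1..D} = scale 2 z" using nondegenerate by blast
  then show ?thesis by simp
qed

lemma sum_pr_E: "(\<Sum>i\<in>{1..D}. pr x (E i)) = 0"
  using pr_sum_E[of x] by (simp add: bit_functional_sum[OF pr_functional(1)])

lemma bit_functional_scale2: "bit_functional \<phi> \<Longrightarrow> \<phi> (scale 2 z) = 0"
proof -
  assume \<phi>: "bit_functional \<phi>"
  have "scale 2 z = z + z" by (metis one_add_one scale_left_distrib scale_one)
  then show ?thesis using bit_functional_add[OF \<phi>, of z z] by simp
qed

text \<open>The pairings of \<open>x\<close> with the frame serve as its coordinates: they sum to
  zero, so the sum over all \<open>i\<close> other than \<open>k\<close> equals the pairing with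
  \<open>E k\<close>.\<close>

lemma bit_functional_expand:
  assumes \<phi>: "bit_functional \<phi>"
  shows "\<phi> x = (\<Sum>i\<in>{1..D}. pr x (E i) * \<phi> (E i))"
proof -
  define y where "y = (\<Sum>i\<in>{1..D}. if pr x (E i) = 1 then E i else 0)"
  have y: "\<psi> y = (\<Sum>i\<in>{1..D}. pr x (E i) * \<psi> (E i))" if "bit_functional \<psi>" for \<psi>
    unfolding y_def bit_functional_sum[OF that]
    by (rule sum.cong) (auto simp: bit_functional_0[OF that])
  have "pr (x - y) (E k) = 0" if k: "k \<in> {1..D}" for k
  proof -
    have "pr y (E k) = (\<Sum>i\<in>{1..D}. pr x (E i) * pr (E i) (E k))"
      by (rule y[OF pr_functional(2)])
    also have "\<dots> = (\<Sum>i\<in>{1..D}. if i = k then 0 else pr x (E i))"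
      using k by (intro sum.cong) (simp_all add: pr_E)
    also have "\<dots> = (\<Sum>i\<in>{1..D} - {k}. pr x (E i))"
      using k by (simp add: sum.remove[of _ k])
    also have "\<dots> = pr x (E k)"
      using sum_pr_E[of x] sum.remove[OF _ k, of "\<lambda>i. pr x (E i)"] by (simp add: bit_add_eq_0_iff)
    finally show ?thesis by simp
  qed
  then obtain z where "x - y = scale 2 z" using nondegenerate by blast
  then have "\<phi> (x - y) = 0" using bit_functional_scale2[OF \<phi>] by simp
  then have "\<phi> x = \<phi> y" by (simp add: bit_functional_diff[OF \<phi>] bit_add_eq_0_iff)
  then show ?thesis using y[OF \<phi>] by simp
qed

lemma sum_functional_E: "bit_functional \<phi> \<Longrightarrow> (\<Sum>i\<in>{1..D}. \<phi> (E i)) = 0"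
proof -
  assume \<phi>: "bit_functional \<phi>"
  have "\<phi> (sum E {1..D}) = (\<Sum>i\<in>{1..D}. pr (sum E {1..D}) (E i) * \<phi> (E i))"
    by (rule bit_functional_expand[OF \<phi>])
  also have "\<dots> = 0" using pr_sum_E by (simp add: pr_commute)
  finally show ?thesis by (simp add: bit_functional_sum[OF \<phi>])
qed

text \<open>Modulo 2, \<open>E 1\<close> is the sum of the other vectors, and \<open>E 2\<close>,
  ..., \<open>E D\<close> form a basis.\<close>

lemma bit_functional_eqI:
  assumes \<phi>: "bit_functional \<phi>" and \<psi>: "bit_functional \<psi>"
    and eq: "\<And>i. i \<in> {2..D} \<Longrightarrow> \<phi> (E i) = \<psi> (E i)"
  shows "\<phi> x = \<psi> x"
proof -
  have s: "{1..D} = insert 1 {2..D}" using D_ge by auto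
  have "\<phi> (E 1) = \<psi> (E 1)"
    using sum_functional_E[OF \<phi>] sum_functional_E[OF \<psi>] eq unfolding s
    by (simp add: bit_add_eq_0_iff)
  then have "\<phi> (E i) = \<psi> (E i)" if "i \<in> {1..D}" for i using that eq unfolding s by auto
  then show ?thesis using bit_functional_expand[OF \<phi>, of x] bit_functional_expand[OF \<psi>, of x] by simp
qed

lemma sym_form_eqI:
  assumes \<beta>: "sym_form \<beta>" and \<gamma>: "sym_form \<gamma>"
    and eq: "\<And>k l. k \<in> {2..D} \<Longrightarrow> l \<in> {2..D} \<Longrightarrow> \<beta> (E k) (E l) = \<gamma> (E k) (E l)"
  shows "\<beta> = \<gamma>"
proof (intro ext)
  fix x y
  have E: "\<beta> (E k) z = \<gamma> (E k) z" if "k \<in> {2..D}" for k z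
    by (rule bit_functional_eqI) (use \<beta> \<gamma> eq that in \<open>auto intro: sym_form_functional\<close>)
  have "\<beta> x (E k) = \<gamma> x (E k)" if "k \<in> {2..D}" for k
    using E[OF that, of x] sym_form_commute[OF \<beta>, of x "E k"] sym_form_commute[OF \<gamma>, of x "E k"]
    by simp
  then show "\<beta> x y = \<gamma> x y"
    by (rule bit_functional_eqI[rotated 2]) (use \<beta> \<gamma> in \<open>auto intro: sym_form_functional\<close>)
qed

lemma bit_functional_represent:
  assumes \<phi>: "bit_functional \<phi>" shows "\<exists>b. \<forall>x. \<phi> x = pr b x"
proof (intro exI allI)
  fix x
  let ?f = "\<lambda>i. if \<phi> (E i) = 1 then E i else 0"
  have "pr (\<Sum>i\<in>{1..D}. ?f i) x = (\<Sum>i\<in>{1..D}. pr (?f i) x)"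
    by (rule bit_functional_sum[OF pr_functional(2)])
  also have "\<dots> = (\<Sum>i\<in>{1..D}. pr x (E i) * \<phi> (E i))"
    by (rule sum.cong) (auto simp: pr_commute)
  finally show "\<phi> x = pr (\<Sum>i\<in>{1..D}. ?f i) x"
    using bit_functional_expand[OF \<phi>, of x] by simp
qed

section \<open>Squares, wedges and shears\<close>

lemma sym_form_sq: "sym_form (sq u)"
  by (simp add: sym_form_def bit_functional_def sq_def algebra_simps)

lemma alt_form_wedge: "alt_form (wedge u w)"
  by (simp add: alt_form_def sym_form_def bit_functional_def wedge_def algebra_simps)

lemma wedge_add [simp]:
  "wedge (u + v) w = wedge u w + wedge v w" "wedge u (v + w) = wedge u v + wedge u w"
  by (simp_all add: wedge_def fun_eq_iff algebra_simps)

lemma wedge_commute: "wedge u w = wedge w u"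
  by (simp add: wedge_def fun_eq_iff algebra_simps)

lemma wedge_self [simp]: "wedge u u = 0"
  by (simp add: wedge_def fun_eq_iff algebra_simps)

lemma wedge_zero [simp]: "wedge u 0 = 0" "wedge 0 u = 0"
  by (simp_all add: wedge_def fun_eq_iff)

lemma sq_add: "sq (u + w) = sq u + sq w + wedge u w"
  by (simp add: wedge_def sq_def fun_eq_iff algebra_simps)

lemma wedge_cong: "(\<And>x. pr x u = pr x u') \<Longrightarrow> (\<And>x. pr x w = pr x w') \<Longrightarrow> wedge u w = wedge u' w'"
  by (simp add: wedge_def)

lemma shear_sq: "shear v (sq u) = (if pr u v = 0 then 0 else sq u + sq (u + v))"
  by (cases "pr u v") (auto simp: shear_def sq_def fun_eq_iff algebra_simps pr_commute[of v u])

lemma shear_wedge_orth: "pr u v = 0 \<Longrightarrow> shear v (wedge u w) = (if pr w v = 0 then 0 else wedge u v)"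
  by (cases "pr w v")
    (auto simp: shear_def wedge_def fun_eq_iff algebra_simps pr_commute[of v u] pr_commute[of v w])

lemma shear_plus: "shear v (\<beta> + \<gamma>) = shear v \<beta> + shear v \<gamma>"
  by (simp add: shear_def fun_eq_iff algebra_simps)

text \<open>Only the functional \<open>\<beta> v\<close> enters a shear, so a single vector
  \<open>b\<close> representing it describes the result.\<close>

lemma shear_eq:
  assumes "sym_form \<beta>" "\<And>x. \<beta> v x = pr b x"
  shows "shear v \<beta> = wedge v b + (if pr b v = 1 then sq v else 0)"
  using assms(2) sym_form_commute[OF assms(1), of _ v]
  by (auto simp: shear_def wedge_def sq_def fun_eq_iff algebra_simps pr_commute[of b])

lemma shear_diag: "sym_form \<beta> \<Longrightarrow> shear v \<beta> x x = pr x v * \<beta> v v"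
  using sym_form_commute[of \<beta> v x] by (simp add: shear_def)

lemma sym_form_shear: "sym_form \<beta> \<Longrightarrow> sym_form (shear v \<beta>)"
  unfolding sym_form_def bit_functional_def shear_def
  by (simp add: algebra_simps)

end

section \<open>Stable spaces of forms\<close>

text \<open>The index 1 stays a numeral instead of \<open>Suc 0\<close>, so that facts about
  \<open>E 1\<close> match.\<close>

declare One_nat_def [simp del]

context odd_frame
begin

text \<open>For indices from 2 on, the vectors \<open>E 1 + E i\<close> are dual to the
  \<open>E i\<close>, so the wedges of pairs of them form a basis of the alternating forms.\<close>

lemma alt_form_induct:
  assumes \<beta>: "alt_form \<beta>"
    and zero: "P 0" and plus: "\<And>\<beta> \<gamma>. P \<beta> \<Longrightarrow> P \<gamma> \<Longrightarrow> P (\<beta> + \<gamma>)"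
    and tri: "\<And>i j. i \<in> {2..D} \<Longrightarrow> j \<in> {2..D} \<Longrightarrow> i \<noteq> j \<Longrightarrow> P (wedge (E 1 + E i) (E 1 + E j))"
  shows "P \<beta>"
proof -
  define T where "T = (\<lambda>i j. if i < j \<and> \<beta> (E i) (E j) = 1 then wedge (E 1 + E i) (E 1 + E j) else 0)"
  have \<beta>_eq: "\<beta> = (\<Sum>i\<in>{2..D}. \<Sum>j\<in>{2..D}. T i j)"
  proof (rule sym_form_eqI)
    show "sym_form \<beta>" using \<beta> by (rule alt_formD)
    show "sym_form (\<Sum>i\<in>{2..D}. \<Sum>j\<in>{2..D}. T i j)"
      by (intro sym_form_sum) (simp add: T_def sym_form_0 alt_formD(1)[OF alt_form_wedge] del: wedge_add)
    fix k l assume kl: "k \<in> {2..D}" "l \<in> {2..D}"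
    define f where "f = (\<lambda>i j. if i < j then \<beta> (E i) (E j) else 0)"
    have p: "pr (E m) (E 1 + E i) = (if m = i then 1 else 0)" if "m \<in> {2..D}" "i \<in> {2..D}" for m i
      using that by (auto simp: pr_E)
    have "T i j (E k) (E l) = (if i = k then if j = l then f i j else 0 else 0) +
        (if i = l then if j = k then f i j else 0 else 0)"
      if "i \<in> {2..D}" "j \<in> {2..D}" for i j
      using that kl by (auto simp: T_def f_def wedge_def p simp del: pr_add One_nat_def)
    then have "(\<Sum>i\<in>{2..D}. \<Sum>j\<in>{2..D}. T i j) (E k) (E l) =
      (\<Sum>i\<in>{2..D}. \<Sum>j\<in>{2..D}. (if i = k then if j = l then f i j else 0 else 0) +
        (if i = l then if j = k then f i j else 0 else 0))"
      by (simp add: sum_fun_apply)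
    also have "\<dots> = (\<Sum>i\<in>{2..D}. (if i = k then f i l else 0) + (if i = l then f i k else 0))"
      using kl by (intro sum.cong) (auto simp: sum.distrib)
    also have "\<dots> = f k l + f l k"
      using kl by (simp add: sum.distrib)
    also have "\<dots> = \<beta> (E k) (E l)"
      using alt_formD(2)[OF \<beta>] sym_form_commute[OF alt_formD(1)[OF \<beta>], of "E k" "E l"]
      by (cases k l rule: linorder_cases) (auto simp: f_def)
    finally show "\<beta> (E k) (E l) = (\<Sum>i\<in>{2..D}. \<Sum>j\<in>{2..D}. T i j) (E k) (E l)" by simp
  qed
  have sum: "P (sum f A)" if "\<And>i. i \<in> A \<Longrightarrow> P (f i)" for f :: "nat \<Rightarrow> _" and A
    using that by (induction A rule: infinite_finite_induct) (auto intro: zero plus)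
  have "P (T i j)" if "i \<in> {2..D}" "j \<in> {2..D}" for i j
    using tri[OF that] zero unfolding T_def by (simp del: wedge_add)
  then show ?thesis unfolding \<beta>_eq by (intro sum)
qed

end

text \<open>Models the level forms of a group. A permutation has no preferred lift, so
  \<open>L_perm\<close> asks for some substitution \<open>t\<close> with the right pairings; the
  shears come from transpositions.\<close>

locale stable_forms = odd_frame scale form D E
  for scale :: "two_adic \<Rightarrow> 'v::ab_group_add \<Rightarrow> 'v" and form D E +
  fixes L :: "('v \<Rightarrow> 'v \<Rightarrow> bit) set"
  assumes L_0: "0 \<in> L"
    and L_plus: "\<beta> \<in> L \<Longrightarrow> \<gamma> \<in> L \<Longrightarrow> \<beta> + \<gamma> \<in> L"
    and L_sym: "\<beta> \<in> L \<Longrightarrow> sym_form \<beta>"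
    and L_shear: "i \<in> {1..D} \<Longrightarrow> j \<in> {1..D} \<Longrightarrow> i \<noteq> j \<Longrightarrow> \<beta> \<in> L \<Longrightarrow> shear (E i + E j) \<beta> \<in> L"
    and L_perm: "\<sigma> permutes {1..D} \<Longrightarrow> \<beta> \<in> L \<Longrightarrow>
      \<exists>t. (\<forall>x. \<forall>i\<in>{1..D}. pr (t x) (E (\<sigma> i)) = pr x (E i)) \<and> (\<lambda>x y. \<beta> (t x) (t y)) \<in> L"
begin

lemma L_sum: "(\<And>i. i \<in> A \<Longrightarrow> f i \<in> L) \<Longrightarrow> sum f A \<in> L"
  by (induction A rule: infinite_finite_induct) (auto intro: L_0 L_plus)

lemma L_cancel: "\<beta> + \<gamma> \<in> L \<Longrightarrow> \<gamma> \<in> L \<Longrightarrow> \<beta> \<in> L"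
  using L_plus[of "\<beta> + \<gamma>" \<gamma>] by (simp add: add.assoc)

text \<open>The list equation allows repeated indices, so triangles, where \<open>i = k\<close>, are
  covered together with four distinct indices.\<close>

lemma wedge_perm:
  assumes "wedge (E i' + E j') (E k' + E l') \<in> L"
    and "map \<sigma> [i, j, k, l] = [i', j', k', l']" "\<sigma> permutes {1..D}" "{i, j, k, l} \<subseteq> {1..D}"
  shows "wedge (E i + E j) (E k + E l) \<in> L"
proof -
  obtain t where t: "\<forall>x. \<forall>i\<in>{1..D}. pr (t x) (E (\<sigma> i)) = pr x (E i)"
    and L: "(\<lambda>x y. wedge (E i' + E j') (E k' + E l') (t x) (t y)) \<in> L"
    using L_perm[OF assms(3,1)] by blast
  have e: "pr (t x) (E i') = pr x (E i)" "pr (t x) (E j') = pr x (E j)"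
     "pr (t x) (E k') = pr x (E k)" "pr (t x) (E l') = pr x (E l)" for x
    using t assms(2,4) by auto
  from L show ?thesis by (simp add: wedge_def e)
qed

lemma sq_perm:
  assumes "sq (E i' + E j') \<in> L" "i' \<noteq> j'" "{i', j'} \<subseteq> {1..D}" "i \<noteq> j" "{i, j} \<subseteq> {1..D}"
  shows "sq (E i + E j) \<in> L"
proof -
  obtain \<sigma> where \<sigma>: "\<sigma> permutes {1..D}" "map \<sigma> [i, j] = [i', j']"
    using permutes_map_distinct[of "[i, j]" "[i', j']" "{1..D}"] assms by auto
  obtain t where t: "\<forall>x. \<forall>i\<in>{1..D}. pr (t x) (E (\<sigma> i)) = pr x (E i)"
    and L: "(\<lambda>x y. sq (E i' + E j') (t x) (t y)) \<in> L"
    using L_perm[OF \<sigma>(1) assms(1)] by blast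
  have e: "pr (t x) (E i') = pr x (E i)" "pr (t x) (E j') = pr x (E j)" for x
    using t assms \<sigma>(2) by auto
  from L show ?thesis by (simp add: sq_def e)
qed

lemma four_cycle_all:
  assumes "wedge (E i' + E j') (E k' + E l') \<in> L" "distinct [i', j', k', l']"
    "{i', j', k', l'} \<subseteq> {1..D}" "distinct [i, j, k, l]" "{i, j, k, l} \<subseteq> {1..D}"
  shows "wedge (E i + E j) (E k + E l) \<in> L"
proof -
  have "\<exists>\<sigma>. \<sigma> permutes {1..D} \<and> map \<sigma> [i, j, k, l] = [i', j', k', l']"
    by (rule permutes_map_distinct) (use assms in simp_all)
  then obtain \<sigma> where \<sigma>: "\<sigma> permutes {1..D}" "map \<sigma> [i, j, k, l] = [i', j', k', l']" by (elim exE conjE)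
  show ?thesis by (rule wedge_perm[OF assms(1) \<sigma>(2,1) assms(5)])
qed

lemma triangle_all:
  assumes "wedge (E i' + E j') (E i' + E k') \<in> L" "distinct [i', j', k']"
    "{i', j', k'} \<subseteq> {1..D}" "distinct [i, j, k]" "{i, j, k} \<subseteq> {1..D}"
  shows "wedge (E i + E j) (E i + E k) \<in> L"
proof -
  obtain \<sigma> where "\<sigma> permutes {1..D}" "map \<sigma> [i, j, k] = [i', j', k']"
    using permutes_map_distinct[of "[i, j, k]" "[i', j', k']" "{1..D}"] assms by auto
  then show ?thesis using wedge_perm[OF assms(1), of \<sigma> i j i k] assms by auto
qed

lemma alt_mem_if_triangles:
  assumes tri: "\<And>i j. i \<in> {2..D} \<Longrightarrow> j \<in> {2..D} \<Longrightarrow> i \<noteq> j \<Longrightarrow> wedge (E 1 + E i) (E 1 + E j) \<in> L"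
    and \<beta>: "alt_form \<beta>"
  shows "\<beta> \<in> L"
  using \<beta> by (rule alt_form_induct[where P = "\<lambda>\<beta>. \<beta> \<in> L"]) (use L_0 L_plus tri in blast)+

lemma alt_mem_if_triangle:
  assumes "wedge (E i + E j) (E i + E k) \<in> L" "distinct [i, j, k]" "{i, j, k} \<subseteq> {1..D}"
    and "alt_form \<beta>"
  shows "\<beta> \<in> L"
proof (rule alt_mem_if_triangles[OF _ assms(4)])
  fix a b assume "a \<in> {2..D}" "b \<in> {2..D}" "a \<noteq> b"
  then show "wedge (E 1 + E a) (E 1 + E b) \<in> L"
    by (intro triangle_all[OF assms(1-3)]) auto
qed

text \<open>Expanding \<open>sq (u + w)\<close> turns three squares into a triangle, which yields
  the alternating forms; squares then correct the diagonal.\<close>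

lemma sym_mem_if_sq:
  assumes "sq (E i + E j) \<in> L" "i \<noteq> j" "{i, j} \<subseteq> {1..D}" and \<beta>: "sym_form \<beta>"
  shows "\<beta> \<in> L"
proof -
  have sq: "sq (E a + E b) \<in> L" if "a \<noteq> b" "{a, b} \<subseteq> {1..D}" for a b
    using sq_perm[OF assms(1-3) that] .
  have "wedge (E 1 + E 2) (E 1 + E 3) = sq (E 2 + E 3) + (sq (E 1 + E 2) + sq (E 1 + E 3))"
    by (simp add: sq_add ac_simps wedge_commute[of "E 2"])
  then have tri: "wedge (E 1 + E 2) (E 1 + E 3) \<in> L"
    using D_ge by (auto intro!: L_plus sq)
  \<comment> \<open>On the basis \<open>E 2\<close>, ..., \<open>E D\<close> the diagonal of
    \<open>sq (E 1 + E k)\<close> is dual to \<open>E k\<close>, so \<open>\<gamma>\<close> has the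
    diagonal of \<open>\<beta>\<close>.\<close>
  define \<gamma> where "\<gamma> = (\<Sum>k\<in>{2..D}. if \<beta> (E k) (E k) = 1 then sq (E 1 + E k) else 0)"
  have \<gamma>: "sym_form \<gamma>" unfolding \<gamma>_def
    by (intro sym_form_sum) (auto simp: sym_form_0 sym_form_sq)
  have "\<beta> x x = \<gamma> x x" for x
  proof (rule bit_functional_eqI[of "\<lambda>x. \<beta> x x" "\<lambda>x. \<gamma> x x"])
    fix i assume i: "i \<in> {2..D}"
    have "\<gamma> (E i) (E i) = (\<Sum>k\<in>{2..D}. if k = i then \<beta> (E k) (E k) else 0)"
      unfolding \<gamma>_def sum_fun_apply
      by (rule sum.cong) (use i in \<open>auto simp: sq_def pr_E\<close>)
    then show "\<beta> (E i) (E i) = \<gamma> (E i) (E i)" using i by simp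
  qed (fact sym_form_diag[OF \<beta>] sym_form_diag[OF \<gamma>])+
  then have "alt_form (\<beta> + \<gamma>)" by (rule alt_form_plusI[OF \<beta> \<gamma>])
  then have "\<beta> + \<gamma> \<in> L"
    using D_ge by (intro alt_mem_if_triangle[OF tri]) auto
  moreover have "\<gamma> \<in> L" unfolding \<gamma>_def
    by (intro L_sum) (auto intro!: L_0 sq)
  ultimately show ?thesis by (rule L_cancel)
qed

text \<open>Up to a multiple of \<open>E i + E j\<close>, a vector orthogonal to it is a sum of
  vectors \<open>E m + E k\<close> with \<open>m\<close> and \<open>k\<close> outside
  \<open>{i, j}\<close>, and each of these gives a four-cycle.\<close>

lemma wedge_orth_mem:
  assumes four: "\<And>k l. distinct [i, j, k, l] \<Longrightarrow> {k, l} \<subseteq> {1..D} \<Longrightarrow> wedge (E i + E j) (E k + E l) \<in> L"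
    and ij: "i \<noteq> j" "{i, j} \<subseteq> {1..D}" and b: "pr b (E i + E j) = 0"
  shows "wedge (E i + E j) b \<in> L"
proof -
  let ?p = "E i + E j"
  have "card ({1..D} - {i, j}) > 0" using ij D_ge by (simp add: card_Diff_subset)
  then obtain k where k: "k \<in> {1..D}" "k \<noteq> i" "k \<noteq> j" by (metis DiffE card_gt_0_iff ex_in_conv insertCI)
  let ?f = "\<lambda>m. if pr b (E m) = 1 then wedge ?p (E m + E k) else 0"
  have "wedge ?p b = (\<Sum>m\<in>{1..D} - {i, j, k}. ?f m)"
  proof (intro ext)
    fix x y
    define \<phi> where "\<phi> = (\<lambda>b. wedge ?p b x y)"
    have \<phi>: "bit_functional \<phi>" by (simp add: bit_functional_def \<phi>_def)
    \<comment> \<open>The coordinates of \<open>b\<close> sum to zero, so a zero multiple of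
      \<open>\<phi> (E k)\<close> can be added; it joins \<open>E k\<close> to every
      \<open>E m\<close>.\<close>
    have "\<phi> b = (\<Sum>m\<in>{1..D}. pr b (E m) * \<phi> (E m)) + (\<Sum>m\<in>{1..D}. pr b (E m)) * \<phi> (E k)"
      using bit_functional_expand[OF \<phi>, of b] sum_pr_E[of b] by simp
    also have "\<dots> = (\<Sum>m\<in>{1..D}. pr b (E m) * \<phi> (E m + E k))"
      by (simp add: sum_distrib_right sum.distrib[symmetric] bit_functional_add[OF \<phi>] distrib_left)
    also have "\<dots> = (\<Sum>m\<in>{1..D} - {i, j, k}. pr b (E m) * \<phi> (E m + E k)) +
        (\<Sum>m\<in>{i, j, k}. pr b (E m) * \<phi> (E m + E k))"
      by (rule sum.subset_diff) (use ij k in auto)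
    also have "(\<Sum>m\<in>{i, j, k}. pr b (E m) * \<phi> (E m + E k)) = pr b (E i) * \<phi> ?p"
      using ij k b by (simp add: bit_functional_add[OF \<phi>] algebra_simps bit_add_eq_0_iff)
    also have "\<phi> ?p = 0" by (simp only: \<phi>_def wedge_self zero_fun_apply)
    also have "(\<Sum>m\<in>{1..D} - {i, j, k}. pr b (E m) * \<phi> (E m + E k)) =
        (\<Sum>m\<in>{1..D} - {i, j, k}. ?f m) x y"
      unfolding sum_fun_apply by (rule sum.cong) (auto simp: \<phi>_def)
    finally show "wedge ?p b x y = (\<Sum>m\<in>{1..D} - {i, j, k}. ?f m) x y" by (simp add: \<phi>_def)
  qed
  also have "\<dots> \<in> L"
    by (intro L_sum) (use ij k in \<open>auto intro!: L_0 four simp del: wedge_add\<close>)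
  finally show ?thesis .
qed

text \<open>The diagonal is 1 at some \<open>E i\<close>, but not at all of them, since its values
  sum to zero over an odd index set. A shear along \<open>v = E i + E j\<close> with different
  values at \<open>i\<close> and \<open>j\<close> has the diagonal of \<open>sq v\<close>.\<close>

lemma all_sym_mem_if_not_alt:
  assumes alt: "\<And>\<gamma>. alt_form \<gamma> \<Longrightarrow> \<gamma> \<in> L" and \<beta>: "\<beta> \<in> L" "\<beta> x x \<noteq> 0" and \<gamma>: "sym_form \<gamma>"
  shows "\<gamma> \<in> L"
proof -
  note s = L_sym[OF \<beta>(1)]
  note d = sym_form_diag[OF s]
  have "\<exists>i\<in>{1..D}. \<beta> (E i) (E i) = 1"
  proof (rule ccontr)
    assume "\<not> ?thesis"
    then have "(\<Sum>i\<in>{1..D}. pr x (E i) * \<beta> (E i) (E i)) = 0" by (intro sum.neutral) simp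
    then show False using bit_functional_expand[OF d, of x] \<beta>(2) by simp
  qed
  then obtain i where i: "i \<in> {1..D}" "\<beta> (E i) (E i) = 1" by blast
  have "\<exists>j\<in>{1..D}. \<beta> (E j) (E j) = 0"
  proof (rule ccontr)
    assume "\<not> ?thesis"
    then have "(\<Sum>j\<in>{1..D}. \<beta> (E j) (E j)) = (\<Sum>j\<in>{1..D}. 1)" by (intro sum.cong) auto
    then show False using sum_functional_E[OF d] odd_D by (simp add: of_nat_bit)
  qed
  then obtain j where j: "j \<in> {1..D}" "\<beta> (E j) (E j) = 0" by blast
  let ?v = "E i + E j"
  have ij: "i \<noteq> j" using i j by auto
  have sh: "shear ?v \<beta> \<in> L" by (rule L_shear) (use i j ij \<beta> in auto)
  have "\<beta> ?v ?v = 1" using i j bit_functional_add[OF d] by simp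
  then have "alt_form (sq ?v + shear ?v \<beta>)"
    by (intro alt_form_plusI sym_form_sq sym_form_shear s) (simp only: shear_diag[OF s], simp add: sq_def)
  then have "sq ?v \<in> L" using alt sh L_cancel by blast
  then show ?thesis using sym_mem_if_sq ij i j \<gamma> by auto
qed

text \<open>The square of a lift of the transposition \<open>(1 2)\<close> yields the assumption. If \<open>b\<close> represents \<open>B v\<close>,
  where \<open>v = E 1 + E 2\<close>, the form is \<open>wedge v b\<close>, plus \<open>sq v\<close> if \<open>\<langle>b, v\<rangle> = 0\<close>; shears then
  produce some \<open>wedge (E i + E j) (E k + E l)\<close> or \<open>sq v\<close>.\<close>

lemma alt_mem_from_square:
  assumes X: "sq (E 1 + E 2) + shear (E 1 + E 2) B \<in> L" and B: "sym_form B" and \<beta>: "alt_form \<beta>"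
  shows "\<beta> \<in> L"
proof -
  let ?p = "E 1 + E 2"
  have D: "1 \<in> {1..D}" "2 \<in> {1..D}" "3 \<in> {1..D}" "4 \<in> {1..D}" "5 \<in> {1..D}"
    using D_ge by auto
  note pE = pr_E[OF D(1)] pr_E[OF D(2)] pr_E[OF D(3)] pr_E[OF D(4)] pr_E[OF D(5)]
  have pE1: "pr (E m) (E 1) = (if m = 1 then 0 else 1)" "pr (E m) (E 2) = (if m = 2 then 0 else 1)"
    if "m \<in> {1..D}" for m using that D by (simp_all add: pr_E)
  obtain b where b: "\<And>x. B ?p x = pr b x"
    using bit_functional_represent[OF sym_form_functional[OF B]] by blast
  have X': "sq ?p + (wedge ?p b + (if pr b ?p = 1 then sq ?p else 0)) \<in> L"
    using X unfolding shear_eq[OF B b] .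
  have D1: "{1..D} = {1, 2} \<union> {3..D}" using D_ge by auto
  have s: "pr b (E 1) + pr b (E 2) + (\<Sum>k\<in>{3..D}. pr b (E k)) = 0"
    using sum_pr_E[of b] unfolding D1 by (subst (asm) sum.union_disjoint) auto
  have "sq ?p \<in> L \<or> (\<exists>i j k l. wedge (E i + E j) (E k + E l) \<in> L \<and> distinct [i, j, k, l] \<and>
      {i, j, k, l} \<subseteq> {1..D})"
  proof (cases "\<exists>k\<in>{3..D}. \<exists>l\<in>{3..D}. pr b (E k) \<noteq> pr b (E l)")
    case True
    then obtain k l where kl: "k \<in> {3..D}" "l \<in> {3..D}" "pr b (E k) \<noteq> pr b (E l)" by blast
    \<comment> \<open>The support of \<open>?v\<close> is disjoint from \<open>{1, 2}\<close>: the
      shear kills the square of \<open>?p\<close> and turns the wedge into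
      \<open>wedge ?p ?v\<close>.\<close>
    let ?v = "E k + E l"
    have kl': "k \<in> {1..D}" "l \<in> {1..D}" "k \<noteq> l" using kl by auto
    have pv: "pr ?p ?v = 0" using kl kl' pE by simp
    have bv: "pr b ?v = 1" using kl(3) by (simp add: bit_add_eq_1_iff)
    have "shear ?v (sq ?p + (wedge ?p b + (if pr b ?p = 1 then sq ?p else 0))) = wedge ?p ?v"
      using pv bv by (simp add: shear_plus shear_sq shear_wedge_orth del: wedge_add pr_add) (simp add: shear_def fun_eq_iff)
    then have "wedge ?p ?v \<in> L" using L_shear[OF kl' X'] by simp
    then show ?thesis using kl kl' D by (intro disjI2 exI conjI) auto
  next
    case False
    then obtain c where c: "\<And>k. k \<in> {3..D} \<Longrightarrow> pr b (E k) = c" by (metis (full_types))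
    \<comment> \<open>As \<open>D - 2\<close> is odd, the common value \<open>c\<close> is the sum
      of the coordinates at 1 and 2.\<close>
    have "(\<Sum>k\<in>{3..D}. pr b (E k)) = of_nat (D - 2) * c" using c by simp
    then have c': "pr b (E 1) + pr b (E 2) = c"
      using s odd_D D_ge by (cases c) (auto simp: of_nat_bit bit_add_eq_0_iff)
    have D2: "{2..D} = insert 2 {3..D}" using D_ge by auto
    show ?thesis
    proof (cases "c = 0")
      \<comment> \<open>Here \<open>b\<close> is 0 or \<open>?p\<close> modulo 2, so the wedge
        vanishes and the given form is the square.\<close>
      case 1: True
      let ?b = "if pr b (E 1) = 1 then ?p else 0"
      have e: "pr b (E 1) = pr b (E 2)" using c' 1 by (simp add: bit_add_eq_0_iff)
      have "pr x b = pr x ?b" for x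
      proof (rule bit_functional_eqI[OF pr_functional(2) pr_functional(2)])
        fix i assume "i \<in> {2..D}"
        then show "pr (E i) b = pr (E i) ?b"
          unfolding D2 using c 1 e D by (auto simp: pE1 pr_commute[of _ b])
      qed
      then have "wedge ?p b = wedge ?p ?b" by (intro wedge_cong) auto
      then have "wedge ?p b = 0" using wedge_self[of ?p] by (simp del: wedge_add)
      moreover have "pr b ?p = 0" using e by simp
      ultimately show ?thesis using X' by simp
    next
      \<comment> \<open>Now \<open>b\<close> is \<open>E 1\<close> or \<open>E 2\<close> modulo 2
        and pairs to 1 with \<open>?p\<close>, so the two squares cancel. Two shears spread the
        remaining wedge over four indices.\<close>
      case False
      then have 2: "c = 1" by simp
      have "wedge ?p b = wedge (E 1) (E 2)"
      proof (cases "pr b (E 1) = 0")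
        case 1: True
        have "pr x b = pr x (E 1)" for x
        proof (rule bit_functional_eqI[OF pr_functional(2) pr_functional(2)])
          fix i assume "i \<in> {2..D}"
          then show "pr (E i) b = pr (E i) (E 1)"
            unfolding D2 using c 1 c' 2 D by (auto simp: pE1 pr_commute[of _ b])
        qed
        then have "wedge ?p b = wedge ?p (E 1)" by (intro wedge_cong) auto
        then show ?thesis by (simp add: wedge_commute[of "E 2"])
      next
        case False
        then have b1: "pr b (E 1) = 1" by simp
        have "pr x b = pr x (E 2)" for x
        proof (rule bit_functional_eqI[OF pr_functional(2) pr_functional(2)])
          fix i assume "i \<in> {2..D}"
          then show "pr (E i) b = pr (E i) (E 2)"
            unfolding D2 using c b1 c' 2 D by (auto simp: pE1 pr_commute[of _ b])
        qed
        then have "wedge ?p b = wedge ?p (E 2)" by (intro wedge_cong) auto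
        then show ?thesis by simp
      qed
      moreover have "pr b ?p = 1" using c' 2 by simp
      ultimately have "wedge (E 1) (E 2) \<in> L" using X' by (simp add: ac_simps)
      then have "shear (E 2 + E 3) (wedge (E 1) (E 2)) \<in> L" using D by (intro L_shear) auto
      also have "shear (E 2 + E 3) (wedge (E 1) (E 2)) = wedge (E 2 + E 3) (E 1)"
        using D by (subst shear_wedge_orth) (simp_all add: pE wedge_commute[of "E 1"])
      finally have w: "wedge (E 2 + E 3) (E 1) \<in> L" .
      have "shear (E 1 + E 4) (wedge (E 2 + E 3) (E 1)) \<in> L"
        by (rule L_shear[OF _ _ _ w]) (use D in auto)
      also have "shear (E 1 + E 4) (wedge (E 2 + E 3) (E 1)) = wedge (E 2 + E 3) (E 1 + E 4)"
        using D by (subst shear_wedge_orth) (simp_all add: pE del: wedge_add)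
      finally have "wedge (E 2 + E 3) (E 1 + E 4) \<in> L \<and> distinct [2, 3, 1, 4 :: nat] \<and> {2, 3, 1, 4} \<subseteq> {1..D}"
        using D by (simp del: wedge_add)
      then show ?thesis by blast
    qed
  qed
  then show ?thesis
  proof
    assume "sq ?p \<in> L"
    then show ?thesis using sym_mem_if_sq[of 1 2] D alt_formD(1)[OF \<beta>] by auto
  next
    assume "\<exists>i j k l. wedge (E i + E j) (E k + E l) \<in> L \<and> distinct [i, j, k, l] \<and>
      {i, j, k, l} \<subseteq> {1..D}"
    then obtain i' j' k' l' where w: "wedge (E i' + E j') (E k' + E l') \<in> L"
      "distinct [i', j', k', l']" "{i', j', k', l'} \<subseteq> {1..D}" by (elim exE conjE)
    have four: "wedge (E i + E j) (E k + E l) \<in> L" if "distinct [i, j, k, l]" "{i, j, k, l} \<subseteq> {1..D}"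
      for i j k l by (rule four_cycle_all[OF w that])
    \<comment> \<open>Wedges of \<open>?p\<close> with orthogonal vectors are now available, so only
      the pairing of \<open>b\<close> with \<open>?p\<close> matters.\<close>
    have orth: "wedge ?p x \<in> L" if "pr x ?p = 0" for x
      by (rule wedge_orth_mem[OF four _ _ that]) (use D in simp_all)
    show ?thesis
    proof (cases "pr b ?p = 0")
      case True
      then have "sq ?p \<in> L" using X' orth[of b] by (simp del: wedge_add pr_add) (metis L_cancel)
      then show ?thesis using sym_mem_if_sq[of 1 2] D alt_formD(1)[OF \<beta>] by auto
    next
      case False
      then have w: "wedge ?p b \<in> L" using X' by (simp add: ac_simps del: wedge_add pr_add)
      \<comment> \<open>\<open>E 1 + E 3\<close> pairs with \<open>?p\<close> as \<open>b\<close>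
        does, so the triangle differs from \<open>wedge ?p b\<close> by an orthogonal wedge.\<close>
      have "pr (E 1 + E 3) ?p = 1" using D by (simp add: pE)
      then have "pr (b + (E 1 + E 3)) ?p = 0" using False by (simp only: pr_add(1)) simp
      then have "wedge ?p (E 1 + E 3) + wedge ?p b \<in> L"
        using orth[of "b + (E 1 + E 3)"] by (simp only: wedge_add(2) add.commute)
      then have "wedge ?p (E 1 + E 3) \<in> L" using w L_cancel by blast
      then show ?thesis using alt_mem_if_triangle[of 1 2 3] D \<beta> by auto
    qed
  qed
qed

text \<open>Modulo four-cycles, a wedge with \<open>E i + E j\<close> depends on one bit, the
  pairing with that vector, and a shear along it is 0 or triangle plus square. If such a shear is
  not 0, the given form is not alternating, and shearing it puts triangle plus square into
  \<open>L\<close>. In every case the wedge of \<open>E a\<close> and \<open>E b\<close> is left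
  over.\<close>

lemma alt_mem_from_commutator:
  assumes four: "\<And>i j k l. distinct [i, j, k, l] \<Longrightarrow> {i, j, k, l} \<subseteq> {1..D} \<Longrightarrow>
      wedge (E i + E j) (E k + E l) \<in> L"
    and X: "wedge (E a) (E b) + (shear (E b + E b') B + shear (E a + E a') B') \<in> L"
    and B: "sym_form B" "sym_form B'" and d: "distinct [a, b, a', b']" "{a, b, a', b'} \<subseteq> {1..D}"
    and \<beta>: "alt_form \<beta>"
  shows "\<beta> \<in> L"
proof -
  have dec: "wedge (E i + E j) c + (if pr c (E i + E j) = 1 then wedge (E i + E j) (E i + E k) else 0) \<in> L"
    if "distinct [i, j, k]" "{i, j, k} \<subseteq> {1..D}" for i j k c
  proof (cases "pr c (E i + E j) = 0")
    case True
    then have "wedge (E i + E j) c \<in> L" by (intro wedge_orth_mem[OF four]) (use that in simp_all)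
    then show ?thesis using True by (simp del: wedge_add pr_add)
  next
    case False
    have "pr (E i + E k) (E i + E j) = 1" using that by (auto simp: pr_E)
    then have "pr (c + (E i + E k)) (E i + E j) = 0" using False by (simp only: pr_add(1)) simp
    then have "wedge (E i + E j) (c + (E i + E k)) \<in> L"
      by (intro wedge_orth_mem[OF four]) (use that in simp_all)
    then show ?thesis using False by (simp only: wedge_add(2)) simp
  qed
  have shear_dec: "shear (E i + E j) \<gamma> +
      (if \<gamma> (E i + E j) (E i + E j) = 1 then wedge (E i + E j) (E i + E k) + sq (E i + E j) else 0) \<in> L"
    if \<gamma>: "sym_form \<gamma>" and ijk: "distinct [i, j, k]" "{i, j, k} \<subseteq> {1..D}" for i j k \<gamma>
  proof -
    obtain c where c: "\<And>x. \<gamma> (E i + E j) x = pr c x"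
      using bit_functional_represent[OF sym_form_functional[OF \<gamma>]] by blast
    show ?thesis
      using dec[OF ijk, of c] unfolding shear_eq[OF \<gamma> c] c
      by (simp add: ac_simps del: wedge_add pr_add split: if_splits)
  qed
  have "card ({1..D} - {a, b, a', b'}) > 0" using d D_ge by (simp add: card_Diff_subset)
  then obtain e where e: "e \<in> {1..D}" "e \<notin> {a, b, a', b'}"
    by (metis DiffE card_gt_0_iff ex_in_conv)
  let ?P = "\<lambda>i j k. wedge (E i + E j) (E i + E k) + sq (E i + E j)"
  let ?m = "B (E b + E b') (E b + E b') = 1" and ?m' = "B' (E a + E a') (E a + E a') = 1"
  note sb = shear_dec[OF B(1), of b b' e] and sa = shear_dec[OF B(2), of a a' e]
  have w: "wedge (E a) (E b) \<in> L"
  proof (cases "?m \<or> ?m'")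
    case False
    then have "shear (E b + E b') B \<in> L" "shear (E a + E a') B' \<in> L"
      using sb sa d e by auto
    then show ?thesis using X L_plus L_cancel by blast
  next
    case True
    let ?Y = "wedge (E a) (E b) + (shear (E b + E b') B + shear (E a + E a') B')"
    note sY = L_sym[OF X]
    have dg: "?Y x x = pr x (E b + E b') * B (E b + E b') (E b + E b') +
        pr x (E a + E a') * B' (E a + E a') (E a + E a')" for x
      using alt_formD(2)[OF alt_form_wedge] by (simp add: shear_diag[OF B(1)] shear_diag[OF B(2)] del: pr_add)
    have "\<exists>i j. i \<noteq> j \<and> {i, j} \<subseteq> {1..D} \<and> ?Y (E i + E j) (E i + E j) = 1"
    proof (cases ?m)
      case True
      \<comment> \<open>With a fifth index \<open>e\<close>, the vector \<open>E e + E b\<close>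
        detects \<open>{b, b'}\<close> and is orthogonal to \<open>E a + E a'\<close>.\<close>
      have "pr (E e + E b) (E b + E b') = 1" "pr (E e + E b) (E a + E a') = 0"
        using d e by (auto simp: pr_E)
      then show ?thesis using True d e unfolding dg
        by (intro exI[of _ e] exI[of _ b]) (simp del: pr_add)
    next
      case False
      then have m: ?m' using True by simp
      have "pr (E e + E a) (E b + E b') = 0" "pr (E e + E a) (E a + E a') = 1"
        using d e by (auto simp: pr_E)
      then show ?thesis using m d e unfolding dg
        by (intro exI[of _ e] exI[of _ a]) (simp del: pr_add)
    qed
    then obtain i j where ij: "i \<noteq> j" "{i, j} \<subseteq> {1..D}" "?Y (E i + E j) (E i + E j) = 1" by blast
    \<comment> \<open>The diagonal of \<open>?Y\<close> is 1 at \<open>E i + E j\<close>, so its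
      shear there reduces to triangle plus square.\<close>
    have P0: "?P i j k \<in> L" if "k \<in> {1..D}" "k \<noteq> i" "k \<noteq> j" for k
    proof -
      have "shear (E i + E j) ?Y \<in> L" by (rule L_shear[OF _ _ _ X]) (use ij in auto)
      moreover have "?P i j k + shear (E i + E j) ?Y \<in> L"
        using shear_dec[OF sY, of i j k] ij(1,2) that unfolding ij(3) by (simp add: ac_simps del: wedge_add)
      ultimately show ?thesis using L_cancel by blast
    qed
    have "card ({1..D} - {i, j}) > 0" using ij D_ge by (simp add: card_Diff_subset)
    then obtain k where k: "k \<in> {1..D}" "k \<noteq> i" "k \<noteq> j"
      by (metis DiffE card_gt_0_iff ex_in_conv insertCI)
    have P: "?P i' j' k' \<in> L" if ijk': "distinct [i', j', k']" "{i', j', k'} \<subseteq> {1..D}" for i' j' k'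
    proof -
      obtain \<sigma> where \<sigma>: "\<sigma> permutes {1..D}" "map \<sigma> [i', j', k'] = [i, j, k]"
        using permutes_map_distinct[of "[i', j', k']" "[i, j, k]" "{1..D}"] ij k ijk' by auto
      obtain t where t: "\<forall>x. \<forall>i\<in>{1..D}. pr (t x) (E (\<sigma> i)) = pr x (E i)"
        and L: "(\<lambda>x y. ?P i j k (t x) (t y)) \<in> L"
        using L_perm[OF \<sigma>(1) P0[OF k]] by blast
      have e: "pr (t x) (E i) = pr x (E i')" "pr (t x) (E j) = pr x (E j')" "pr (t x) (E k) = pr x (E k')" for x
        using t \<sigma>(2) ijk' by auto
      have "(\<lambda>x y. ?P i j k (t x) (t y)) = ?P i' j' k'"
        by (simp add: wedge_def sq_def fun_eq_iff e del: wedge_add)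
      with L show ?thesis by simp
    qed
    have "shear (E b + E b') B \<in> L"
      using sb P[of b b' e] d e by (cases ?m) (auto simp del: wedge_add dest: L_cancel)
    moreover have "shear (E a + E a') B' \<in> L"
      using sa P[of a a' e] d e by (cases ?m') (auto simp del: wedge_add dest: L_cancel)
    ultimately show ?thesis using X L_plus L_cancel by blast
  qed
  \<comment> \<open>\<open>wedge (E a) (E b)\<close> is also the wedge of \<open>E a + E b\<close>
    with \<open>E b\<close>; these two vectors pair to 1, so it reduces to a triangle.\<close>
  have "wedge (E a + E b) (E b) + wedge (E a + E b) (E a + E e) \<in> L"
    using dec[of a b e "E b"] d e by (auto simp: pr_E simp del: wedge_add)
  moreover have "wedge (E a + E b) (E b) \<in> L" using w by simp
  ultimately have "wedge (E a + E b) (E a + E e) \<in> L" by (metis L_cancel add.commute)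
  then show ?thesis using alt_mem_if_triangle[of a b e] d e \<beta> by auto
qed

end

section \<open>Isometries and their level forms\<close>

abbreviation invf :: "('a \<Rightarrow> 'a) \<Rightarrow> 'a \<Rightarrow> 'a" where
  "invf f \<equiv> inv_into UNIV f"

context odd_frame
begin

lemma torsion_free_power: "scale (2 ^ n) x = scale (2 ^ n) y \<Longrightarrow> x = y"
proof -
  have "scale (2 ^ n) z = 0 \<Longrightarrow> z = 0" for z
    by (induction n) (auto simp flip: scale_scale dest!: torsion_free)
  from this[of "x - y"] show "scale (2 ^ n) x = scale (2 ^ n) y \<Longrightarrow> x = y"
    by (simp add: scale_right_diff_distrib)
qed

lemma bit_functional_scale:
  assumes \<phi>: "bit_functional \<phi>" shows "\<phi> (scale r x) = residue_bit r * \<phi> x"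
proof (cases "residue_bit r = 0")
  case True
  then obtain s where "r = 2 * s" using residue_bit_eq_0_iff by blast
  then have "scale r x = scale 2 (scale s x)" by simp
  then show ?thesis using bit_functional_scale2[OF \<phi>, of "scale s x"] True by (simp only: mult_zero_left)
next
  case False
  then have "residue_bit (r - 1) = 0" by simp
  then obtain s where "r - 1 = 2 * s" using residue_bit_eq_0_iff by blast
  then have "r = 1 + 2 * s" by (simp add: algebra_simps)
  then have "scale r x = x + scale 2 (scale s x)" by (simp add: scale_left_distrib)
  then have "\<phi> (scale r x) = \<phi> x"
    by (simp only: bit_functional_add[OF \<phi>] bit_functional_scale2[OF \<phi>] add_0_right)
  then show ?thesis using False by simp
qed

lemma sym_form_scale:
  assumes "sym_form \<beta>"
  shows "\<beta> (scale r x) y = residue_bit r * \<beta> x y" "\<beta> y (scale r x) = residue_bit r * \<beta> y x"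
  using bit_functional_scale[OF sym_form_functional[OF assms]] sym_form_commute[OF assms] by metis+

lemma pr_eq_0D: "(\<And>y. pr x y = 0) \<Longrightarrow> \<exists>z. x = scale 2 z"
  by (rule nondegenerate) simp

definition isom :: "('v \<Rightarrow> 'v) \<Rightarrow> bool" where
  "isom f \<longleftrightarrow> bij f \<and> module_hom scale scale f \<and> (\<forall>x y. form (f x) (f y) = form x y)"

lemma isom_bij: "isom f \<Longrightarrow> bij f"
  and isom_add: "isom f \<Longrightarrow> f (x + y) = f x + f y"
  and isom_scale: "isom f \<Longrightarrow> f (scale r x) = scale r (f x)"
  and isom_form: "isom f \<Longrightarrow> form (f x) (f y) = form x y"
  by (auto simp: isom_def module_hom.add module_hom.scale)

lemma isom_pr: "isom f \<Longrightarrow> pr (f x) (f y) = pr x y"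
  by (simp add: pr_def isom_form)

lemma isom_inv_apply: "isom f \<Longrightarrow> invf f (f x) = x" "isom f \<Longrightarrow> f (invf f x) = x"
  by (simp_all add: isom_bij bij_is_inj bij_is_surj surj_f_inv_f)

lemma isomI:
  assumes "bij f" "\<And>x y. f (x + y) = f x + f y" "\<And>r x. f (scale r x) = scale r (f x)"
    "\<And>x y. form (f x) (f y) = form x y"
  shows "isom f"
  unfolding isom_def using assms by (auto intro!: module_hom.intro module_hom_axioms.intro module_axioms)

lemma isom_id: "isom id"
  by (rule isomI) simp_all

lemma isom_comp: "isom f \<Longrightarrow> isom g \<Longrightarrow> isom (f \<circ> g)"
  by (rule isomI) (auto simp: bij_comp isom_bij isom_add isom_scale isom_form)

lemma isom_inv: "isom f \<Longrightarrow> isom (invf f)"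
proof (rule isomI)
  assume f: "isom f"
  have inj: "f a = f b \<Longrightarrow> a = b" for a b by (metis f isom_inv_apply(1))
  show "bij (invf f)" using f by (simp add: isom_bij bij_imp_bij_inv)
  show "invf f (x + y) = invf f x + invf f y" for x y
    by (rule inj) (simp add: f isom_add isom_inv_apply)
  show "invf f (scale r x) = scale r (invf f x)" for r x
    by (rule inj) (simp add: f isom_scale isom_inv_apply)
  show "form (invf f x) (invf f y) = form x y" for x y
    by (metis f isom_form isom_inv_apply(2))
qed

lemma isom_inv_adjoint: "isom f \<Longrightarrow> form (invf f x) y = form x (f y)"
  by (metis isom_form isom_inv_apply(2))

lemma pr_inv_adjoint: "isom f \<Longrightarrow> pr (invf f x) y = pr x (f y)"
  by (simp add: pr_def isom_inv_adjoint)

lemma isom_inv_comp: "isom f \<Longrightarrow> isom g \<Longrightarrow> invf (f \<circ> g) = invf g \<circ> invf f"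
  by (simp add: o_inv_distrib isom_bij)

text \<open>\<open>gam n f\<close> says \<open>f \<in> \<Gamma>(2\<^sup>n)\<close>. Then \<open>f = 1 + 2\<^sup>n lev n f\<close>, and \<open>lv n f\<close> is the class of \<open>f\<close>
  in \<open>\<Gamma>(2\<^sup>n)/\<Gamma>(2\<^sup>n\<^sup>+\<^sup>1)\<close> viewed as a symmetric form.\<close>

definition gam :: "nat \<Rightarrow> ('v \<Rightarrow> 'v) \<Rightarrow> bool" where
  "gam n f \<longleftrightarrow> isom f \<and> (\<forall>x. \<exists>z. f x = x + scale (2 ^ n) z)"

definition lev :: "nat \<Rightarrow> ('v \<Rightarrow> 'v) \<Rightarrow> 'v \<Rightarrow> 'v" where
  "lev n f x = (SOME z. f x = x + scale (2 ^ n) z)"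

definition lv :: "nat \<Rightarrow> ('v \<Rightarrow> 'v) \<Rightarrow> 'v \<Rightarrow> 'v \<Rightarrow> bit" where
  "lv n f = (\<lambda>x y. pr (lev n f x) y)"

lemma gam_isom: "gam n f \<Longrightarrow> isom f"
  by (simp add: gam_def)

lemma gamI: "isom f \<Longrightarrow> (\<And>x. f x = x + scale (2 ^ n) (A x)) \<Longrightarrow> gam n f"
  by (auto simp: gam_def)

lemma lev_eq: "gam n f \<Longrightarrow> f x = x + scale (2 ^ n) (lev n f x)"
  unfolding gam_def lev_def by (rule someI_ex) blast

lemma lev_unique: "gam n f \<Longrightarrow> f x = x + scale (2 ^ n) z \<Longrightarrow> lev n f x = z"
  using lev_eq[of n f x] by (auto intro: torsion_free_power)

lemma lv_unique: "gam n f \<Longrightarrow> f x = x + scale (2 ^ n) z \<Longrightarrow> lv n f x y = pr z y"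
  by (simp add: lv_def lev_unique)

lemma lev_add: "gam n f \<Longrightarrow> lev n f (x + y) = lev n f x + lev n f y"
proof (rule lev_unique)
  assume f: "gam n f"
  have "f (x + y) = f x + f y" by (rule isom_add[OF gam_isom[OF f]])
  also have "\<dots> = x + scale (2 ^ n) (lev n f x) + (y + scale (2 ^ n) (lev n f y))"
    by (subst (1 2) lev_eq[OF f]) simp
  finally show "f (x + y) = x + y + scale (2 ^ n) (lev n f x + lev n f y)"
    by (simp add: scale_right_distrib ac_simps)
qed

lemma lev_scale: "gam n f \<Longrightarrow> lev n f (scale r x) = scale r (lev n f x)"
proof (rule lev_unique)
  assume f: "gam n f"
  have "f (scale r x) = scale r (f x)" by (rule isom_scale[OF gam_isom[OF f]])
  also have "\<dots> = scale r (x + scale (2 ^ n) (lev n f x))"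
    by (subst lev_eq[OF f]) simp
  finally show "f (scale r x) = scale r x + scale (2 ^ n) (scale r (lev n f x))"
    by (simp add: scale_right_distrib mult.commute)
qed

text \<open>Invariance of the form, expanded and divided exactly by \<open>2^n\<close>. For
  \<open>n > 0\<close> its reduction modulo 2 is the symmetry of \<open>lv n f\<close>;
  \<open>lv_quartic\<close> uses the full 2-adic identity.\<close>

lemma lev_form:
  assumes f: "gam n f"
  shows "form (lev n f x) y + form x (lev n f y) + 2 ^ n * form (lev n f x) (lev n f y) = 0"
proof -
  let ?A = "lev n f"
  have "form (x + scale (2 ^ n) (?A x)) (y + scale (2 ^ n) (?A y)) = form x y"
    using isom_form[OF gam_isom[OF f], of x y] unfolding lev_eq[OF f, of x] lev_eq[OF f, of y] .
  then have "2 ^ n * (form (?A x) y + form x (?A y) + 2 ^ n * form (?A x) (?A y)) = 2 ^ n * 0"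
    by (simp add: algebra_simps)
  then show ?thesis by (rule two_adic_power_mult_cancel)
qed

lemma sym_form_lv: "gam n f \<Longrightarrow> n > 0 \<Longrightarrow> sym_form (lv n f)"
proof -
  assume f: "gam n f" and n: "n > 0"
  have "lv n f x y = lv n f y x" for x y
  proof -
    have "residue_bit (form (lev n f x) y + form x (lev n f y) + 2 ^ n * form (lev n f x) (lev n f y)) = 0"
      by (simp only: lev_form[OF f] residue_bit_0)
    then have "pr (lev n f x) y + pr x (lev n f y) = 0"
      using n by (simp add: residue_bit_power pr_def)
    then show ?thesis by (simp add: lv_def bit_add_eq_0_iff pr_commute[of x])
  qed
  then show ?thesis
    by (simp add: sym_form_def bit_functional_def lv_def)
qed

lemma gam_id: "gam n id"
  by (rule gamI[where A = "\<lambda>_. 0"]) (simp_all add: isom_id)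

lemma lv_id: "lv n id = 0"
  by (intro ext) (simp add: lv_unique[OF gam_id[of n], of _ 0])

lemma gam_comp:
  assumes f: "gam n f" and g: "gam n g"
  shows "gam n (f \<circ> g)"
    and "lev n (f \<circ> g) x = lev n f x + lev n g x + scale (2 ^ n) (lev n f (lev n g x))"
proof -
  let ?A = "\<lambda>x. lev n f x + lev n g x + scale (2 ^ n) (lev n f (lev n g x))"
  have e: "(f \<circ> g) x = x + scale (2 ^ n) (?A x)" for x
  proof -
    have "(f \<circ> g) x = f (x + scale (2 ^ n) (lev n g x))" by (simp flip: lev_eq[OF g])
    also have "\<dots> = x + scale (2 ^ n) (lev n g x) +
        scale (2 ^ n) (lev n f (x + scale (2 ^ n) (lev n g x)))" by (rule lev_eq[OF f])
    finally show ?thesis by (simp add: lev_add[OF f] lev_scale[OF f] scale_right_distrib ac_simps)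
  qed
  show c: "gam n (f \<circ> g)"
    by (rule gamI[of "f \<circ> g", OF _ e]) (simp add: isom_comp gam_isom[OF f] gam_isom[OF g])
  show "lev n (f \<circ> g) x = ?A x" by (rule lev_unique[OF c e])
qed

lemma lv_comp: "gam n f \<Longrightarrow> gam n g \<Longrightarrow> n > 0 \<Longrightarrow> lv n (f \<circ> g) = lv n f + lv n g"
  by (intro ext) (simp add: lv_def gam_comp(2) residue_bit_power)

lemma gam_inv: "gam n f \<Longrightarrow> gam n (invf f)"
proof (rule gamI)
  assume f: "gam n f"
  show "isom (invf f)" by (rule isom_inv[OF gam_isom[OF f]])
  fix x
  have "x = f (invf f x)" by (simp add: isom_inv_apply gam_isom[OF f])
  also have "\<dots> = invf f x + scale (2 ^ n) (lev n f (invf f x))" by (rule lev_eq[OF f])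
  finally show "invf f x = x + scale (2 ^ n) (- lev n f (invf f x))"
    by (simp add: eq_diff_eq)
qed

lemma lv_inv: "gam n f \<Longrightarrow> n > 0 \<Longrightarrow> lv n (invf f) = lv n f"
proof -
  assume f: "gam n f" and n: "n > 0"
  have "invf f \<circ> f = id" by (simp add: fun_eq_iff isom_inv_apply gam_isom[OF f])
  then have "lv n (invf f) + lv n f = 0"
    using lv_comp[OF gam_inv[OF f] f n] by (simp add: lv_id)
  then show ?thesis by (simp add: fun_eq_iff bit_add_eq_0_iff)
qed

lemma gam_conj:
  assumes t: "isom t" and f: "gam n f"
  shows "gam n (invf t \<circ> f \<circ> t)" "lv n (invf t \<circ> f \<circ> t) = (\<lambda>x y. lv n f (t x) (t y))"
proof -
  have e: "(invf t \<circ> f \<circ> t) x = x + scale (2 ^ n) (invf t (lev n f (t x)))" for x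
    using lev_eq[OF f, of "t x"]
    by (simp add: isom_add[OF isom_inv[OF t]] isom_scale[OF isom_inv[OF t]] isom_inv_apply t)
  show c: "gam n (invf t \<circ> f \<circ> t)"
    by (rule gamI[of "invf t \<circ> f \<circ> t", OF _ e]) (intro isom_comp isom_inv t gam_isom[OF f])
  show "lv n (invf t \<circ> f \<circ> t) = (\<lambda>x y. lv n f (t x) (t y))"
    by (intro ext) (simp only: lv_unique[OF c e] pr_inv_adjoint[OF t], simp add: lv_def)
qed

text \<open>A vanishing level form makes every \<open>lev n f x\<close> orthogonal to everything
  modulo 2, hence divisible by 2.\<close>

lemma gam_Suc_iff: "n > 0 \<Longrightarrow> gam (Suc n) f \<longleftrightarrow> gam n f \<and> lv n f = 0"
proof safe
  assume f: "gam (Suc n) f" and n: "n > 0"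
  have e: "f x = x + scale (2 ^ n) (scale 2 (lev (Suc n) f x))" for x
    using lev_eq[OF f, of x] by (simp add: mult.commute)
  show g: "gam n f" by (rule gamI[OF gam_isom[OF f] e])
  show "lv n f = 0" by (intro ext) (simp add: lv_unique[OF g e])
next
  assume f: "gam n f" and l: "lv n f = 0"
  have "\<exists>z. lev n f x = scale 2 z" for x
    by (rule pr_eq_0D) (use l in \<open>simp add: lv_def fun_eq_iff\<close>)
  then obtain A where A: "\<And>x. lev n f x = scale 2 (A x)" by metis
  show "gam (Suc n) f"
    by (rule gamI[OF gam_isom[OF f], where A = A]) (subst lev_eq[OF f], simp add: A mult.commute)
qed

lemma gam_antimono: "gam n f \<Longrightarrow> m \<le> n \<Longrightarrow> gam m f"
proof (rule gamI)
  assume f: "gam n f" and m: "m \<le> n"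
  show "isom f" by (rule gam_isom[OF f])
  have "(2::two_adic) ^ n = 2 ^ m * 2 ^ (n - m)" using m by (simp flip: power_add)
  then show "f x = x + scale (2 ^ m) (scale (2 ^ (n - m)) (lev n f x))" for x
    by (subst lev_eq[OF f]) simp
qed

text \<open>Level forms add under composition; this drives the successive approximations
  below.\<close>

lemma gam_Suc_if_lv_eq:
  assumes "gam n f" "gam n g" "n > 0" "lv n f = lv n g"
  shows "gam (Suc n) (invf g \<circ> f)"
  using assms by (simp add: gam_Suc_iff gam_comp gam_inv lv_comp lv_inv)

lemma gam_pr: "gam n f \<Longrightarrow> n > 0 \<Longrightarrow> pr (f x) y = pr x y"
  using lev_eq[of n f x] by (simp add: residue_bit_power)

lemma pr_gam: "gam n f \<Longrightarrow> n > 0 \<Longrightarrow> pr y (f x) = pr y x"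
  using lev_eq[of n f x] by (simp add: residue_bit_power)

text \<open>In \<open>(1 + 2^n A)^2 = 1 + 2^(n+1) (A + 2^(n-1) A^2)\<close> the quadratic term is
  even once \<open>n\<close> is at least 2.\<close>

lemma lv_square:
  assumes f: "gam n f" and n: "n \<ge> 2"
  shows "gam (Suc n) (f \<circ> f)" "lv (Suc n) (f \<circ> f) = lv n f"
proof -
  have "scale (2 ^ n) (lev n f x + lev n f x + scale (2 ^ n) (lev n f (lev n f x))) =
      scale (2 ^ Suc n) (lev n f x + scale (2 ^ (n - 1)) (lev n f (lev n f x)))" for x
  proof -
    have "(2::two_adic) ^ n = 2 * 2 ^ (n - 1)" using n by (simp flip: power_Suc)
    then have "lev n f x + lev n f x + scale (2 ^ n) (lev n f (lev n f x)) =
        scale 2 (lev n f x + scale (2 ^ (n - 1)) (lev n f (lev n f x)))"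
      by (simp add: scale_right_distrib) (metis one_add_one scale_left_distrib scale_one)
    then show ?thesis by (simp add: mult.commute)
  qed
  then have e: "(f \<circ> f) x = x + scale (2 ^ Suc n) (lev n f x + scale (2 ^ (n - 1)) (lev n f (lev n f x)))" for x
    using lev_eq[OF gam_comp(1)[OF f f]] gam_comp(2)[OF f f] by simp
  show c: "gam (Suc n) (f \<circ> f)" by (rule gamI[of "f \<circ> f", OF _ e]) (intro isom_comp gam_isom[OF f])
  show "lv (Suc n) (f \<circ> f) = lv n f"
    by (intro ext) (use n in \<open>simp only: lv_unique[OF c e], simp add: lv_def residue_bit_power\<close>)
qed

lemma lv_square_1:
  assumes f: "gam 1 f"
  shows "gam 2 (f \<circ> f)" "lv 2 (f \<circ> f) x y = lv 1 f x y + lv 1 f (lev 1 f x) y"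
    "(f \<circ> f) x = x + scale 4 (lev 1 f x + lev 1 f (lev 1 f x))"
proof -
  have e: "(f \<circ> f) x = x + scale (2 ^ 2) (lev 1 f x + lev 1 f (lev 1 f x))" for x
  proof -
    have "(f \<circ> f) x = x + scale 2 (lev 1 f x + lev 1 f x + scale 2 (lev 1 f (lev 1 f x)))"
      using lev_eq[OF gam_comp(1)[OF f f], of x] gam_comp(2)[OF f f, of x] by simp
    also have "lev 1 f x + lev 1 f x = scale 2 (lev 1 f x)"
      by (metis one_add_one scale_left_distrib scale_one)
    finally show ?thesis by (simp add: scale_right_distrib)
  qed
  show c: "gam 2 (f \<circ> f)" by (rule gamI[of "f \<circ> f", OF _ e]) (intro isom_comp gam_isom[OF f])
  show "lv 2 (f \<circ> f) x y = lv 1 f x y + lv 1 f (lev 1 f x) y"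
    by (simp only: lv_unique[OF c e], simp add: lv_def)
  show "(f \<circ> f) x = x + scale 4 (lev 1 f x + lev 1 f (lev 1 f x))"
    using e[of x] by simp
qed

section \<open>Transvections, and the level forms of squares and commutators\<close>

definition tv :: "two_adic \<Rightarrow> 'v \<Rightarrow> 'v \<Rightarrow> 'v" where
  "tv r u = (\<lambda>x. x + scale (r * form x u) u)"

lemma tv_comp: "tv r u \<circ> tv s u = tv (r + s) u"
  by (simp add: tv_def fun_eq_iff form_alternating algebra_simps scale_left_distrib)

lemma tv_commute: "form u w = 0 \<Longrightarrow> tv r u \<circ> tv s w = tv s w \<circ> tv r u"
  using form_commute[of w u] by (simp add: tv_def fun_eq_iff algebra_simps)

lemma isom_tv: "isom (tv r u)"
proof (rule isomI)
  have "tv 0 u = id" by (simp add: tv_def fun_eq_iff)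
  then have "tv r u \<circ> tv (- r) u = id" "tv (- r) u \<circ> tv r u = id"
    by (simp_all add: tv_comp)
  then show "bij (tv r u)" using o_bij by blast
  show "form (tv r u x) (tv r u y) = form x y" for x y
    using form_commute[of u y] by (simp add: tv_def form_alternating algebra_simps)
qed (simp_all add: tv_def algebra_simps scale_right_distrib scale_left_distrib)

lemma pr_tv: "pr (tv r u x) y = pr x y + residue_bit r * pr x u * pr u y"
  by (simp add: tv_def pr_def)

lemma gam_tv: "gam n (tv (2 ^ n) u)" "lv n (tv (2 ^ n) u) = sq u"
proof -
  have e: "tv (2 ^ n) u x = x + scale (2 ^ n) (scale (form x u) u)" for x
    by (simp add: tv_def)
  show c: "gam n (tv (2 ^ n) u)" by (rule gamI[OF isom_tv e])
  show "lv n (tv (2 ^ n) u) = sq u"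
    by (intro ext) (simp only: lv_unique[OF c e], simp add: sq_def pr_def[symmetric] pr_commute[of u])
qed

lemma shear_eq_tv:
  assumes "sym_form \<beta>" shows "shear p \<beta> = (\<lambda>x y. \<beta> (tv 1 p x) (tv 1 p y)) + \<beta>"
  by (simp add: shear_def tv_def fun_eq_iff sym_form_add[OF assms] sym_form_scale[OF assms]
      algebra_simps pr_def)

text \<open>By nondegeneracy, this is congruence of \<open>f\<close> and \<open>g\<close> modulo
  \<open>2V\<close>.\<close>

definition sim :: "('v \<Rightarrow> 'v) \<Rightarrow> ('v \<Rightarrow> 'v) \<Rightarrow> bool" where
  "sim f g \<longleftrightarrow> (\<forall>x y. pr (f x) y = pr (g x) y)"

lemma simI:
  assumes "isom f" "isom g" "\<And>i y. i \<in> {1..D} \<Longrightarrow> pr (f (E i)) y = pr (g (E i)) y"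
  shows "sim f g"
  unfolding sim_def
proof (intro allI)
  fix x y
  have "bit_functional (\<lambda>x. pr (f x) y)" "bit_functional (\<lambda>x. pr (g x) y)"
    using assms by (simp_all add: bit_functional_def isom_add)
  from bit_functional_expand[OF this(1), of x] bit_functional_expand[OF this(2), of x] assms(3)
  show "pr (f x) y = pr (g x) y" by simp
qed

lemma gam_1_if_sim:
  assumes "isom f" "isom g" "sim f g" shows "gam 1 (invf g \<circ> f)"
proof -
  have "\<exists>z. f x - g x = scale 2 z" for x
    by (rule pr_eq_0D) (use assms(3) in \<open>simp add: sim_def\<close>)
  then obtain A where A: "\<And>x. f x = g x + scale 2 (A x)"
    by (metis add_diff_cancel_left' add_diff_eq diff_add_cancel add.commute)
  show ?thesis
    by (rule gamI[where A = "\<lambda>x. invf g (A x)"])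
      (simp_all add: A isom_comp isom_inv assms isom_add[OF isom_inv] isom_scale[OF isom_inv] isom_inv_apply)
qed

text \<open>With \<open>T = tv 1 p\<close>, the square is
  \<open>T^2 (T^-1 \<gamma> T) \<gamma>\<close>. The factor \<open>T^2 = tv 2 p\<close> contributes
  \<open>sq p\<close>, and the other two together contribute a shear.\<close>

lemma lv_transvection_square:
  assumes g: "gam 1 \<gamma>" and t: "t = tv 1 p \<circ> \<gamma>"
  shows "gam 1 (t \<circ> t)" "lv 1 (t \<circ> t) = sq p + shear p (lv 1 \<gamma>)"
proof -
  let ?T = "tv 1 p"
  have "tv 2 p x = ?T (?T x)" for x
    using tv_comp[of 1 p 1] by (simp add: fun_eq_iff)
  then have "t \<circ> t = tv 2 p \<circ> ((invf ?T \<circ> \<gamma> \<circ> ?T) \<circ> \<gamma>)"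
    by (simp add: t fun_eq_iff isom_inv_apply[OF isom_tv])
  moreover note c = gam_conj[OF isom_tv g, of 1 p] and tt = gam_tv[of 1 p, simplified]
  ultimately show "gam 1 (t \<circ> t)" "lv 1 (t \<circ> t) = sq p + shear p (lv 1 \<gamma>)"
    using g by (simp_all add: gam_comp lv_comp shear_eq_tv[OF sym_form_lv[OF g]])
qed

lemma inv_comp_cancel:
  assumes "isom s" "isom g" shows "invf (s \<circ> g) \<circ> (s \<circ> f) = invf g \<circ> f"
  by (simp add: isom_inv_comp assms fun_eq_iff isom_inv_apply(1))

text \<open>The transvections commute, as \<open>p\<close> and \<open>q\<close> are orthogonal over
  the 2-adic integers, and cancel. What remains is how each of them conjugates the correction of the
  other.\<close>

lemma lv_commutator_1:
  assumes g: "gam 1 \<gamma>" "gam 1 \<delta>" and t: "t = tv 1 p \<circ> \<gamma>" "s = tv 1 q \<circ> \<delta>" and pq: "form p q = 0"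
  shows "gam 1 (invf (s \<circ> t) \<circ> (t \<circ> s))"
    "lv 1 (invf (s \<circ> t) \<circ> (t \<circ> s)) = shear q (lv 1 \<gamma>) + shear p (lv 1 \<delta>)"
proof -
  let ?P = "tv 1 p" and ?Q = "tv 1 q"
  let ?X = "(invf ?Q \<circ> \<gamma> \<circ> ?Q) \<circ> \<delta>" and ?Y = "(invf ?P \<circ> \<delta> \<circ> ?P) \<circ> \<gamma>"
  have c: "?P (?Q x) = ?Q (?P x)" for x using tv_commute[OF pq, of 1 1] by (simp add: fun_eq_iff)
  have X: "gam 1 ?X" "gam 1 ?Y" using g by (simp_all add: gam_comp gam_conj isom_tv)
  have ts: "t \<circ> s = ?P \<circ> ?Q \<circ> ?X" "s \<circ> t = ?P \<circ> ?Q \<circ> ?Y"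
    by (simp_all add: t fun_eq_iff isom_inv_apply[OF isom_tv] c)
  have "invf (s \<circ> t) \<circ> (t \<circ> s) = invf ?Y \<circ> ?X"
    unfolding ts by (rule inv_comp_cancel[OF isom_comp[OF isom_tv isom_tv] gam_isom[OF X(2)]])
  then show "gam 1 (invf (s \<circ> t) \<circ> (t \<circ> s))"
    "lv 1 (invf (s \<circ> t) \<circ> (t \<circ> s)) = shear q (lv 1 \<gamma>) + shear p (lv 1 \<delta>)"
    using X g by (simp_all add: gam_comp(1) gam_inv lv_comp lv_inv gam_conj isom_tv ac_simps
        shear_eq_tv[OF sym_form_lv[OF g(1)]] shear_eq_tv[OF sym_form_lv[OF g(2)]])
qed

text \<open>Elements of level 1 commute up to level 2, where the commutator shows the Lie bracket of
  \<open>x -> <x, a> a\<close> and \<open>x -> <x, b> b\<close>.\<close>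

lemma lv_commutator_tv:
  assumes ab: "pr a b = 1"
  defines "f \<equiv> tv 2 a \<circ> tv 2 b" and "g \<equiv> tv 2 b \<circ> tv 2 a"
  shows "gam 2 (invf g \<circ> f)" "lv 2 (invf g \<circ> f) = wedge a b"
proof -
  let ?w = "\<lambda>x. scale (form x b * form b a) a - scale (form x a * form a b) b"
  have g: "isom g" "isom f" unfolding f_def g_def by (simp_all add: isom_comp isom_tv)
  have "gam 1 g" unfolding g_def using gam_tv(1)[of 1] by (simp add: gam_comp)
  note pg = pr_gam[OF this]
  have "f x = g x + scale (2 ^ 2) (?w x)" for x
    by (simp add: f_def g_def tv_def scale_right_distrib scale_left_distrib scale_right_diff_distrib algebra_simps)
  then have e: "(invf g \<circ> f) x = x + scale (2 ^ 2) (invf g (?w x))" for x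
    using isom_add[OF isom_inv[OF g(1)]] isom_scale[OF isom_inv[OF g(1)]] isom_inv_apply[OF g(1)] by simp
  show c: "gam 2 (invf g \<circ> f)" by (rule gamI[of "invf g \<circ> f", OF _ e]) (intro isom_comp isom_inv g)
  show "lv 2 (invf g \<circ> f) = wedge a b"
  proof (intro ext)
    fix x y
    have "lv 2 (invf g \<circ> f) x y = pr (?w x) y"
      by (simp only: lv_unique[OF c e] pr_inv_adjoint[OF g(1)] pg)
    also have "\<dots> = pr x b * pr b a * pr a y + pr x a * pr a b * pr b y"
      by (simp add: pr_def)
    finally show "lv 2 (invf g \<circ> f) x y = wedge a b x y"
      using ab by (simp add: wedge_def pr_commute[of a y] pr_commute[of b y] pr_commute[of b a] algebra_simps)
  qed
qed

text \<open>The orthogonality conditions leave \<open>tv 2 a\<close> and \<open>tv 2 b\<close> as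
  the only noncommuting pair of transvections, so the commutator is theirs up to shears of the
  corrections at level 2.\<close>

lemma lv_commutator_2:
  assumes g: "gam 2 \<gamma>" "gam 2 \<delta>"
    and t: "t = tv 1 p \<circ> (tv 2 a \<circ> \<gamma>)" "s = tv 1 q \<circ> (tv 2 b \<circ> \<delta>)"
    and orth: "form p q = 0" "form p b = 0" "form q a = 0" and ab: "pr a b = 1"
  shows "gam 2 (invf (s \<circ> t) \<circ> (t \<circ> s))"
    "lv 2 (invf (s \<circ> t) \<circ> (t \<circ> s)) = wedge a b + (shear q (lv 2 \<gamma>) + shear p (lv 2 \<delta>))"
proof -
  let ?P = "tv 1 p" and ?Q = "tv 1 q" and ?A = "tv 2 a" and ?B = "tv 2 b"
  let ?X = "(invf (?Q \<circ> ?B) \<circ> \<gamma> \<circ> (?Q \<circ> ?B)) \<circ> \<delta>" and ?Y = "(invf (?P \<circ> ?A) \<circ> \<delta> \<circ> (?P \<circ> ?A)) \<circ> \<gamma>"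
  have c: "?P (?Q x) = ?Q (?P x)" "?P (?B x) = ?B (?P x)" "?A (?Q x) = ?Q (?A x)" for x
    using tv_commute[OF orth(1), of 1 1] tv_commute[OF orth(2), of 1 2] tv_commute[OF orth(3), of 1 2]
    by (simp_all add: fun_eq_iff)
  have iso: "isom (?Q \<circ> ?B)" "isom (?P \<circ> ?A)" "isom (?P \<circ> ?Q)" "isom (?B \<circ> ?A)"
    by (simp_all add: isom_comp isom_tv)
  have X: "gam 2 ?X" "gam 2 ?Y" using g iso by (simp_all add: gam_comp gam_conj)
  have "?Q (?B (invf (?Q \<circ> ?B) x)) = x" "?P (?A (invf (?P \<circ> ?A) x)) = x" for x
    using isom_inv_apply(2)[OF iso(1), of x] isom_inv_apply(2)[OF iso(2), of x] by simp_all
  then have ts: "t \<circ> s = (?P \<circ> ?Q) \<circ> ((?A \<circ> ?B) \<circ> ?X)" "s \<circ> t = (?P \<circ> ?Q) \<circ> ((?B \<circ> ?A) \<circ> ?Y)"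
    by (simp_all add: t fun_eq_iff c flip: c(3))
  have "invf (s \<circ> t) \<circ> (t \<circ> s) = invf ((?B \<circ> ?A) \<circ> ?Y) \<circ> ((?A \<circ> ?B) \<circ> ?X)"
    unfolding ts by (rule inv_comp_cancel[OF iso(3) isom_comp[OF iso(4) gam_isom[OF X(2)]]])
  also have "\<dots> = invf ?Y \<circ> ((invf (?B \<circ> ?A) \<circ> (?A \<circ> ?B)) \<circ> ?X)"
    unfolding isom_inv_comp[OF iso(4) gam_isom[OF X(2)]] by (simp only: o_assoc)
  finally have "invf (s \<circ> t) \<circ> (t \<circ> s) = invf ?Y \<circ> ((invf (?B \<circ> ?A) \<circ> (?A \<circ> ?B)) \<circ> ?X)" .
  \<comment> \<open>\<open>tv 2 v\<close> is the identity modulo 2, so these conjugations act on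
    forms through \<open>tv 1 u\<close> alone.\<close>
  moreover have mod2: "(\<lambda>x y. \<beta> ((tv 1 u \<circ> tv 2 v) x) ((tv 1 u \<circ> tv 2 v) y)) = (\<lambda>x y. \<beta> (tv 1 u x) (tv 1 u y))"
    if \<beta>: "sym_form \<beta>" for \<beta> u v
  proof -
    have "tv 1 u (tv 2 v x) = tv 1 u x + scale 2 (scale (form x v) (tv 1 u v))" for x
      by (simp add: tv_def[of 2] isom_add[OF isom_tv] isom_scale[OF isom_tv])
    then show ?thesis
      by (simp add: fun_eq_iff sym_form_add[OF \<beta>] sym_form_scale[OF \<beta>] del: scale_scale)
  qed
  note mod2[OF sym_form_lv[OF g(1)]] mod2[OF sym_form_lv[OF g(2)]]
  ultimately show "gam 2 (invf (s \<circ> t) \<circ> (t \<circ> s))"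
    "lv 2 (invf (s \<circ> t) \<circ> (t \<circ> s)) = wedge a b + (shear q (lv 2 \<gamma>) + shear p (lv 2 \<delta>))"
    using X g lv_commutator_tv[OF ab]
    by (simp_all only: gam_comp(1) gam_inv lv_comp lv_inv gam_conj iso zero_less_numeral)
      (simp add: ac_simps shear_eq_tv[OF sym_form_lv[OF g(1)]] shear_eq_tv[OF sym_form_lv[OF g(2)]])
qed

text \<open>Since \<open>p\<close> and \<open>b\<close> pair to 1, the endomorphism \<open>A\<close>
  of \<open>wedge p b\<close> is idempotent modulo 2, so \<open>A + A^2\<close> is even. The
  diagonal at level 3 is recovered from \<open><f x, x> = <t x, t^-1 x>\<close>, where
  \<open>t^-1 x\<close> simplifies because the transvection fixes \<open>x\<close>.\<close>

lemma lv_quartic: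
  assumes g: "gam 1 \<gamma>" and t: "t = tv 1 p \<circ> \<gamma>" and w: "lv 1 (t \<circ> t) = wedge p b" and pb: "pr p b = 1"
  defines "f \<equiv> t \<circ> t"
  shows "gam 3 (f \<circ> f)" "form x p = 0 \<Longrightarrow> lv 3 (f \<circ> f) x x = lv 1 \<gamma> x x + lv 1 \<gamma> x p"
proof -
  let ?A = "lev 1 f" and ?B = "lv 1 \<gamma>" and ?C = "lev 1 \<gamma>" and ?C' = "lev 1 (invf \<gamma>)"
  have f: "gam 1 f" "lv 1 f = wedge p b" using lv_transvection_square(1)[OF g t] w by (simp_all add: f_def)
  have pA: "pr (?A x) y = wedge p b x y" for x y using f(2) by (simp add: lv_def fun_eq_iff)
  have "lv 2 (f \<circ> f) x y = 0" for x y
  proof -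
    have "lv 2 (f \<circ> f) x y = wedge p b x y + wedge p b (?A x) y"
      using lv_square_1(2)[OF f(1), of x y] by (simp only: f(2))
    also have "\<dots> = 0"
      using pb by (simp add: wedge_def pA pr_commute[of b p] algebra_simps)
    finally show ?thesis .
  qed
  then have "lv 2 (f \<circ> f) = 0" by (simp add: fun_eq_iff)
  then show c: "gam 3 (f \<circ> f)"
    using gam_Suc_iff[of 2 "f \<circ> f"] lv_square_1(1)[OF f(1)] by simp
  assume xp: "form x p = 0"
  let ?w = "lev 3 (f \<circ> f) x"
  have iso: "isom t" "isom \<gamma>" using g t by (simp_all add: isom_comp isom_tv gam_isom)
  \<comment> \<open>\<open>lev_form\<close> at \<open>?A x\<close> and \<open>x\<close>: the middle
    term is a vector paired with itself, and the last is divisible by 4 because \<open>?A\<close> is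
    alternating modulo 2.\<close>
  have ev: "\<exists>m. form (?A (?A x)) x = 4 * m"
  proof -
    let ?z = "?A x"
    have "residue_bit (form (?A ?z) ?z) = 0"
      using pA[of ?z ?z] alt_formD(2)[OF alt_form_wedge] by (simp add: pr_def)
    then obtain m where m: "form (?A ?z) ?z = 2 * m" using residue_bit_eq_0_iff by blast
    have "form (?A ?z) x + form ?z ?z + 2 ^ 1 * form (?A ?z) ?z = 0"
      by (rule lev_form[OF f(1)])
    then have "form (?A ?z) x = 4 * (- m)"
      by (simp add: form_alternating m eq_neg_iff_add_eq_0)
    then show ?thesis ..
  qed
  then obtain m where m: "form (?A (?A x)) x = 4 * m" ..
  have "x + scale (2 ^ 3) ?w = x + scale 4 (?A x + ?A (?A x))"
    using lev_eq[OF c, of x] lv_square_1(3)[OF f(1), of x] by simp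
  then have "form (scale (2 ^ 3) ?w) x = form (scale 4 (?A x + ?A (?A x))) x" by simp
  then have "2 ^ 2 * (2 * form ?w x) = 2 ^ 2 * (form (?A x) x + 4 * m)"
    using m by (simp add: algebra_simps)
  then have e1: "2 * form ?w x = form (?A x) x + 4 * m" by (rule two_adic_power_mult_cancel)
  have tvx: "tv 1 p x = x" using xp by (simp add: tv_def)
  have "2 * form (?A x) x = form (f x) x"
    by (subst lev_eq[OF f(1)]) (simp add: form_alternating)
  also have "\<dots> = form (t x) (invf t x)"
    using isom_inv_adjoint[OF isom_inv[OF iso(1)], of "t x" x] iso(1) by (simp add: f_def inv_inv_eq isom_bij)
  also have "invf t x = invf \<gamma> x"
    using isom_inv_apply(1)[OF isom_tv, of 1 p x] tvx iso by (simp add: t isom_inv_comp isom_tv)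
  also have "form (t x) (invf \<gamma> x) = form (\<gamma> x) (invf \<gamma> x) + form (\<gamma> x) p * form p (invf \<gamma> x)"
    by (simp add: t tv_def)
  also have "form (\<gamma> x) (invf \<gamma> x) = form (\<gamma> (\<gamma> x)) x"
    using isom_inv_adjoint[OF isom_inv[OF iso(2)], of "\<gamma> x" x] iso(2) by (simp add: inv_inv_eq isom_bij)
  also have "\<dots> = 4 * (form (?C x) x + form (?C (?C x)) x)"
    using lv_square_1(3)[OF g, of x] by (simp add: form_alternating)
  also have "form (\<gamma> x) p = 2 * form (?C x) p"
    using xp by (subst lev_eq[OF g]) simp
  also have "form p (invf \<gamma> x) = 2 * form p (?C' x)"
    using xp form_commute[of p x] by (subst lev_eq[OF gam_inv[OF g]]) simp
  finally have "2 ^ 1 * form (?A x) x =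
      2 ^ 1 * (2 * (form (?C x) x + form (?C (?C x)) x + form (?C x) p * form p (?C' x)))"
    by (simp add: algebra_simps)
  then have "form (?A x) x = 2 * (form (?C x) x + form (?C (?C x)) x + form (?C x) p * form p (?C' x))"
    by (rule two_adic_power_mult_cancel)
  with e1 have "2 ^ 1 * form ?w x = 2 ^ 1 *
      (form (?C x) x + form (?C (?C x)) x + form (?C x) p * form p (?C' x) + 2 * m)"
    by (simp add: algebra_simps)
  then have "form ?w x = form (?C x) x + form (?C (?C x)) x + form (?C x) p * form p (?C' x) + 2 * m"
    by (rule two_adic_power_mult_cancel)
  then have "pr ?w x = pr (?C x) x + pr (?C (?C x)) x + pr (?C x) p * pr p (?C' x)"
    by (simp add: pr_def)
  \<comment> \<open>By symmetry this is the pairing of \<open>?C x\<close> with itself.\<close>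
  also have "pr (?C (?C x)) x = 0"
    using sym_form_commute[OF sym_form_lv[OF g], of "?C x" x] by (simp add: lv_def)
  also have "pr p (?C' x) = pr (?C x) p"
    using lv_inv[OF g] by (simp add: lv_def fun_eq_iff pr_commute[of p])
  finally show "lv 3 (f \<circ> f) x x = lv 1 \<gamma> x x + lv 1 \<gamma> x p" by (simp add: lv_def o_def)
qed

end

section \<open>Closed groups lifting the permutations\<close>

context odd_frame
begin

lemma sym_form_cong:
  assumes "sym_form \<beta>" "\<And>y. pr x y = pr x' y"
  shows "\<beta> x y = \<beta> x' y" "\<beta> y x = \<beta> y x'"
proof -
  show "\<beta> y x = \<beta> y x'" for y
    using bit_functional_represent[OF sym_form_functional[OF assms(1), of y]] assms(2)
    by (metis pr_commute)
  then show "\<beta> x y = \<beta> x' y" using sym_form_commute[OF assms(1)] by metis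
qed

definition lifts :: "('v \<Rightarrow> 'v) \<Rightarrow> (nat \<Rightarrow> nat) \<Rightarrow> bool" where
  "lifts g \<sigma> \<longleftrightarrow> (\<forall>i\<in>{1..D}. \<forall>y. pr (g (E i)) y = pr (E (\<sigma> i)) y)"

end

text \<open>Closedness is phrased as approximation modulo all powers of 2, so no topology enters
  before the lattice is instantiated.\<close>

locale frame_group = odd_frame scale form D E
  for scale :: "two_adic \<Rightarrow> 'v::ab_group_add \<Rightarrow> 'v" and form D E +
  fixes G :: "('v \<Rightarrow> 'v) set"
  assumes G_isom: "f \<in> G \<Longrightarrow> isom f"
    and G_id: "id \<in> G"
    and G_comp: "f \<in> G \<Longrightarrow> g \<in> G \<Longrightarrow> f \<circ> g \<in> G"
    and G_inv: "f \<in> G \<Longrightarrow> invf f \<in> G"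
    and G_lift: "\<sigma> permutes {1..D} \<Longrightarrow> \<exists>g\<in>G. lifts g \<sigma>"
    and G_closed: "isom f \<Longrightarrow> (\<And>n. \<exists>g\<in>G. \<forall>x. \<exists>z. f x = g x + scale (2 ^ n) z) \<Longrightarrow> f \<in> G"
begin

definition L :: "nat \<Rightarrow> ('v \<Rightarrow> 'v \<Rightarrow> bit) set" where
  "L n = lv n ` {f \<in> G. gam n f}"

lemma L_I: "f \<in> G \<Longrightarrow> gam n f \<Longrightarrow> lv n f \<in> L n"
  by (auto simp: L_def)

lemma L_E: "\<beta> \<in> L n \<Longrightarrow> (\<And>f. f \<in> G \<Longrightarrow> gam n f \<Longrightarrow> \<beta> = lv n f \<Longrightarrow> P) \<Longrightarrow> P"
  by (auto simp: L_def)

text \<open>Modulo 2 the transposition is the transvection along \<open>E i + E j\<close>. The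
  vector \<open>p\<close> may be any lift of it, which leaves room for exact orthogonality.\<close>

lemma transposition_lift:
  assumes ij: "i \<in> {1..D}" "j \<in> {1..D}" "i \<noteq> j" and p: "\<And>x. pr x p = pr x (E i + E j)"
  shows "\<exists>t\<in>G. sim t (tv 1 p)"
proof -
  obtain t where t: "t \<in> G" "lifts t (Transposition.transpose i j)"
    using G_lift[OF permutes_swap_id[OF ij(1,2)]] by blast
  have "sim t (tv 1 p)"
  proof (rule simI[OF G_isom[OF t(1)] isom_tv])
    fix m y assume m: "m \<in> {1..D}"
    have "pr (t (E m)) y = pr (E (Transposition.transpose i j m)) y"
      using t(2) m by (simp add: lifts_def)
    moreover have "pr (tv 1 p (E m)) y = pr (E m) y + pr (E m) (E i + E j) * (pr (E i) y + pr (E j) y)"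
      using p[of y] p[of "E m"] by (simp add: pr_tv pr_commute[of p y] pr_commute[of "E i" y] pr_commute[of "E j" y])
    ultimately show "pr (t (E m)) y = pr (tv 1 p (E m)) y"
      using m ij by (auto simp: transpose_def pr_E)
  qed
  with t(1) show ?thesis by blast
qed

lemma sim_decompose:
  assumes "t \<in> G" "sim t (tv 1 p)"
  obtains \<gamma> where "gam 1 \<gamma>" "t = tv 1 p \<circ> \<gamma>"
proof
  show "gam 1 (invf (tv 1 p) \<circ> t)" by (rule gam_1_if_sim[OF G_isom isom_tv]) (use assms in auto)
  show "t = tv 1 p \<circ> (invf (tv 1 p) \<circ> t)" by (simp add: fun_eq_iff isom_inv_apply[OF isom_tv])
qed

text \<open>Conjugation by \<open>G\<close> acts on level forms by substitution, and a form plus its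
  substitution by a lift of a transposition is a shear.\<close>

lemma stable_L:
  assumes n: "n > 0" shows "stable_forms scale form D E (L n)"
proof unfold_locales
  show "0 \<in> L n" using L_I[OF G_id gam_id, of n] by (simp add: lv_id)
  show "\<beta> + \<gamma> \<in> L n" if "\<beta> \<in> L n" "\<gamma> \<in> L n" for \<beta> \<gamma>
    using that n L_I[OF G_comp gam_comp(1)] by (auto elim!: L_E) (metis lv_comp)
  note plus = this
  show sym: "sym_form \<beta>" if "\<beta> \<in> L n" for \<beta>
    using that n by (auto elim!: L_E intro: sym_form_lv)
  have conj: "(\<lambda>x y. \<beta> (t x) (t y)) \<in> L n" if \<beta>: "\<beta> \<in> L n" and t: "t \<in> G" for \<beta> t
  proof -
    obtain f where f: "f \<in> G" "gam n f" "\<beta> = lv n f" using \<beta> by (rule L_E)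
    show ?thesis
      using L_I[OF G_comp[OF G_comp[OF G_inv[OF t] f(1)] t] gam_conj(1)[OF G_isom[OF t] f(2)]]
        gam_conj(2)[OF G_isom[OF t] f(2)] f(3) by simp
  qed
  show "shear (E i + E j) \<beta> \<in> L n" if ij: "i \<in> {1..D}" "j \<in> {1..D}" "i \<noteq> j" and \<beta>: "\<beta> \<in> L n" for i j \<beta>
  proof -
    obtain t where t: "t \<in> G" "sim t (tv 1 (E i + E j))" using transposition_lift[OF ij] by blast
    have e: "pr (t x) y = pr (tv 1 (E i + E j) x) y" for x y using t(2) by (simp add: sim_def)
    have "\<beta> (t x) (t y) = \<beta> (tv 1 (E i + E j) x) (tv 1 (E i + E j) y)" for x y
      using sym_form_cong(1)[OF sym[OF \<beta>] e] sym_form_cong(2)[OF sym[OF \<beta>] e] by metis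
    then have "shear (E i + E j) \<beta> = (\<lambda>x y. \<beta> (t x) (t y)) + \<beta>"
      by (simp add: shear_eq_tv[OF sym[OF \<beta>]])
    then show ?thesis using plus[OF conj[OF \<beta> t(1)] \<beta>] by simp
  qed
  show "\<exists>t. (\<forall>x. \<forall>i\<in>{1..D}. pr (t x) (E (\<sigma> i)) = pr x (E i)) \<and> (\<lambda>x y. \<beta> (t x) (t y)) \<in> L n"
    if \<sigma>: "\<sigma> permutes {1..D}" and \<beta>: "\<beta> \<in> L n" for \<sigma> \<beta>
  proof -
    obtain t where t: "t \<in> G" "lifts t \<sigma>" using G_lift[OF \<sigma>] by blast
    have "pr (t x) (E (\<sigma> i)) = pr x (E i)" if "i \<in> {1..D}" for x i
      using t(2) that isom_pr[OF G_isom[OF t(1)], of x "E i"]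
      by (simp add: lifts_def pr_commute[of "t x"])
    then show ?thesis using conj[OF \<beta> t(1)] by blast
  qed
qed

lemma E_decompose:
  assumes "i \<in> {1..D}" "j \<in> {1..D}" "i \<noteq> j" "\<And>x. pr x p = pr x (E i + E j)"
  obtains t \<gamma> where "t \<in> G" "gam 1 \<gamma>" "t = tv 1 p \<circ> \<gamma>"
proof -
  obtain t where t: "t \<in> G" "sim t (tv 1 p)" using transposition_lift[OF assms] by blast
  from t obtain \<gamma> where "gam 1 \<gamma>" "t = tv 1 p \<circ> \<gamma>" by (rule sim_decompose)
  with t(1) show ?thesis by (rule that)
qed

lemma alt_mem_L1: "alt_form \<beta> \<Longrightarrow> \<beta> \<in> L 1"
proof -
  assume \<beta>: "alt_form \<beta>"
  obtain t \<gamma> where t: "t \<in> G" "gam 1 \<gamma>" "t = tv 1 (E 1 + E 2) \<circ> \<gamma>"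
    by (rule E_decompose[of 1 2 "E 1 + E 2"]) (use D_ge in auto)
  note s = lv_transvection_square[OF t(2,3)]
  show ?thesis
    using stable_forms.alt_mem_from_square[OF stable_L _ sym_form_lv[OF t(2)] \<beta>, of 1]
      L_I[OF G_comp[OF t(1) t(1)] s(1)] s(2) t(2) by simp
qed

lemma L_Suc: "n \<ge> 2 \<Longrightarrow> \<beta> \<in> L n \<Longrightarrow> \<beta> \<in> L (Suc n)"
  by (metis L_E L_I G_comp lv_square)

lemma L_mono:
  assumes "2 \<le> n" "n \<le> m" "\<beta> \<in> L n" shows "\<beta> \<in> L m"
  using assms(2) by (induction rule: dec_induct) (use assms in \<open>auto intro: L_Suc\<close>)

text \<open>Successive approximation: at each level an element of \<open>G\<close> with the same
  level form is divided out, and closedness supplies the limit.\<close>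

lemma gam_subset_G:
  assumes n: "n > 0" and full: "\<And>m \<beta>. m \<ge> n \<Longrightarrow> sym_form \<beta> \<Longrightarrow> \<beta> \<in> L m" and f: "gam n f"
  shows "f \<in> G"
proof (rule G_closed[OF gam_isom[OF f]])
  have approx: "\<exists>g\<in>G. gam (n + k) (invf g \<circ> f)" for k
  proof (induction k)
    case 0
    have "invf id \<circ> f = f" by (simp add: fun_eq_iff inv_id)
    then show ?case using f G_id by (intro bexI[of _ id]) simp_all
  next
    case (Suc k)
    then obtain g where g: "g \<in> G" "gam (n + k) (invf g \<circ> f)" by blast
    have "lv (n + k) (invf g \<circ> f) \<in> L (n + k)"
      by (rule full) (use n g in \<open>auto intro: sym_form_lv\<close>)
    then obtain h where h: "h \<in> G" "gam (n + k) h" "lv (n + k) (invf g \<circ> f) = lv (n + k) h"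
      by (rule L_E)
    have "gam (Suc (n + k)) (invf h \<circ> (invf g \<circ> f))"
      by (rule gam_Suc_if_lv_eq) (use h g n in auto)
    then have "gam (n + Suc k) (invf (g \<circ> h) \<circ> f)"
      using g h by (simp add: isom_inv_comp G_isom o_assoc)
    then show ?case using G_comp[OF g(1) h(1)] by blast
  qed
  fix m
  obtain g where g: "g \<in> G" "gam (n + m) (invf g \<circ> f)" using approx by blast
  have gm: "gam m (invf g \<circ> f)" by (rule gam_antimono[OF g(2)]) simp
  have "f x = g x + scale (2 ^ m) (g (lev m (invf g \<circ> f) x))" for x
  proof -
    have "f x = g ((invf g \<circ> f) x)" by (simp add: isom_inv_apply G_isom g)
    also have "(invf g \<circ> f) x = x + scale (2 ^ m) (lev m (invf g \<circ> f) x)" by (rule lev_eq[OF gm])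
    finally show ?thesis by (simp add: isom_add isom_scale G_isom g)
  qed
  then show "\<exists>g\<in>G. \<forall>x. \<exists>z. f x = g x + scale (2 ^ m) z" using g(1) by blast
qed

lemma gam1_subset_G:
  assumes \<beta>: "\<beta> \<in> L 1" "\<beta> x x \<noteq> 0" and f: "gam 1 f"
  shows "f \<in> G"
proof (rule gam_subset_G[OF _ _ f])
  have full1: "\<gamma> \<in> L 1" if "sym_form \<gamma>" for \<gamma>
    using stable_forms.all_sym_mem_if_not_alt[OF stable_L alt_mem_L1 \<beta> that] by simp
  have full2: "\<gamma> \<in> L 2" if "sym_form \<gamma>" for \<gamma>
  proof -
    let ?p = "E 1 + E 2"
    \<comment> \<open>The vector \<open>?p\<close> is isotropic, so the endomorphism of its square
      form has square zero modulo 2 and \<open>h \<circ> h\<close> carries that form to level 2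
      unchanged.\<close>
    obtain h where h: "h \<in> G" "gam 1 h" "sq ?p = lv 1 h" using full1[OF sym_form_sq] by (rule L_E)
    have pA: "pr (lev 1 h x) y = sq ?p x y" for x y by (simp only: h(3), simp add: lv_def)
    have "lv 2 (h \<circ> h) x y = sq ?p x y" for x y
    proof -
      have "lv 2 (h \<circ> h) x y = sq ?p x y + sq ?p (lev 1 h x) y"
        using lv_square_1(2)[OF h(2)] by (simp only: h(3))
      also have "sq ?p (lev 1 h x) y = sq ?p x ?p * pr y ?p"
        by (simp only: sq_def[of ?p, THEN fun_cong, THEN fun_cong, of "lev 1 h x"] pA)
      also have "sq ?p x ?p = 0" by (simp only: sq_def pr_self mult_zero_right)
      finally show ?thesis by (simp add: o_def)
    qed
    then have "lv 2 (h \<circ> h) = sq ?p" by (simp add: fun_eq_iff)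
    then have "sq ?p \<in> L 2" using L_I[OF G_comp[OF h(1) h(1)] lv_square_1(1)[OF h(2)]] by simp
    then show ?thesis
      using stable_forms.sym_mem_if_sq[OF stable_L, of 2 1 2 \<gamma>] that D_ge by simp
  qed
  show "\<gamma> \<in> L m" if "m \<ge> 1" "sym_form \<gamma>" for m \<gamma>
  proof (cases "m = 1")
    case False
    then have "2 \<le> m" using that by simp
    then show ?thesis using L_mono[OF order_refl] full2 that by blast
  qed (use full1 that in simp)
qed simp

section \<open>Groups whose \<open>L 1\<close> is alternating\<close>

context
  assumes alt1: "\<And>\<beta> x. \<beta> \<in> L 1 \<Longrightarrow> \<beta> x x = 0"
begin

text \<open>The diagonal of \<open>lv 1 (t \<circ> t)\<close> at \<open>x\<close> is
  \<open>pr x p * (1 + lv 1 \<gamma> p p)\<close>, and it must vanish.\<close>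

lemma diag_self:
  assumes t: "t \<in> G" "gam 1 \<gamma>" "t = tv 1 p \<circ> \<gamma>" and x: "pr x p = 1"
  shows "lv 1 \<gamma> p p = 1"
proof -
  note s = lv_transvection_square[OF t(2,3)]
  have "sq p + shear p (lv 1 \<gamma>) \<in> L 1"
    using L_I[OF G_comp[OF t(1) t(1)] s(1)] s(2) by simp
  then have "(sq p + shear p (lv 1 \<gamma>)) x x = 0" by (rule alt1)
  then show ?thesis
    using x by (simp add: shear_diag[OF sym_form_lv[OF t(2)]] sq_def bit_add_eq_0_iff)
qed

text \<open>Cross-multiplication makes the orthogonality exact; as \<open>form p a\<close> is odd
  and \<open>form p q\<close> even, the result is still \<open>q\<close> modulo 2. Transvections
  commute only under exact orthogonality.\<close>

lemma orthogonal_adjust: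
  assumes "pr p a = 1" "pr p q = 0"
  obtains q' where "form p q' = 0" "\<And>x. pr x q' = pr x q"
proof
  show "form p (scale (form p a) q - scale (form p q) a) = 0" by simp
  show "pr x (scale (form p a) q - scale (form p q) a) = pr x q" for x
    using assms by (simp add: pr_def)
qed

text \<open>At a vector \<open>x\<close> orthogonal to \<open>p\<close> but not to \<open>q\<close>,
  the commutator of \<open>t\<close> and \<open>s\<close> shows the diagonal of
  \<open>lv 1 \<gamma>\<close> at \<open>q\<close>.\<close>

lemma diag_orthogonal:
  assumes t: "t \<in> G" "gam 1 \<gamma>" "t = tv 1 p \<circ> \<gamma>" and s: "s \<in> G" "sim s (tv 1 q)"
    and pq: "pr p q = 0" and x: "pr x q = 1" "pr x p = 0" and a: "pr p a = 1"
  shows "lv 1 \<gamma> q q = 0"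
proof -
  obtain q' where q': "form p q' = 0" "\<And>x. pr x q' = pr x q"
    using orthogonal_adjust[OF a pq] by blast
  have q'': "pr q' x = pr q x" for x using q'(2)[of x] by (simp add: pr_commute)
  have "sim s (tv 1 q')" using s(2) by (simp add: sim_def pr_tv q'(2) q'')
  with s(1) obtain \<delta> where d: "gam 1 \<delta>" "s = tv 1 q' \<circ> \<delta>" by (rule sim_decompose)
  note c = lv_commutator_1[OF t(2) d(1) t(3) d(2) q'(1)]
  have "invf (s \<circ> t) \<circ> (t \<circ> s) \<in> G" by (intro G_comp G_inv t s)
  from L_I[OF this c(1)] have "shear q' (lv 1 \<gamma>) + shear p (lv 1 \<delta>) \<in> L 1" unfolding c(2) .
  from alt1[OF this, of x] have "lv 1 \<gamma> q' q' = 0"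
    using x by (simp add: shear_diag sym_form_lv t(2) d(1) q'(2))
  then show ?thesis
    using sym_form_cong[OF sym_form_lv[OF t(2)] q''] by simp
qed

text \<open>The function \<open>x \<mapsto> lv 1 \<gamma> x x\<close> is additive, is 1 at \<open>E D\<close> and is 0 at \<open>E i + E j\<close> for
  \<open>i, j < D\<close>, but \<open>E 1 + \<dots> + E D\<close> vanishes modulo 2 and \<open>D - 1\<close> is even.\<close>

lemma no_extra_transvection:
  assumes t: "t \<in> G" "sim t (tv 1 (E D))" shows False
proof -
  from t obtain \<gamma> where g: "gam 1 \<gamma>" "t = tv 1 (E D) \<circ> \<gamma>" by (rule sim_decompose)
  let ?\<phi> = "\<lambda>x. lv 1 \<gamma> x x"
  have \<phi>: "bit_functional ?\<phi>" by (rule sym_form_diag[OF sym_form_lv[OF g(1)]]) simp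
  have D: "D \<in> {1..D}" "1 \<in> {1..D}" "2 \<in> {1..D}" "3 \<in> {1..D}" "D \<noteq> 1" "D \<noteq> 2" "D \<noteq> 3"
    using D_ge by auto
  have \<phi>D: "?\<phi> (E D) = 1"
    by (rule diag_self[OF t(1) g, of "E 1"]) (use D pr_E in simp)
  have "?\<phi> (E i) = ?\<phi> (E 1)" if i: "i \<in> {1..D} - {D}" for i
  proof (cases "i = 1")
    case False
    \<comment> \<open>With a third index, \<open>E i + E k\<close> is orthogonal to
      \<open>E D\<close> and still pairs to 1 with \<open>E i + E 1\<close>.\<close>
    define k where "k = (if i = 2 then 3 else 2 :: nat)"
    have k: "k \<in> {1..D}" "k \<noteq> i" "k \<noteq> 1" "k \<noteq> D" using D by (auto simp: k_def)
    have i': "i \<in> {1..D}" "i \<noteq> D" using i by auto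
    obtain s where s: "s \<in> G" "sim s (tv 1 (E i + E 1))"
      using transposition_lift[OF i'(1) D(2) False refl] by blast
    have ne: "k \<noteq> i" "k \<noteq> 1" "k \<noteq> D" "i \<noteq> k" "1 \<noteq> k" "D \<noteq> k" "i \<noteq> 1" "1 \<noteq> i" "i \<noteq> D" "D \<noteq> i" "1 \<noteq> D"
      using k i' D False by metis+
    have "?\<phi> (E i + E 1) = 0"
      by (rule diag_orthogonal[OF t(1) g s, of "E i + E k" "E 1"])
        (simp_all only: pr_add pr_E[OF i'(1)] pr_E[OF k(1)] pr_E[OF D(1)] i' k(1) D(1,2) ne D(5) if_True if_False,
          simp_all)
    then show ?thesis using bit_functional_add[OF \<phi>, of "E i" "E 1"] by (simp add: bit_add_eq_0_iff)
  qed simp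
  then have "(\<Sum>i\<in>{1..D} - {D}. ?\<phi> (E i)) = (\<Sum>i\<in>{1..D} - {D}. ?\<phi> (E 1))"
    by (rule sum.cong[OF refl])
  also have "\<dots> = of_nat (D - 1) * ?\<phi> (E 1)"
    using D(1) by (simp add: card_Diff_subset)
  also have "\<dots> = 0" using odd_D by (simp add: of_nat_bit)
  finally have "(\<Sum>i\<in>{1..D}. ?\<phi> (E i)) = 1"
    using \<phi>D sum.remove[OF _ D(1), of "\<lambda>i. ?\<phi> (E i)"] by simp
  then show False using sum_functional_E[OF \<phi>] by simp
qed

text \<open>The value 1 at \<open>p\<close> separates \<open>E i\<close> from \<open>E j\<close>,
  and the values off \<open>{i, j}\<close> agree by \<open>diag_orthogonal\<close>. As
  \<open>D - 2\<close> is odd, the vanishing total forces them to be 1. So exactly one value is 0,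
  as for the pairing with \<open>E a\<close>.\<close>

lemma diag_transposition:
  assumes ij: "i \<in> {1..D}" "j \<in> {1..D}" "i \<noteq> j" and p: "\<And>x. pr x p = pr x (E i + E j)"
    and t: "t \<in> G" "gam 1 \<gamma>" "t = tv 1 p \<circ> \<gamma>"
  shows "\<exists>a\<in>{i, j}. \<forall>x. lv 1 \<gamma> x x = pr x (E a)"
proof -
  let ?\<phi> = "\<lambda>x. lv 1 \<gamma> x x"
  have \<phi>: "bit_functional ?\<phi>" by (rule sym_form_diag[OF sym_form_lv[OF t(2)]]) simp
  have "?\<phi> p = 1"
    by (rule diag_self[OF t, of "E i"]) (use p ij in \<open>simp add: pr_E\<close>)
  moreover have p': "pr p x = pr (E i + E j) x" for x using p[of x] by (simp only: pr_commute)
  ultimately have "?\<phi> (E i + E j) = 1"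
    using sym_form_cong[OF sym_form_lv[OF t(2)] p'] by simp
  then have ne: "?\<phi> (E i) \<noteq> ?\<phi> (E j)" using bit_functional_add[OF \<phi>] by (simp add: bit_add_eq_1_iff)
  have "?\<phi> (E k) = ?\<phi> (E l)" if kl: "k \<in> {1..D} - {i, j}" "l \<in> {1..D} - {i, j}" for k l
  proof (cases "k = l")
    case False
    have kl': "k \<in> {1..D}" "l \<in> {1..D}" "k \<noteq> i" "k \<noteq> j" "l \<noteq> i" "l \<noteq> j" using kl by auto
    obtain s where s: "s \<in> G" "sim s (tv 1 (E k + E l))"
      using transposition_lift[OF kl'(1,2) False refl] by blast
    have ne: "i \<noteq> k" "j \<noteq> k" "i \<noteq> l" "j \<noteq> l" "j \<noteq> i" using kl' ij by metis+
    have "?\<phi> (E k + E l) = 0"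
      by (rule diag_orthogonal[OF t s, of "E k" "E i"])
        (simp_all only: p p' pr_add pr_E[OF ij(1)] pr_E[OF ij(2)] pr_E[OF kl'(1)] ij kl' False ne if_True if_False,
          simp_all)
    then show ?thesis using bit_functional_add[OF \<phi>, of "E k" "E l"] by (simp add: bit_add_eq_0_iff)
  qed simp
  then obtain c where c: "\<And>k. k \<in> {1..D} - {i, j} \<Longrightarrow> ?\<phi> (E k) = c" by metis
  have "(\<Sum>k\<in>{1..D}. ?\<phi> (E k)) = (\<Sum>k\<in>{1..D} - {i, j}. ?\<phi> (E k)) + (\<Sum>k\<in>{i, j}. ?\<phi> (E k))"
    by (rule sum.subset_diff) (use ij in auto)
  also have "(\<Sum>k\<in>{1..D} - {i, j}. ?\<phi> (E k)) = of_nat (D - 2) * c"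
    using c ij by (simp add: card_Diff_subset)
  also have "(\<Sum>k\<in>{i, j}. ?\<phi> (E k)) = 1" using ij ne by (simp add: bit_add_eq_1_iff)
  finally have c1: "c = 1"
    using sum_functional_E[OF \<phi>] odd_D D_ge by (cases c) (auto simp: of_nat_bit bit_add_eq_0_iff)
  define a where "a = (if ?\<phi> (E i) = 0 then i else j)"
  have a: "a \<in> {i, j}" "a \<in> {1..D}" using ij by (auto simp: a_def)
  have v: "?\<phi> (E k) = (if k = a then 0 else 1)" if "k \<in> {1..D}" for k
    using c[of k] c1 ne that by (cases "k \<in> {i, j}") (auto simp: a_def)
  have "?\<phi> x = pr x (E a)" for x
    by (rule bit_functional_eqI[OF \<phi> pr_functional(2)]) (use v a pr_E in auto)
  then show ?thesis using a(1) by blast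
qed

text \<open>Over \<open>\<Gamma>(2)\<close> modulo \<open>\<Gamma>(4)\<close>, the transvection \<open>tv 2 a\<close> is the simplest element with the given
  diagonal. With this choice the commutator of two disjoint lifts is that of \<open>tv 2 a\<close> and \<open>tv 2 b\<close>.\<close>

lemma normal_lift:
  assumes t: "t \<in> G" "gam 1 \<gamma>" "t = tv 1 p \<circ> \<gamma>" and a: "\<And>x. lv 1 \<gamma> x x = pr x a"
  obtains s \<delta> where "s \<in> G" "gam 2 \<delta>" "s = tv 1 p \<circ> (tv 2 a \<circ> \<delta>)"
proof -
  have "alt_form (lv 1 \<gamma> + sq a)"
    by (rule alt_form_plusI[OF sym_form_lv[OF t(2)] sym_form_sq]) (simp_all add: a sq_def)
  then have "lv 1 \<gamma> + sq a \<in> L 1" by (rule alt_mem_L1)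
  then obtain f where f: "f \<in> G" "gam 1 f" "lv 1 \<gamma> + sq a = lv 1 f" by (rule L_E)
  have g: "gam 1 (\<gamma> \<circ> f)" "lv 1 (\<gamma> \<circ> f) = sq a"
    using gam_comp(1)[OF t(2) f(2)] lv_comp[OF t(2) f(2)] by (simp_all flip: f(3))
  have "gam (Suc 1) (invf (tv 2 a) \<circ> (\<gamma> \<circ> f))"
    by (rule gam_Suc_if_lv_eq) (use g gam_tv[of 1 a] in simp_all)
  then have "gam 2 (invf (tv 2 a) \<circ> (\<gamma> \<circ> f))" by (simp add: numeral_2_eq_2)
  moreover have "t \<circ> f = tv 1 p \<circ> (tv 2 a \<circ> (invf (tv 2 a) \<circ> (\<gamma> \<circ> f)))"
    by (simp add: t(3) fun_eq_iff isom_inv_apply[OF isom_tv])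
  ultimately show ?thesis using that G_comp[OF t(1) f(1)] by blast
qed

text \<open>For orthogonal \<open>u\<close> and \<open>w\<close> the endomorphism of
  \<open>wedge u w\<close> has square zero modulo 2, so squaring carries the form to level 2
  unchanged.\<close>

lemma four_cycle_mem_L2:
  assumes uw: "pr u w = 0" shows "wedge u w \<in> L 2"
proof -
  obtain f where f: "f \<in> G" "gam 1 f" "wedge u w = lv 1 f"
    using alt_mem_L1[OF alt_form_wedge] by (rule L_E)
  have pA: "pr (lev 1 f x) y = wedge u w x y" for x y by (simp only: f(3), simp add: lv_def)
  have "lv 2 (f \<circ> f) x y = wedge u w x y" for x y
  proof -
    have "lv 2 (f \<circ> f) x y = wedge u w x y + wedge u w (lev 1 f x) y"
      using lv_square_1(2)[OF f(2)] by (simp only: f(3))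
    also have "wedge u w (lev 1 f x) y = wedge u w x u * pr y w + wedge u w x w * pr y u"
      by (simp add: wedge_def[of u w, THEN fun_cong, THEN fun_cong, of "lev 1 f x"] pA)
    also have "\<dots> = 0" using uw by (simp add: wedge_def pr_commute[of w u])
    finally show ?thesis by (simp add: o_def)
  qed
  then have "lv 2 (f \<circ> f) = wedge u w" by (simp add: fun_eq_iff)
  then show ?thesis using L_I[OF G_comp[OF f(1) f(1)] lv_square_1(1)[OF f(2)]] by simp
qed

text \<open>The diagonals of lifts of two disjoint transpositions are pairings with
  \<open>E a\<close> and \<open>E b\<close>. These pair to 1, so the commutator contributes
  \<open>wedge (E a) (E b)\<close>, beyond the four-cycles given by squares.\<close>

lemma alt_mem_L2:
  assumes \<beta>: "alt_form \<beta>" shows "\<beta> \<in> L 2"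
proof -
  have D: "1 \<in> {1..D}" "2 \<in> {1..D}" "3 \<in> {1..D}" "4 \<in> {1..D}" using D_ge by auto
  note pE = pr_E[OF D(1)] pr_E[OF D(2)] pr_E[OF D(3)] pr_E[OF D(4)]
  let ?p = "E 1 + E 2"
  have "pr ?p (E 1) = 1" "pr ?p (E 3 + E 4) = 0" using D by (simp_all add: pE)
  then obtain q where q: "form ?p q = 0" "\<And>x. pr x q = pr x (E 3 + E 4)"
    using orthogonal_adjust by blast
  obtain t \<gamma> where t: "t \<in> G" "gam 1 \<gamma>" "t = tv 1 ?p \<circ> \<gamma>"
    by (rule E_decompose[of 1 2 ?p]) (use D in auto)
  obtain s \<delta> where s: "s \<in> G" "gam 1 \<delta>" "s = tv 1 q \<circ> \<delta>"
    by (rule E_decompose[of 3 4 q]) (use D q in auto)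
  obtain a where a: "a \<in> {1, 2}" "\<And>x. lv 1 \<gamma> x x = pr x (E a)"
    using diag_transposition[OF D(1,2) _ _ t] by auto
  obtain b where b: "b \<in> {3, 4}" "\<And>x. lv 1 \<delta> x x = pr x (E b)"
    using diag_transposition[OF D(3,4) _ q(2) s] by auto
  have q': "pr q x = pr (E 3 + E 4) x" for x using q(2)[of x] by (simp only: pr_commute)
  have o: "pr ?p (E a) = 1" "pr ?p (E b) = 0" "pr q (E a) = 0" "pr q (E b) = 1"
    using a(1) b(1) D by (auto simp: q' pE)
  \<comment> \<open>\<open>lv_commutator_2\<close> requires exact orthogonality, hence the congruent
    replacements of \<open>E b\<close> and \<open>E a\<close>.\<close>
  obtain b' where b': "form ?p b' = 0" "\<And>x. pr x b' = pr x (E b)"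
    using orthogonal_adjust[OF o(1,2)] by blast
  obtain a' where a': "form q a' = 0" "\<And>x. pr x a' = pr x (E a)"
    using orthogonal_adjust[OF o(4,3)] by blast
  obtain t' \<gamma>' where t': "t' \<in> G" "gam 2 \<gamma>'" "t' = tv 1 ?p \<circ> (tv 2 a' \<circ> \<gamma>')"
    by (rule normal_lift[OF t, of a']) (use a a' in auto)
  obtain s' \<delta>' where s': "s' \<in> G" "gam 2 \<delta>'" "s' = tv 1 q \<circ> (tv 2 b' \<circ> \<delta>')"
    by (rule normal_lift[OF s, of b']) (use b b' in auto)
  have "pr a' b' = pr (E a) (E b)" using a'(2)[of "E b"] b'(2)[of a'] by (simp add: pr_commute)
  then have ab: "pr a' b' = 1" using a(1) b(1) D by (auto simp: pE)
  note c = lv_commutator_2[OF t'(2) s'(2) t'(3) s'(3) q(1) b'(1) a'(1) ab]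
  have "invf (s' \<circ> t') \<circ> (t' \<circ> s') \<in> G" by (intro G_comp G_inv t' s')
  from L_I[OF this c(1)]
  have L: "wedge a' b' + (shear q (lv 2 \<gamma>') + shear ?p (lv 2 \<delta>')) \<in> L 2" unfolding c(2) .
  have sy: "sym_form (lv 2 \<gamma>')" "sym_form (lv 2 \<delta>')" using t' s' by (auto intro: sym_form_lv)
  have "shear q (lv 2 \<gamma>') = shear (E 3 + E 4) (lv 2 \<gamma>')"
    using sym_form_cong[OF sy(1) q'] by (simp add: shear_def q(2))
  moreover have "wedge a' b' = wedge (E a) (E b)" using a' b' by (intro wedge_cong) auto
  ultimately have L': "wedge (E a) (E b) + (shear (E 3 + E 4) (lv 2 \<gamma>') + shear (E 1 + E 2) (lv 2 \<delta>')) \<in> L 2"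
    using L by simp
  define a2 where "a2 = (if a = 1 then 2 else 1 :: nat)"
  define b2 where "b2 = (if b = 3 then 4 else 3 :: nat)"
  have e: "E 1 + E 2 = E a + E a2" "E 3 + E 4 = E b + E b2"
    using a(1) b(1) by (auto simp: a2_def b2_def add.commute)
  have d: "distinct [a, b, a2, b2]" "{a, b, a2, b2} \<subseteq> {1..D}"
    using a(1) b(1) D by (auto simp: a2_def b2_def)
  show ?thesis
  proof (rule stable_forms.alt_mem_from_commutator[OF stable_L _ L'[unfolded e] sy d \<beta>])
    fix i j k l assume "distinct [i, j, k, l]" "{i, j, k, l} \<subseteq> {1..D}"
    then show "wedge (E i + E j) (E k + E l) \<in> L 2"
      by (intro four_cycle_mem_L2) (auto simp: pr_E)
  qed simp
qed

text \<open>By \<open>lv_quartic\<close> the diagonal at level 3 has two terms. The first is a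
  pairing with \<open>E 1\<close> or \<open>E 2\<close>, zero at \<open>E 3 + E 5\<close>; the
  second is made 1 by the choice of the lift.\<close>

lemma L3_not_alt: "\<exists>\<beta>\<in>L 3. \<exists>x. \<beta> x x \<noteq> 0"
proof -
  have D: "1 \<in> {1..D}" "2 \<in> {1..D}" "3 \<in> {1..D}" "4 \<in> {1..D}" "5 \<in> {1..D}" using D_ge by auto
  note pE = pr_E[OF D(1)] pr_E[OF D(2)] pr_E[OF D(3)] pr_E[OF D(4)] pr_E[OF D(5)]
  let ?p = "E 1 + E 2" and ?y = "E 3 + E 5"
  have "\<exists>t \<gamma>. t \<in> G \<and> gam 1 \<gamma> \<and> t = tv 1 ?p \<circ> \<gamma> \<and> lv 1 \<gamma> ?y ?p = 1"
  proof -
    obtain t \<gamma> where t: "t \<in> G" "gam 1 \<gamma>" "t = tv 1 ?p \<circ> \<gamma>"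
      by (rule E_decompose[of 1 2 ?p]) (use D in auto)
    show ?thesis
    proof (cases "lv 1 \<gamma> ?y ?p = 1")
      case False
      \<comment> \<open>Composing with an element that has this triangle as level form flips the
        value at \<open>?y\<close> and \<open>?p\<close>.\<close>
      let ?w = "wedge (E 1 + E 3) (E 1 + E 4)"
      obtain f where f: "f \<in> G" "gam 1 f" "?w = lv 1 f"
        using alt_mem_L1[OF alt_form_wedge] by (rule L_E)
      have "lv 1 (\<gamma> \<circ> f) ?y ?p = lv 1 \<gamma> ?y ?p + ?w ?y ?p"
        using lv_comp[OF t(2) f(2)] by (simp only: f(3) plus_fun_apply zero_less_one)
      also have "?w ?y ?p = 1" using D by (simp add: wedge_def pE del: wedge_add)
      finally have "lv 1 (\<gamma> \<circ> f) ?y ?p = 1" using False by (simp add: o_def)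
      then show ?thesis using t f
        by (intro exI[of _ "t \<circ> f"] exI[of _ "\<gamma> \<circ> f"]) (simp add: G_comp gam_comp(1) o_assoc)
    qed (use t in blast)
  qed
  then obtain t \<gamma> where t: "t \<in> G" "gam 1 \<gamma>" "t = tv 1 ?p \<circ> \<gamma>" and y: "lv 1 \<gamma> ?y ?p = 1" by blast
  note sy = sym_form_lv[OF t(2) zero_less_one]
  let ?b = "lev 1 \<gamma> ?p"
  have x: "pr (E 1) ?p = 1" using D by (simp add: pE)
  have pb: "lv 1 \<gamma> ?p ?p = 1" by (rule diag_self[OF t x])
  have b: "lv 1 \<gamma> ?p x = pr ?b x" for x by (simp add: lv_def)
  have w: "lv 1 (t \<circ> t) = wedge ?p ?b"
    using lv_transvection_square(2)[OF t(2,3)] pb unfolding shear_eq[OF sy b] b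
    by (simp add: ac_simps del: wedge_add pr_add)
  have pb': "pr ?p ?b = 1" using pb b pr_commute by metis
  have "pr ?p (E 1) = 1" "pr ?p ?y = 0" using D by (simp_all add: pE)
  then obtain x where x: "form ?p x = 0" "\<And>z. pr z x = pr z ?y" using orthogonal_adjust by blast
  have x': "pr x z = pr ?y z" for z using x(2)[of z] by (simp only: pr_commute)
  have "form x ?p = 0" by (simp only: form_commute[of x ?p] x(1) neg_equal_0_iff_equal)
  from lv_quartic(2)[OF t(2,3) w pb' this]
  have q: "lv 3 ((t \<circ> t) \<circ> (t \<circ> t)) x x = lv 1 \<gamma> x x + lv 1 \<gamma> x ?p" .
  obtain a where a: "a \<in> {1, 2}" "\<And>x. lv 1 \<gamma> x x = pr x (E a)"
    using diag_transposition[OF D(1,2) _ _ t] by auto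
  have "lv 1 \<gamma> x x = 0" using a(1) D by (auto simp: a(2) x' pE)
  moreover have "lv 1 \<gamma> x ?p = 1" using sym_form_cong(1)[OF sy x'] y by simp
  ultimately have "lv 3 ((t \<circ> t) \<circ> (t \<circ> t)) x x \<noteq> 0" using q by simp
  moreover have "lv 3 ((t \<circ> t) \<circ> (t \<circ> t)) \<in> L 3"
    by (intro L_I G_comp t lv_quartic(1)[OF t(2,3) w pb'])
  ultimately show ?thesis by blast
qed

lemma sym_mem_L3: "sym_form \<beta> \<Longrightarrow> \<beta> \<in> L 3"
proof -
  assume \<beta>: "sym_form \<beta>"
  have "\<gamma> \<in> L 3" if "alt_form \<gamma>" for \<gamma> using L_Suc[OF _ alt_mem_L2[OF that]] by (simp add: numeral_3_eq_3 numeral_2_eq_2)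
  then show ?thesis
    using L3_not_alt stable_forms.all_sym_mem_if_not_alt[OF stable_L _ _ _ \<beta>, of 3] by auto
qed

end

theorem gam1_subset_G_if_extra_transvection:
  assumes "t \<in> G" "sim t (tv 1 (E D))" "gam 1 f" shows "f \<in> G"
  using no_extra_transvection[OF _ assms(1,2)] gam1_subset_G[OF _ _ assms(3)] by metis

theorem gam3_subset_G:
  assumes f: "gam 3 f" shows "f \<in> G"
proof (cases "\<exists>\<beta>\<in>L 1. \<exists>x. \<beta> x x \<noteq> 0")
  case True
  then show ?thesis using gam1_subset_G gam_antimono[OF f, of 1] by auto
next
  case False
  have L3: "\<beta> \<in> L 3" if "sym_form \<beta>" for \<beta>
    by (rule sym_mem_L3[OF _ that]) (use False in blast)
  show ?thesis
  proof (rule gam_subset_G[OF _ _ f])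
    show "\<beta> \<in> L m" if "3 \<le> m" "sym_form \<beta>" for m \<beta>
      using L_mono[of 3 m \<beta>] L3 that by simp
  qed simp
qed

text \<open>Once the alternating forms are present, any further form fills the level. At level 1
  this would put all of level 1 into \<open>G\<close>, at level 2 all of level 2.\<close>

theorem L_eq_alt:
  assumes n: "\<not> (\<forall>f. gam 2 f \<longrightarrow> f \<in> G)"
  shows "L 1 = {\<beta>. alt_form \<beta>}" "L 2 = {\<beta>. alt_form \<beta>}"
proof -
  have alt1: "\<beta> x x = 0" if "\<beta> \<in> L 1" for \<beta> x
    using n gam1_subset_G[OF that] gam_antimono[of 2 _ 1] by fastforce
  have alt_L2: "\<gamma> \<in> L 2" if "alt_form \<gamma>" for \<gamma>
    by (rule alt_mem_L2[OF _ that]) (rule alt1)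
  have alt2: "\<beta> x x = 0" if "\<beta> \<in> L 2" for \<beta> x
  proof (rule ccontr)
    assume b: "\<beta> x x \<noteq> 0"
    have "\<gamma> \<in> L 2" if "sym_form \<gamma>" for \<gamma>
      using stable_forms.all_sym_mem_if_not_alt[OF stable_L alt_L2 \<open>\<beta> \<in> L 2\<close> b that] by simp
    then have "gam 2 f \<Longrightarrow> f \<in> G" for f
      using gam_subset_G[of 2 f] L_mono[OF order_refl] by auto
    then show False using n by blast
  qed
  show "L 1 = {\<beta>. alt_form \<beta>}"
    using alt1 alt_mem_L1 stable_forms.L_sym[OF stable_L[OF zero_less_one]] unfolding alt_form_def by blast
  show "L 2 = {\<beta>. alt_form \<beta>}"
    using alt2 alt_L2 stable_forms.L_sym[OF stable_L[OF zero_less_numeral]] unfolding alt_form_def by blast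
qed

end

section \<open>Counting\<close>

lemma card_image_eq_if_iff:
  assumes "\<And>x y. x \<in> A \<Longrightarrow> y \<in> A \<Longrightarrow> f x = f y \<longleftrightarrow> g x = g y"
  shows "card (f ` A) = card (g ` A)"
proof (rule bij_betw_same_card)
  show "bij_betw (\<lambda>y. g (inv_into A f y)) (f ` A) (g ` A)"
  proof (rule bij_betw_imageI)
    show "inj_on (\<lambda>y. g (inv_into A f y)) (f ` A)"
      by (rule inj_onI) (metis assms f_inv_into_f inv_into_into)
    show "(\<lambda>y. g (inv_into A f y)) ` f ` A = g ` A"
    proof -
      have "g (inv_into A f (f x)) = g x" if "x \<in> A" for x
        using assms[of "inv_into A f (f x)" x] that inv_into_into[of "f x" f A]
        by (simp add: f_inv_into_f)
      then show ?thesis by (auto simp: image_iff)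
    qed
  qed
qed

context frame_group
begin

text \<open>Relative to a fixed representative of its class modulo \<open>2^n\<close>, an element is
  determined modulo \<open>2^(n+1)\<close> by the level form of the quotient, and all of
  \<open>L n\<close> occurs.\<close>

lemma card_step:
  assumes n: "n > 0"
    and r: "\<And>f g. f \<in> G \<Longrightarrow> g \<in> G \<Longrightarrow> r f = r g \<longleftrightarrow> gam n (invf g \<circ> f)"
    and r': "\<And>f g. f \<in> G \<Longrightarrow> g \<in> G \<Longrightarrow> r' f = r' g \<longleftrightarrow> gam (Suc n) (invf g \<circ> f)"
  shows "card (r' ` G) = card (r ` G) * card (L n)"
proof -
  define s where "s = inv_into G r"
  have s: "s (r f) \<in> G" "gam n (invf (s (r f)) \<circ> f)" if "f \<in> G" for f
  proof -
    show "s (r f) \<in> G" unfolding s_def by (rule inv_into_into) (use that in auto)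
    moreover have "r (s (r f)) = r f" unfolding s_def by (rule f_inv_into_f[of _ _ G]) (use that in auto)
    ultimately show "gam n (invf (s (r f)) \<circ> f)" using r[OF that] by metis
  qed
  define F where "F = (\<lambda>f. (r f, lv n (invf (s (r f)) \<circ> f)))"
  have "card (r' ` G) = card (F ` G)"
  proof (rule card_image_eq_if_iff)
    fix f g assume fg: "f \<in> G" "g \<in> G"
    show "r' f = r' g \<longleftrightarrow> F f = F g"
    proof (cases "r f = r g")
      case True
      let ?h = "s (r g)"
      have h: "?h \<in> G" "gam n (invf ?h \<circ> f)" "gam n (invf ?h \<circ> g)"
        using s[OF fg(1)] s[OF fg(2)] True by simp_all
      have e: "invf (invf ?h \<circ> g) \<circ> (invf ?h \<circ> f) = invf g \<circ> f"
        by (rule inv_comp_cancel) (use h fg in \<open>auto intro: isom_inv G_isom\<close>)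
      have "r' f = r' g \<longleftrightarrow> lv n (invf g \<circ> f) = 0"
        using r'[OF fg] r[OF fg] True gam_Suc_iff[OF n, of "invf g \<circ> f"] by simp
      also have "lv n (invf g \<circ> f) = lv n (invf ?h \<circ> g) + lv n (invf ?h \<circ> f)"
        unfolding e[symmetric] using h n by (simp add: lv_comp gam_inv lv_inv)
      also have "\<dots> = 0 \<longleftrightarrow> F f = F g"
        unfolding F_def prod.inject using True
        by (auto simp: fun_eq_iff bit_add_eq_0_iff)
      finally show ?thesis .
    next
      case False
      then have "\<not> gam (Suc n) (invf g \<circ> f)" using r[OF fg] gam_antimono[of "Suc n" "invf g \<circ> f" n] by auto
      with False show ?thesis using r'[OF fg] by (simp add: F_def)
    qed
  qed
  also have "F ` G = (r ` G) \<times> L n"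
  proof
    show "F ` G \<subseteq> (r ` G) \<times> L n"
      using s by (auto simp: F_def intro!: L_I G_comp G_inv)
    show "(r ` G) \<times> L n \<subseteq> F ` G"
    proof
      fix q assume "q \<in> (r ` G) \<times> L n"
      then obtain h0 \<beta> where q: "q = (r h0, \<beta>)" "h0 \<in> G" "\<beta> \<in> L n" by auto
      from q(3) obtain k where k: "k \<in> G" "gam n k" "\<beta> = lv n k" by (rule L_E)
      let ?h = "s (r h0)"
      note h = s[OF q(2)]
      have rh: "r ?h = r h0" using r[OF q(2) h(1)] h(2) by simp
      have c: "invf ?h \<circ> (?h \<circ> k) = k"
        by (simp add: fun_eq_iff isom_inv_apply G_isom h(1))
      have hk: "?h \<circ> k \<in> G" by (rule G_comp[OF h(1) k(1)])
      have "r (?h \<circ> k) = r h0"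
        using r[OF hk h(1)] c k(2) rh by simp
      then have "F (?h \<circ> k) = q" unfolding F_def q(1) using c k(3) by simp
      then show "q \<in> F ` G" using hk by blast
    qed
  qed
  finally show ?thesis by (simp add: card_cartesian_product)
qed

end

context odd_frame
begin

text \<open>The coefficients below the diagonal on \<open>E 2\<close>, ..., \<open>E D\<close> are
  free: wedges of the dual vectors \<open>E 1 + E i\<close> realise every choice.\<close>

lemma card_alt_forms: "card {\<beta> :: 'v \<Rightarrow> 'v \<Rightarrow> bit. alt_form \<beta>} = 2 ^ ((D - 1) * (D - 2) div 2)"
proof -
  define P where "P = Sigma {2..D} (\<lambda>j. {2..<j})"
  define F where "F = (\<lambda>\<beta> :: 'v \<Rightarrow> 'v \<Rightarrow> bit. {(j, i) \<in> P. \<beta> (E j) (E i) = 1})"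
  have finP: "finite P" by (simp add: P_def)
  have "bij_betw F {\<beta>. alt_form \<beta>} (Pow P)"
  proof (rule bij_betw_imageI)
    show "inj_on F {\<beta>. alt_form \<beta>}"
    proof (rule inj_onI)
      fix \<beta> \<gamma> assume "\<beta> \<in> {\<beta>. alt_form \<beta>}" "\<gamma> \<in> {\<beta>. alt_form \<beta>}" and eq: "F \<beta> = F \<gamma>"
      then have a: "alt_form \<beta>" "alt_form \<gamma>" by auto
      have lt: "\<beta> (E k) (E l) = \<gamma> (E k) (E l)" if "k \<in> {2..D}" "l \<in> {2..D}" "l < k" for k l
      proof -
        have "(k, l) \<in> P" using that by (auto simp: P_def)
        then have "\<beta> (E k) (E l) = 1 \<longleftrightarrow> \<gamma> (E k) (E l) = 1" using eq unfolding F_def by blast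
        then show ?thesis by (metis bit_not_one_iff)
      qed
      show "\<beta> = \<gamma>"
      proof (rule sym_form_eqI)
        fix k l assume "k \<in> {2..D}" "l \<in> {2..D}"
        then show "\<beta> (E k) (E l) = \<gamma> (E k) (E l)"
          using lt[of k l] lt[of l k] alt_formD(2)[OF a(1)] alt_formD(2)[OF a(2)]
            sym_form_commute[OF alt_formD(1)[OF a(1)]] sym_form_commute[OF alt_formD(1)[OF a(2)]]
          by (metis linorder_neqE_nat)
      qed (use a in \<open>auto intro: alt_formD\<close>)
    qed
    show "F ` {\<beta>. alt_form \<beta>} = Pow P"
    proof
      show "F ` {\<beta>. alt_form \<beta>} \<subseteq> Pow P" by (auto simp: F_def)
      show "Pow P \<subseteq> F ` {\<beta>. alt_form \<beta>}"
      proof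
        fix S assume "S \<in> Pow P"
        then have S: "S \<subseteq> P" "finite S" using finP finite_subset by auto
        let ?w = "\<lambda>q. wedge (E 1 + E (fst q)) (E 1 + E (snd q))"
        define \<beta> where "\<beta> = (\<Sum>q\<in>S. ?w q)"
        have alt: "alt_form \<beta>" unfolding \<beta>_def by (intro alt_form_sum alt_form_wedge)
        have p: "pr (E m) (E 1 + E i) = (if m = i then 1 else 0)" if "m \<in> {2..D}" "i \<in> {2..D}" for m i
          using that by (auto simp: pr_E)
        have "\<beta> (E k) (E l) = (if (k, l) \<in> S then 1 else 0)" if kl: "(k, l) \<in> P" for k l
        proof -
          have "?w q (E k) (E l) = (if q = (k, l) then 1 else 0)" if "q \<in> S" for q
          proof -
            obtain j i where q: "q = (j, i)" by (cases q)
            have "i \<in> {2..D}" "j \<in> {2..D}" "i < j" "k \<in> {2..D}" "l \<in> {2..D}" "l < k"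
              using that kl S(1) by (auto simp: q P_def)
            then show ?thesis by (auto simp: q wedge_def p simp del: pr_add)
          qed
          then show ?thesis using S(2) unfolding \<beta>_def sum_fun_apply by simp
        qed
        then have "F \<beta> = S" using S(1) unfolding F_def by (auto split: if_splits)
        then show "S \<in> F ` {\<beta>. alt_form \<beta>}" using alt by blast
      qed
    qed
  qed
  then have "card {\<beta> :: 'v \<Rightarrow> 'v \<Rightarrow> bit. alt_form \<beta>} = 2 ^ card P"
    using finP by (simp add: bij_betw_same_card card_Pow)
  also have "card P = (\<Sum>j\<in>{2..D}. j - 2)" by (simp add: P_def)
  also have "\<dots> = (\<Sum>k\<in>{0..D - 2}. k)"
    by (rule sum.reindex_bij_witness[of _ "\<lambda>k. k + 2" "\<lambda>j. j - 2"]) (use D_ge in auto)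
  also have "\<dots> = (D - 2) * Suc (D - 2) div 2" by (rule gauss_sum_nat)
  also have "Suc (D - 2) = D - 1" using D_ge by simp
  finally have "card {\<beta> :: 'v \<Rightarrow> 'v \<Rightarrow> bit. alt_form \<beta>} = 2 ^ ((D - 2) * (D - 1) div 2)" .
  then show ?thesis by (simp only: mult.commute)
qed

end

section \<open>Cocycles\<close>

text \<open>This is Shapiro's lemma: the restriction of \<open>c\<close> to the coordinate \<open>b\<close> and the stabiliser of \<open>b\<close>
  is a homomorphism to the bits. On a transposition, \<open>c\<close> is constant off the support and its two values
  on the support agree, so the vanishing sum over an odd set makes this homomorphism zero.\<close>

lemma permutation_cocycle_trivial:
  fixes c :: "('a \<Rightarrow> 'a) \<Rightarrow> 'a \<Rightarrow> bit"
  assumes fin: "finite S" and odd: "odd (card S)"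
    and coc: "\<And>\<sigma> \<rho> j. \<sigma> permutes S \<Longrightarrow> \<rho> permutes S \<Longrightarrow> j \<in> S \<Longrightarrow>
      c (\<sigma> \<circ> \<rho>) (\<sigma> j) = c \<sigma> (\<sigma> j) + c \<rho> j"
    and sum0: "\<And>\<sigma>. \<sigma> permutes S \<Longrightarrow> (\<Sum>i\<in>S. c \<sigma> i) = 0"
  shows "\<exists>w. \<forall>\<sigma>. \<sigma> permutes S \<longrightarrow> (\<forall>j\<in>S. c \<sigma> (\<sigma> j) = w (\<sigma> j) + w j)"
proof -
  let ?\<tau> = "Transposition.transpose"
  have c_id: "c id j = 0" if "j \<in> S" for j
    using coc[OF permutes_id permutes_id that] by simp
  have tr: "?\<tau> a b permutes S" if "a \<in> S" "b \<in> S" for a b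
    using that by (rule permutes_swap_id)
  \<comment> \<open>When \<open>\<tau>\<close> fixes \<open>k\<close>, the two contributions of
    \<open>\<pi>\<close> cancel.\<close>
  have conj: "c (\<pi> \<circ> (\<tau> \<circ> invf \<pi>)) (\<pi> k) = c \<tau> k"
    if \<pi>: "\<pi> permutes S" and \<tau>: "\<tau> permutes S" and k: "k \<in> S" "\<tau> k = k" for \<pi> \<tau> k
  proof -
    note \<pi>' = permutes_inv[OF \<pi>]
    have pk: "\<pi> k \<in> S" using \<pi> k by (simp add: permutes_in_image)
    have "c (\<pi> \<circ> (\<tau> \<circ> invf \<pi>)) (\<pi> k) = c \<pi> (\<pi> k) + c (\<tau> \<circ> invf \<pi>) k"
      by (rule coc[OF \<pi> permutes_compose[OF \<pi>' \<tau>] k(1)])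
    also have "c (\<tau> \<circ> invf \<pi>) k = c \<tau> k + c (invf \<pi>) k"
      using coc[OF \<tau> \<pi>' k(1)] k(2) by simp
    also have "c (invf \<pi>) k = c \<pi> (\<pi> k)"
      using coc[OF \<pi>' \<pi> k(1)] coc[OF \<pi>' \<pi> k(1)] c_id[of k]
        coc[OF \<pi> \<pi>' k(1)] c_id[OF pk] permutes_inv_o[OF \<pi>]
      by (simp add: bit_add_eq_0_iff)
    finally show ?thesis by (simp add: ac_simps o_def)
  qed
  have zero: "c (?\<tau> a b) k = 0" if ab: "a \<in> S" "b \<in> S" "a \<noteq> b" and k: "k \<in> S" "k \<noteq> a" "k \<noteq> b" for a b k
  proof -
    \<comment> \<open>The transposition of \<open>k\<close> and \<open>l\<close> centralises that of
      \<open>a\<close> and \<open>b\<close>.\<close>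
    have const: "c (?\<tau> a b) l = c (?\<tau> a b) k" if l: "l \<in> S - {a, b}" for l
    proof -
      let ?\<pi> = "?\<tau> k l"
      have "?\<pi> \<circ> (?\<tau> a b \<circ> invf ?\<pi>) = ?\<tau> a b"
        using ab k l by (auto simp: fun_eq_iff transpose_def)
      then show ?thesis using conj[OF tr tr k(1), of k l a b] ab k l by simp
    qed
    have "?\<tau> a b \<circ> ?\<tau> a b = id" by (simp add: fun_eq_iff)
    then have "c (?\<tau> a b) a + c (?\<tau> a b) b = 0"
      using coc[OF tr[OF ab(1,2)] tr[OF ab(1,2)] ab(1)] c_id[OF ab(2)] by (simp add: add.commute)
    moreover have "(\<Sum>i\<in>S. c (?\<tau> a b) i) = (\<Sum>i\<in>S - {a, b}. c (?\<tau> a b) i) + (\<Sum>i\<in>{a, b}. c (?\<tau> a b) i)"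
      by (rule sum.subset_diff) (use ab fin in auto)
    moreover have "(\<Sum>i\<in>S - {a, b}. c (?\<tau> a b) i) = (\<Sum>i\<in>S - {a, b}. c (?\<tau> a b) k)"
      by (rule sum.cong[OF refl const])
    moreover have "card (S - {a, b}) = card S - 2" using ab fin by (simp add: card_Diff_subset)
    moreover have "card S \<ge> 2" using card_mono[OF fin, of "{a, b}"] ab by simp
    ultimately show ?thesis
      using sum0[OF tr[OF ab(1,2)]] ab odd by (simp add: of_nat_bit)
  qed
  show ?thesis
  proof (cases "S = {}")
    case False
    then obtain b where b: "b \<in> S" by blast
    have stab: "c \<rho> b = 0" if "\<rho> permutes S - {b}" for \<rho>
    proof -
      have "finite (S - {b})" using fin by simp
      from that this show ?thesis
      proof (induction rule: permutes_induct)
        case id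
        show ?case by (rule c_id[OF b])
      next
        case (swap x y p)
        have p: "p permutes S" by (rule permutes_subset[OF swap.hyps(4)]) auto
        have "p b = b" by (rule permutes_not_in[OF swap.hyps(4)]) simp
        moreover have "c (?\<tau> x y) b = 0" by (rule zero) (use swap b in auto)
        moreover have "?\<tau> x y b = b" using swap by (auto simp: transpose_def)
        ultimately show ?case
          using coc[OF tr[of x y] p b] swap by (auto simp: o_def)
      qed
    qed
    \<comment> \<open>The values on coset representatives of the stabiliser of \<open>b\<close>;
      comparing \<open>\<sigma>\<close> with the element \<open>?\<rho>\<close> of the stabiliser
      gives the coboundary.\<close>
    define w where "w = (\<lambda>k. c (?\<tau> b k) k)"
    have "c \<sigma> (\<sigma> j) = w (\<sigma> j) + w j" if \<sigma>: "\<sigma> permutes S" and j: "j \<in> S" for \<sigma> j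
    proof -
      have sj: "\<sigma> j \<in> S" using \<sigma> j by (simp add: permutes_in_image)
      let ?a = "?\<tau> b (\<sigma> j)" and ?b = "?\<tau> b j"
      let ?\<rho> = "?a \<circ> (\<sigma> \<circ> ?b)"
      have \<rho>: "?\<rho> permutes S" by (intro permutes_compose tr \<sigma> b j sj)
      have "?\<rho> b = b" by simp
      then have "?\<rho> permutes S - {b}" using \<rho> permutes_superset[OF \<rho>, of "S - {b}"] by auto
      then have \<rho>0: "c ?\<rho> b = 0" by (rule stab)
      have "?a \<circ> ?\<rho> = \<sigma> \<circ> ?b" by (simp add: fun_eq_iff)
      then have "c (\<sigma> \<circ> ?b) (\<sigma> j) = w (\<sigma> j)"
        using coc[OF tr[OF b sj] \<rho> b] \<rho>0 by (simp add: w_def)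
      then show ?thesis
        using coc[OF \<sigma> tr[OF b j] j] by (simp add: w_def bit_add_eq_0_iff) (metis add.commute bit_add_self_left)
    qed
    then show ?thesis by blast
  qed auto
qed

text \<open>Modulo \<open>2^n\<close>, \<open>G\<close> is contained in \<open>H\<close>. The
  discrepancies \<open>h \<circ> invf g\<close> are measured at level \<open>n\<close> modulo
  alternating forms, that is by their diagonals.\<close>

locale group_pair = frame_group scale form D E G + H: frame_group scale form D E H
  for scale :: "two_adic \<Rightarrow> 'v::ab_group_add \<Rightarrow> 'v" and form D E G H +
  fixes n :: nat
  assumes n_pos: "n > 0"
    and agree: "g \<in> G \<Longrightarrow> \<exists>h\<in>H. gam n (h \<circ> invf g)"
    and alt_G: "\<beta> \<in> L n \<Longrightarrow> \<beta> x x = 0"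
    and alt_H: "\<beta> \<in> H.L n \<Longrightarrow> \<beta> x x = 0"
begin

text \<open>The choice of the partner does not matter for the defect, because two partners differ by an element
  of \<open>H\<close> whose level form is alternating.\<close>

definition partner :: "('v \<Rightarrow> 'v) \<Rightarrow> 'v \<Rightarrow> 'v" where
  "partner g = (SOME h. h \<in> H \<and> gam n (h \<circ> invf g))"

definition defect :: "('v \<Rightarrow> 'v) \<Rightarrow> 'v \<Rightarrow> bit" where
  "defect g x = lv n (partner g \<circ> invf g) x x"

lemma partner: "g \<in> G \<Longrightarrow> partner g \<in> H" "g \<in> G \<Longrightarrow> gam n (partner g \<circ> invf g)"
  using someI_ex[of "\<lambda>h. h \<in> H \<and> gam n (h \<circ> invf g)"] agree[of g] unfolding partner_def by blast+

lemma defect_eq: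
  assumes g: "g \<in> G" and h: "h \<in> H" "gam n (h \<circ> invf g)"
  shows "lv n (h \<circ> invf g) x x = defect g x"
proof -
  let ?p = "partner g"
  note p = partner[OF g]
  have e: "(h \<circ> invf ?p) \<circ> (?p \<circ> invf g) = h \<circ> invf g"
    by (simp add: fun_eq_iff isom_inv_apply H.G_isom p)
  have "(h \<circ> invf g) \<circ> invf (?p \<circ> invf g) = h \<circ> invf ?p"
    using G_isom[OF g] H.G_isom[OF p(1)]
    by (simp add: isom_inv_comp isom_inv fun_eq_iff inv_inv_eq isom_bij isom_inv_apply)
  then have hp: "gam n (h \<circ> invf ?p)" using gam_comp(1)[OF h(2) gam_inv[OF p(2)]] by simp
  have "lv n (h \<circ> invf ?p) \<in> H.L n" by (intro H.L_I H.G_comp H.G_inv h p hp)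
  then have "lv n (h \<circ> invf ?p) x x = 0" by (rule alt_H)
  then show ?thesis
    using lv_comp[OF hp p(2) n_pos] unfolding e defect_def by simp
qed

lemma defect_functional: "g \<in> G \<Longrightarrow> bit_functional (defect g)"
  unfolding defect_def[abs_def] by (intro sym_form_diag sym_form_lv partner n_pos)

lemma defect_cong: "g \<in> G \<Longrightarrow> (\<And>y. pr x y = pr x' y) \<Longrightarrow> defect g x = defect g x'"
  unfolding defect_def using sym_form_cong[OF sym_form_lv[OF partner(2) n_pos]] by metis

text \<open>The cocycle identity: with partners \<open>p\<close> and \<open>q\<close>,
  \<open>(p q) (g h)^-1\<close> is \<open>p g^-1\<close> times the conjugate of
  \<open>q h^-1\<close> by \<open>g\<close>, and level forms add.\<close>

lemma defect_comp:
  assumes g: "g \<in> G" and h: "h \<in> G"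
  shows "defect (g \<circ> h) x = defect g x + defect h (invf g x)"
proof -
  let ?p = "partner g" and ?q = "partner h"
  note p = partner[OF g] and q = partner[OF h]
  let ?k = "invf (invf g) \<circ> (?q \<circ> invf h) \<circ> invf g"
  note ig = isom_inv[OF G_isom[OF g]]
  have k: "gam n ?k" "lv n ?k x x = defect h (invf g x)"
    using gam_conj[OF ig q(2)] by (simp_all add: defect_def)
  have e: "(?p \<circ> ?q) \<circ> invf (g \<circ> h) = (?p \<circ> invf g) \<circ> ?k"
    using G_isom[OF g] G_isom[OF h]
    by (simp add: isom_inv_comp fun_eq_iff inv_inv_eq isom_bij isom_inv_apply)
  have "lv n ((?p \<circ> ?q) \<circ> invf (g \<circ> h)) x x = defect (g \<circ> h) x"
  proof (rule defect_eq)
    show "g \<circ> h \<in> G" by (rule G_comp[OF g h])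
    show "?p \<circ> ?q \<in> H" by (rule H.G_comp[OF p(1) q(1)])
    show "gam n ((?p \<circ> ?q) \<circ> invf (g \<circ> h))" unfolding e by (rule gam_comp(1)[OF p(2) k(1)])
  qed
  then show ?thesis
    unfolding e using k by (simp add: lv_comp[OF p(2) k(1) n_pos] defect_def)
qed

lemma defect_gam:
  assumes g: "g \<in> G" "gam n g" shows "defect g x = 0"
proof -
  have e: "id \<circ> invf g = invf g" by simp
  have d: "lv n (id \<circ> invf g) x x = defect g x"
    by (rule defect_eq[OF g(1) H.G_id]) (simp add: gam_inv g)
  have "lv n (invf g) \<in> L n" by (intro L_I G_inv gam_inv g)
  from alt_G[OF this, of x] d show ?thesis by simp
qed

text \<open>By \<open>K\<close> and \<open>exact\<close> the defect descends to a cocycle of the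
  symmetric group, which is a coboundary. Conjugating \<open>H\<close> by the transvection at the
  corresponding vector changes the defect by this coboundary.\<close>

lemma conjugate_agree:
  assumes K: "\<And>f x. f \<in> G \<Longrightarrow> gam 1 f \<Longrightarrow> defect f x = 0"
    and exact: "\<And>g. g \<in> G \<Longrightarrow> \<exists>\<sigma>. \<sigma> permutes {1..D} \<and> lifts g \<sigma>"
  shows "\<exists>\<gamma>. gam n \<gamma> \<and> (\<forall>g\<in>G. \<exists>h\<in>H. gam n (\<gamma> \<circ> h \<circ> invf \<gamma> \<circ> invf g) \<and>
    alt_form (lv n (\<gamma> \<circ> h \<circ> invf \<gamma> \<circ> invf g)))"
proof -
  have inv_lift: "pr (invf g (E (\<sigma> j))) y = pr (E j) y" if "g \<in> G" "lifts g \<sigma>" "j \<in> {1..D}" for g \<sigma> j y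
    using that isom_pr[OF G_isom[OF that(1)], of "E j" y]
    by (simp add: pr_inv_adjoint G_isom lifts_def)
  have same: "defect g x = defect g' x" if g: "g \<in> G" "lifts g \<sigma>" "g' \<in> G" "lifts g' \<sigma>" for g g' \<sigma> x
  proof -
    have "sim g' g" by (rule simI) (use g in \<open>auto simp: G_isom lifts_def\<close>)
    then have "gam 1 (invf g \<circ> g')" by (intro gam_1_if_sim G_isom g)
    then have "defect (invf g \<circ> g') y = 0" for y by (intro K G_comp G_inv g)
    moreover have "g \<circ> (invf g \<circ> g') = g'" by (simp add: fun_eq_iff isom_inv_apply G_isom g)
    ultimately show ?thesis
      using defect_comp[OF g(1) G_comp[OF G_inv[OF g(1)] g(3)], of x] by simp
  qed
  define s where "s = (\<lambda>\<sigma>. SOME g. g \<in> G \<and> lifts g \<sigma>)"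
  have s: "s \<sigma> \<in> G" "lifts (s \<sigma>) \<sigma>" if "\<sigma> permutes {1..D}" for \<sigma>
    using someI_ex[of "\<lambda>g. g \<in> G \<and> lifts g \<sigma>"] G_lift[OF that] unfolding s_def by blast+
  define c where "c = (\<lambda>\<sigma> i. defect (s \<sigma>) (E i))"
  have "\<exists>w. \<forall>\<sigma>. \<sigma> permutes {1..D} \<longrightarrow> (\<forall>j\<in>{1..D}. c \<sigma> (\<sigma> j) = w (\<sigma> j) + w j)"
  proof (rule permutation_cocycle_trivial)
    fix \<sigma> \<rho> j assume \<sigma>: "\<sigma> permutes {1..D}" and \<rho>: "\<rho> permutes {1..D}" and j: "j \<in> {1..D}"
    have rho_in: "\<rho> i \<in> {1..D}" if "i \<in> {1..D}" for i
      using permutes_in_image[OF \<rho>, of i] that by blast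
    have "lifts (s \<sigma> \<circ> s \<rho>) (\<sigma> \<circ> \<rho>)"
      unfolding lifts_def
    proof (intro ballI allI)
      fix i y assume i: "i \<in> {1..D}"
      have "pr ((s \<sigma> \<circ> s \<rho>) (E i)) y = pr (s \<rho> (E i)) (invf (s \<sigma>) y)"
        using pr_inv_adjoint[OF G_isom[OF s(1)[OF \<sigma>]], of y "s \<rho> (E i)"] by (simp add: pr_commute)
      also have "\<dots> = pr (E (\<rho> i)) (invf (s \<sigma>) y)" using s(2)[OF \<rho>] i by (simp add: lifts_def)
      also have "\<dots> = pr (s \<sigma> (E (\<rho> i))) y"
        using pr_inv_adjoint[OF G_isom[OF s(1)[OF \<sigma>]], of y "E (\<rho> i)"] by (simp add: pr_commute)
      also have "\<dots> = pr (E ((\<sigma> \<circ> \<rho>) i)) y" using s(2)[OF \<sigma>] rho_in[OF i] by (simp add: lifts_def)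
      finally show "pr ((s \<sigma> \<circ> s \<rho>) (E i)) y = pr (E ((\<sigma> \<circ> \<rho>) i)) y" .
    qed
    then have "c (\<sigma> \<circ> \<rho>) i = defect (s \<sigma> \<circ> s \<rho>) (E i)" for i unfolding c_def
      by (intro same[of _ "\<sigma> \<circ> \<rho>"] s permutes_compose G_comp \<sigma> \<rho>)
    then have "c (\<sigma> \<circ> \<rho>) (\<sigma> j) = c \<sigma> (\<sigma> j) + defect (s \<rho>) (invf (s \<sigma>) (E (\<sigma> j)))"
      by (simp add: defect_comp s \<sigma> \<rho> c_def)
    also have "defect (s \<rho>) (invf (s \<sigma>) (E (\<sigma> j))) = c \<rho> j"
      unfolding c_def by (intro defect_cong s \<rho> inv_lift[OF s[OF \<sigma>] j])
    finally show "c (\<sigma> \<circ> \<rho>) (\<sigma> j) = c \<sigma> (\<sigma> j) + c \<rho> j" .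
  next
    fix \<sigma> assume "\<sigma> permutes {1..D}"
    then show "(\<Sum>i\<in>{1..D}. c \<sigma> i) = 0" unfolding c_def by (intro sum_functional_E defect_functional s)
  qed (simp_all add: odd_D)
  then obtain w0 where w0: "\<And>\<sigma> j. \<sigma> permutes {1..D} \<Longrightarrow> j \<in> {1..D} \<Longrightarrow> c \<sigma> (\<sigma> j) = w0 (\<sigma> j) + w0 j"
    by blast
  \<comment> \<open>The shift cancels in the coboundary and makes the sum zero, as \<open>D\<close>
    is odd; coordinates of a vector must sum to zero.\<close>
  define w where "w = (\<lambda>i. w0 i + (\<Sum>k\<in>{1..D}. w0 k))"
  have w: "c \<sigma> (\<sigma> j) = w (\<sigma> j) + w j" if "\<sigma> permutes {1..D}" "j \<in> {1..D}" for \<sigma> j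
    using w0[OF that] by (simp add: w_def ac_simps)
  have w_sum: "(\<Sum>i\<in>{1..D}. w i) = 0"
    using odd_D by (simp add: w_def sum.distrib of_nat_bit)
  define W where "W = (\<Sum>i\<in>{1..D}. if w i = 1 then E i else 0)"
  have W: "pr (E k) W = w k" if k: "k \<in> {1..D}" for k
  proof -
    have "pr (E k) W = (\<Sum>i\<in>{1..D}. pr (E k) (if w i = 1 then E i else 0))"
      unfolding W_def by (rule bit_functional_sum[OF pr_functional(1)])
    also have "\<dots> = (\<Sum>i\<in>{1..D}. if i = k then 0 else w i)"
      by (rule sum.cong) (use k in \<open>auto simp: pr_E\<close>)
    also have "\<dots> = (\<Sum>i\<in>{1..D} - {k}. w i)" using k by (simp add: sum.remove[of _ k])
    also have "\<dots> = w k" using w_sum sum.remove[OF _ k, of w] by (simp add: bit_add_eq_0_iff)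
    finally show ?thesis .
  qed
  let ?\<gamma> = "tv (2 ^ n) W"
  note \<gamma> = gam_tv[of n W]
  have "\<exists>h\<in>H. gam n (?\<gamma> \<circ> h \<circ> invf ?\<gamma> \<circ> invf g) \<and> alt_form (lv n (?\<gamma> \<circ> h \<circ> invf ?\<gamma> \<circ> invf g))"
    if g: "g \<in> G" for g
  proof -
    obtain \<sigma> where \<sigma>: "\<sigma> permutes {1..D}" "lifts g \<sigma>" using exact[OF g] by blast
    let ?h = "partner g"
    note p = partner[OF g]
    note ig = isom_inv[OF G_isom[OF g]]
    let ?k = "invf (invf g) \<circ> invf ?\<gamma> \<circ> invf g"
    have k: "gam n ?k" "lv n ?k x y = sq W (invf g x) (invf g y)" for x y
      using gam_conj[OF ig gam_inv[OF \<gamma>(1)]] \<gamma> n_pos by (simp_all add: lv_inv)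
    have e: "?\<gamma> \<circ> ?h \<circ> invf ?\<gamma> \<circ> invf g = ?\<gamma> \<circ> ((?h \<circ> invf g) \<circ> ?k)"
      using G_isom[OF g] by (simp add: fun_eq_iff inv_inv_eq isom_bij isom_inv_apply)
    have gm: "gam n (?\<gamma> \<circ> ((?h \<circ> invf g) \<circ> ?k))" by (intro gam_comp \<gamma> p k)
    \<comment> \<open>The diagonal of \<open>sq W\<close> is the pairing with \<open>W\<close>; it
      enters once at \<open>x\<close>, and once at \<open>invf g x\<close> from the conjugated
      inverse.\<close>
    have val: "lv n (?\<gamma> \<circ> ((?h \<circ> invf g) \<circ> ?k)) x x = pr x W + (defect g x + pr (invf g x) W)" for x
      by (simp add: lv_comp[OF \<gamma>(1) gam_comp(1)[OF p(2) k(1)] n_pos] lv_comp[OF p(2) k(1) n_pos] \<gamma>(2) k(2) defect_def sq_def)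
    note sy = sym_form_lv[OF gm n_pos]
    have "lv n (?\<gamma> \<circ> ((?h \<circ> invf g) \<circ> ?k)) x x = 0" for x
    proof (rule bit_functional_eqI[OF sym_form_diag[OF sy], of "\<lambda>_. 0"])
      fix i assume "i \<in> {2..D}"
      then have i: "i \<in> {1..D}" by auto
      then obtain j where j: "j \<in> {1..D}" "i = \<sigma> j"
        using permutes_image[OF \<sigma>(1)] by blast
      have "defect g (E i) = w i + w j"
        using same[OF g \<sigma>(2) s[OF \<sigma>(1)]] w[OF \<sigma>(1) j(1)] by (simp add: c_def j(2))
      moreover have "pr (invf g (E i)) W = w j"
        using inv_lift[OF g \<sigma>(2) j(1)] W[OF j(1)] j(2) by simp
      ultimately show "lv n (?\<gamma> \<circ> ((?h \<circ> invf g) \<circ> ?k)) (E i) (E i) = 0"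
        unfolding val by (simp add: W[OF i] ac_simps)
    qed (simp add: bit_functional_def)
    then have "alt_form (lv n (?\<gamma> \<circ> ((?h \<circ> invf g) \<circ> ?k)))" using sy by (simp add: alt_form_def)
    then show ?thesis using p(1) gm unfolding e[symmetric] by blast
  qed
  then show ?thesis using \<gamma>(1) by blast
qed

text \<open>The defect is an \<open>S\<^sub>D\<close>-homomorphism from the alternating forms to \<open>W\<^sub>0\<close>. The image of a triangle
  \<open>wedge (E i + E j) (E i + E k)\<close> is constant on \<open>{i, j, k}\<close> and constant off it. The coordinates sum
  to zero, so the first constant vanishes; the second one does because the four triangles of a
  tetrahedron sum to zero.\<close>

lemma defect_zero:
  assumes n2: "n = 2" and L1: "L 1 = {\<beta>. alt_form \<beta>}" and f: "f \<in> G" "gam 1 f"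
  shows "defect f x = 0"
proof -
  \<comment> \<open>Elements of level 1 act trivially modulo 2, so the cocycle is additive on
    them.\<close>
  have add: "defect (f \<circ> h) x = defect f x + defect h x" if "f \<in> G" "gam 1 f" "h \<in> G" for f h x
    unfolding defect_comp[OF that(1,3)]
    using defect_cong[OF that(3), of "invf f x" x] gam_pr[OF gam_inv[OF that(2)]] by simp
  \<comment> \<open>The defect vanishes on elements of level 2, so at level 1 it depends on the
    level form alone.\<close>
  have same: "defect f x = defect h x" if "f \<in> G" "gam 1 f" "h \<in> G" "gam 1 h" "lv 1 f = lv 1 h" for f h x
  proof -
    have "gam (Suc 1) (invf h \<circ> f)" by (rule gam_Suc_if_lv_eq) (use that in auto)
    then have "gam n (invf h \<circ> f)" using n2 by (simp add: numeral_2_eq_2)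
    then have "defect (invf h \<circ> f) x = 0" by (intro defect_gam G_comp G_inv that)
    moreover have "h \<circ> (invf h \<circ> f) = f" by (simp add: fun_eq_iff isom_inv_apply G_isom that)
    ultimately show ?thesis using add[OF that(3,4) G_comp[OF G_inv[OF that(3)] that(1)], of x] by simp
  qed
  define s where "s = (\<lambda>\<beta>. SOME f. f \<in> G \<and> gam 1 f \<and> lv 1 f = \<beta>)"
  have s: "s \<beta> \<in> G" "gam 1 (s \<beta>)" "lv 1 (s \<beta>) = \<beta>" if "alt_form \<beta>" for \<beta>
  proof -
    have "\<beta> \<in> L 1" using that L1 by simp
    then have "\<exists>f. f \<in> G \<and> gam 1 f \<and> lv 1 f = \<beta>" by (elim L_E) blast
    from someI_ex[OF this] show "s \<beta> \<in> G" "gam 1 (s \<beta>)" "lv 1 (s \<beta>) = \<beta>" unfolding s_def by blast+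
  qed
  define \<delta> where "\<delta> = (\<lambda>\<beta> x. defect (s \<beta>) x)"
  have \<delta>: "defect f x = \<delta> \<beta> x" if "f \<in> G" "gam 1 f" "lv 1 f = \<beta>" "alt_form \<beta>" for f \<beta> x
    unfolding \<delta>_def by (rule same) (use that s in auto)
  have \<delta>_add: "\<delta> (\<beta> + \<gamma>) x = \<delta> \<beta> x + \<delta> \<gamma> x" if "alt_form \<beta>" "alt_form \<gamma>" for \<beta> \<gamma> x
  proof -
    have "defect (s \<beta> \<circ> s \<gamma>) x = \<delta> (\<beta> + \<gamma>) x"
      by (rule \<delta>) (use that in \<open>simp_all add: s G_comp gam_comp lv_comp alt_form_plus\<close>)
    then show ?thesis using add[OF s(1,2)[OF that(1)] s(1)[OF that(2)]] by (simp add: \<delta>_def)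
  qed
  have \<delta>_0: "\<delta> 0 x = 0" for x
    using \<delta>_add[OF alt_form_0 alt_form_0, of x] by simp
  have \<delta>_functional: "bit_functional (\<delta> \<beta>)" if "alt_form \<beta>" for \<beta>
    unfolding \<delta>_def using defect_functional[OF s(1)[OF that]] by simp
  have \<delta>_cong: "\<delta> \<beta> x = \<delta> \<beta> x'" if "alt_form \<beta>" "\<And>y. pr x y = pr x' y" for \<beta> x x'
    unfolding \<delta>_def by (rule defect_cong[OF s(1)]) (use that in auto)
  have \<delta>_conj: "\<delta> (\<lambda>x y. \<beta> (g x) (g y)) x = \<delta> \<beta> (g x)" if g: "g \<in> G" and \<beta>: "alt_form \<beta>" for g \<beta> x
  proof -
    note ig = G_inv[OF g] and f = s[OF \<beta>]
    have c: "gam 1 (invf g \<circ> s \<beta> \<circ> g)" "lv 1 (invf g \<circ> s \<beta> \<circ> g) = (\<lambda>x y. \<beta> (g x) (g y))"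
      using gam_conj[OF G_isom[OF g] f(2)] f(3) by simp_all
    have m: "invf g \<circ> s \<beta> \<circ> g \<in> G" by (intro G_comp ig f g)
    have "lv 1 (invf g \<circ> s \<beta> \<circ> g) \<in> L 1" by (rule L_I[OF m c(1)])
    then have "alt_form (\<lambda>x y. \<beta> (g x) (g y))" unfolding c(2) L1 by simp
    then have "\<delta> (\<lambda>x y. \<beta> (g x) (g y)) x = defect (invf g \<circ> (s \<beta> \<circ> g)) x"
      using \<delta>[OF m c] by (simp add: o_assoc)
    also have "\<dots> = defect (invf g) x + (defect (s \<beta>) (g x) + defect g (invf (s \<beta>) (g x)))"
      using defect_comp[OF ig G_comp[OF f(1) g]] defect_comp[OF f(1) g] G_isom[OF g]
      by (simp add: inv_inv_eq isom_bij)
    also have "defect g (invf (s \<beta>) (g x)) = defect g (g x)"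
      by (rule defect_cong[OF g]) (use gam_pr[OF gam_inv[OF f(2)]] in simp)
    also have "defect g (g x) = defect (invf g) x"
    proof -
      have "invf g \<circ> g = id" by (simp add: fun_eq_iff isom_inv_apply G_isom g)
      then have "defect id x = defect (invf g) x + defect g (g x)"
        using defect_comp[OF ig g, of x] G_isom[OF g] by (simp add: inv_inv_eq isom_bij)
      moreover have "defect id x = 0" by (rule defect_gam[OF G_id gam_id])
      ultimately show ?thesis by (simp add: bit_add_eq_0_iff)
    qed
    finally show ?thesis by (simp add: \<delta>_def ac_simps)
  qed
  define T where "T = (\<lambda>i j k. wedge (E i + E j) (E i + E k))"
  have T: "alt_form (T i j k)" for i j k unfolding T_def by (rule alt_form_wedge)
  have T_sym: "T i j k = T j i k" "T i j k = T i k j" for i j k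
    by (simp_all add: T_def wedge_commute[of "E j" "E i"] wedge_commute[of "E k" "E i"]
        wedge_commute[of "E k" "E j"] ac_simps)
  have perm: "\<delta> (T (\<sigma> i) (\<sigma> j) (\<sigma> k)) (E (\<sigma> m)) = \<delta> (T i j k) (E m)"
    if \<sigma>: "\<sigma> permutes {1..D}" and ijk: "i \<in> {1..D}" "j \<in> {1..D}" "k \<in> {1..D}" "m \<in> {1..D}" for \<sigma> i j k m
  proof -
    obtain g where g: "g \<in> G" "lifts g \<sigma>" using G_lift[OF \<sigma>] by blast
    have e: "pr (g x) (E (\<sigma> a)) = pr x (E a)" if "a \<in> {1..D}" for x a
      using g(2) that isom_pr[OF G_isom[OF g(1)], of x "E a"] by (simp add: lifts_def pr_commute[of "g x"])
    have "(\<lambda>x y. T (\<sigma> i) (\<sigma> j) (\<sigma> k) (g x) (g y)) = T i j k"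
      using ijk by (simp add: T_def wedge_def fun_eq_iff e del: wedge_add)
    then have "\<delta> (T i j k) (E m) = \<delta> (T (\<sigma> i) (\<sigma> j) (\<sigma> k)) (g (E m))"
      using \<delta>_conj[OF g(1) T, of "\<sigma> i" "\<sigma> j" "\<sigma> k" "E m"] by simp
    also have "\<dots> = \<delta> (T (\<sigma> i) (\<sigma> j) (\<sigma> k)) (E (\<sigma> m))"
      by (rule \<delta>_cong[OF T]) (use g(2) ijk in \<open>simp add: lifts_def\<close>)
    finally show ?thesis by simp
  qed
  have outside: "\<delta> (T i j k) (E m) = \<delta> (T i' j' k') (E m')"
    if "distinct [i, j, k, m]" "{i, j, k, m} \<subseteq> {1..D}" "distinct [i', j', k', m']" "{i', j', k', m'} \<subseteq> {1..D}"
    for i j k m i' j' k' m'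
  proof -
    have "\<exists>\<sigma>. \<sigma> permutes {1..D} \<and> map \<sigma> [i, j, k, m] = [i', j', k', m']"
      by (rule permutes_map_distinct) (use that in simp_all)
    then obtain \<sigma> where "\<sigma> permutes {1..D}" "map \<sigma> [i, j, k, m] = [i', j', k', m']" by (elim exE conjE)
    then show ?thesis using perm[of \<sigma> i j k m] that by auto
  qed
  have inside: "\<delta> (T i j k) (E i) = \<delta> (T i' j' k') (E i')"
    if "distinct [i, j, k]" "{i, j, k} \<subseteq> {1..D}" "distinct [i', j', k']" "{i', j', k'} \<subseteq> {1..D}"
    for i j k i' j' k'
  proof -
    have "\<exists>\<sigma>. \<sigma> permutes {1..D} \<and> map \<sigma> [i, j, k] = [i', j', k']"
      by (rule permutes_map_distinct) (use that in simp_all)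
    then obtain \<sigma> where "\<sigma> permutes {1..D}" "map \<sigma> [i, j, k] = [i', j', k']" by (elim exE conjE)
    then show ?thesis using perm[of \<sigma> i j k i] that by auto
  qed
  have D: "1 \<in> {1..D}" "2 \<in> {1..D}" "3 \<in> {1..D}" "4 \<in> {1..D}" using D_ge by auto
  have in0: "\<delta> (T i j k) (E i) = 0" if ijk: "distinct [i, j, k]" "{i, j, k} \<subseteq> {1..D}" for i j k
  proof -
    have "\<exists>c. \<forall>m\<in>{1..D} - {i, j, k}. \<delta> (T i j k) (E m) = c"
    proof (cases "\<exists>m. m \<in> {1..D} - {i, j, k}")
      case True
      then obtain m where m: "m \<in> {1..D} - {i, j, k}" by blast
      have "\<delta> (T i j k) (E m') = \<delta> (T i j k) (E m)" if "m' \<in> {1..D} - {i, j, k}" for m'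
        by (rule outside) (use that m ijk in auto)
      then show ?thesis by blast
    qed blast
    then obtain c where c: "\<And>m. m \<in> {1..D} - {i, j, k} \<Longrightarrow> \<delta> (T i j k) (E m) = c" by blast
    have a: "\<delta> (T i j k) (E j) = \<delta> (T i j k) (E i)" "\<delta> (T i j k) (E k) = \<delta> (T i j k) (E i)"
    proof -
      have "\<delta> (T i j k) (E j) = \<delta> (T j i k) (E j)" by (simp only: T_sym(1)[of i j k])
      also have "\<dots> = \<delta> (T i j k) (E i)" by (rule inside) (use ijk in auto)
      finally show "\<delta> (T i j k) (E j) = \<delta> (T i j k) (E i)" .
      have "\<delta> (T i j k) (E k) = \<delta> (T k i j) (E k)" by (simp only: T_sym(2)[of i j k] T_sym(1)[of i k j])
      also have "\<dots> = \<delta> (T i j k) (E i)" by (rule inside) (use ijk in auto)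
      finally show "\<delta> (T i j k) (E k) = \<delta> (T i j k) (E i)" .
    qed
    have "(\<Sum>m\<in>{1..D}. \<delta> (T i j k) (E m)) = (\<Sum>m\<in>{1..D} - {i, j, k}. \<delta> (T i j k) (E m)) + (\<Sum>m\<in>{i, j, k}. \<delta> (T i j k) (E m))"
      by (rule sum.subset_diff) (use ijk in auto)
    also have "(\<Sum>m\<in>{1..D} - {i, j, k}. \<delta> (T i j k) (E m)) = (\<Sum>m\<in>{1..D} - {i, j, k}. c)"
      by (rule sum.cong[OF refl c])
    also have "\<dots> = of_nat (D - 3) * c" using ijk by (simp add: card_Diff_subset)
    also have "\<dots> = 0" using odd_D D_ge by (simp add: of_nat_bit)
    also have "(\<Sum>m\<in>{i, j, k}. \<delta> (T i j k) (E m)) = \<delta> (T i j k) (E i)"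
      using ijk by (simp add: a)
    finally show ?thesis using sum_functional_E[OF \<delta>_functional[OF T]] by simp
  qed
  \<comment> \<open>All three faces on the right have 4 as a vertex, so \<open>in0\<close> applies
    at \<open>E 4\<close>.\<close>
  have "T 1 2 3 = T 4 1 2 + (T 4 1 3 + T 4 2 3)"
    by (simp add: T_def wedge_commute[of "E 4" "E 1"] wedge_commute[of "E 4" "E 2"] wedge_commute[of "E 4" "E 3"]
        wedge_commute[of "E 3" "E 1"] wedge_commute[of "E 3" "E 2"] wedge_commute[of "E 2" "E 1"] ac_simps)
  then have "\<delta> (T 1 2 3) (E 4) = \<delta> (T 4 1 2) (E 4) + (\<delta> (T 4 1 3) (E 4) + \<delta> (T 4 2 3) (E 4))"
    by (simp only: \<delta>_add alt_form_plus T)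
  also have "\<dots> = 0" using D by (simp add: in0)
  finally have out0: "\<delta> (T 1 2 3) (E 4) = 0" .
  have tri0: "\<delta> (T i j k) x = 0" if ijk: "distinct [i, j, k]" "{i, j, k} \<subseteq> {1..D}" for i j k x
  proof (rule bit_functional_eqI[OF \<delta>_functional[OF T], of "\<lambda>_. 0"])
    fix m assume "m \<in> {2..D}"
    then have m: "m \<in> {1..D}" by auto
    consider "m = i" | "m = j" | "m = k" | "m \<notin> {i, j, k}" by blast
    then show "\<delta> (T i j k) (E m) = 0"
    proof cases
      case 1 then show ?thesis using in0[OF ijk] by simp
    next
      case 2 then show ?thesis using in0[of j i k] ijk by (simp add: T_sym(1)[of i j k])
    next
      case 3 then show ?thesis using in0[of k i j] ijk by (simp add: T_sym(2)[of i j k] T_sym(1)[of i k j])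
    next
      case 4
      have "\<delta> (T i j k) (E m) = \<delta> (T 1 2 3) (E 4)" by (rule outside) (use 4 m ijk D in auto)
      then show ?thesis using out0 by simp
    qed
  qed (simp add: bit_functional_def)
  have "alt_form (lv 1 f)" using L_I[OF f] L1 by simp
  then have "alt_form (lv 1 f) \<and> (\<forall>x. \<delta> (lv 1 f) x = 0)"
  proof (rule alt_form_induct)
    fix i j assume "i \<in> {2..D}" "j \<in> {2..D}" "i \<noteq> j"
    then show "alt_form (wedge (E 1 + E i) (E 1 + E j)) \<and> (\<forall>x. \<delta> (wedge (E 1 + E i) (E 1 + E j)) x = 0)"
      using tri0[of 1 i j] T[of 1 i j] by (auto simp: T_def simp del: wedge_add)
  next
    show "alt_form 0 \<and> (\<forall>x. \<delta> 0 x = 0)" using alt_form_0 \<delta>_0 by blast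
  next
    fix \<beta> \<gamma>
    assume a: "alt_form \<beta> \<and> (\<forall>x. \<delta> \<beta> x = 0)" "alt_form \<gamma> \<and> (\<forall>x. \<delta> \<gamma> x = 0)"
    then have "\<delta> (\<beta> + \<gamma>) x = 0" for x using \<delta>_add[of \<beta> \<gamma> x] by simp
    then show "alt_form (\<beta> + \<gamma>) \<and> (\<forall>x. \<delta> (\<beta> + \<gamma>) x = 0)" using a alt_form_plus by blast
  qed
  then show ?thesis using \<delta>[OF f refl] by simp
qed

end

section \<open>Conjugacy\<close>

context frame_group
begin

lemma frame_group_conjugate:
  assumes g: "gam 1 \<gamma>" shows "frame_group scale form D E ((\<lambda>h. \<gamma> \<circ> h \<circ> invf \<gamma>) ` G)"
proof unfold_locales
  let ?c = "\<lambda>h. \<gamma> \<circ> h \<circ> invf \<gamma>"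
  note i = gam_isom[OF g]
  note inv = isom_inv_apply[OF i]
  show "isom f" if "f \<in> ?c ` G" for f
    using that i by (auto intro: isom_comp isom_inv G_isom simp del: o_apply)
  show "id \<in> ?c ` G"
    by (rule image_eqI[OF _ G_id]) (simp add: fun_eq_iff inv)
  show "f \<circ> h \<in> ?c ` G" if "f \<in> ?c ` G" "h \<in> ?c ` G" for f h
  proof -
    from that obtain a b where ab: "a \<in> G" "f = ?c a" "b \<in> G" "h = ?c b" by blast
    show ?thesis
      by (rule image_eqI[OF _ G_comp[OF ab(1,3)]]) (simp add: ab fun_eq_iff inv)
  qed
  show "invf f \<in> ?c ` G" if "f \<in> ?c ` G" for f
  proof -
    from that obtain a where a: "a \<in> G" "f = ?c a" by blast
    show ?thesis
      by (rule image_eqI[OF _ G_inv[OF a(1)]])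
        (simp add: a isom_inv_comp isom_comp isom_inv i G_isom inv_inv_eq isom_bij o_assoc)
  qed
  show "\<exists>f\<in>?c ` G. lifts f \<sigma>" if "\<sigma> permutes {1..D}" for \<sigma>
  proof -
    obtain h where h: "h \<in> G" "lifts h \<sigma>" using G_lift[OF \<open>\<sigma> permutes {1..D}\<close>] by blast
    have "pr (h (invf \<gamma> x)) y = pr (h x) y" for x y
      using pr_inv_adjoint[OF G_isom[OF h(1)], of y] gam_pr[OF gam_inv[OF g]]
      by (metis pr_commute zero_less_one)
    then have "lifts (?c h) \<sigma>" using h(2) by (simp add: lifts_def gam_pr[OF g])
    then show ?thesis using h(1) by blast
  qed
  fix f assume f: "isom f" and cl: "\<And>n. \<exists>g\<in>?c ` G. \<forall>x. \<exists>z. f x = g x + scale (2 ^ n) z"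
  let ?f = "invf \<gamma> \<circ> f \<circ> \<gamma>"
  have "?f \<in> G"
  proof (rule G_closed)
    show "isom ?f" by (intro isom_comp isom_inv i f)
    fix n
    from cl[of n] obtain h where h: "h \<in> G" "\<forall>x. \<exists>z. f x = ?c h x + scale (2 ^ n) z" by blast
    have "\<exists>z. ?f x = h x + scale (2 ^ n) z" for x
    proof -
      obtain z where "f (\<gamma> x) = ?c h (\<gamma> x) + scale (2 ^ n) z" using h(2) by blast
      then have "?f x = h x + scale (2 ^ n) (invf \<gamma> z)"
        by (simp add: inv isom_add[OF isom_inv[OF i]] isom_scale[OF isom_inv[OF i]])
      then show ?thesis by blast
    qed
    then show "\<exists>g\<in>G. \<forall>x. \<exists>z. ?f x = g x + scale (2 ^ n) z" using h(1) by blast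
  qed
  moreover have "f = ?c ?f" by (simp add: fun_eq_iff inv)
  ultimately show "f \<in> ?c ` G" by blast
qed

lemma not_gam2_conjugate:
  assumes g: "gam 1 \<gamma>" and n: "\<not> (\<forall>f. gam 2 f \<longrightarrow> f \<in> G)"
  shows "\<not> (\<forall>f. gam 2 f \<longrightarrow> f \<in> (\<lambda>h. \<gamma> \<circ> h \<circ> invf \<gamma>) ` G)"
proof -
  note i = gam_isom[OF g]
  note inv = isom_inv_apply[OF i]
  obtain f where f: "gam 2 f" "f \<notin> G" using n by blast
  let ?f = "invf (invf \<gamma>) \<circ> f \<circ> invf \<gamma>"
  have "gam 2 ?f" by (rule gam_conj(1)[OF isom_inv[OF i] f(1)])
  moreover have "?f \<notin> (\<lambda>h. \<gamma> \<circ> h \<circ> invf \<gamma>) ` G"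
  proof
    assume "?f \<in> (\<lambda>h. \<gamma> \<circ> h \<circ> invf \<gamma>) ` G"
    then obtain h where h: "h \<in> G" "?f = \<gamma> \<circ> h \<circ> invf \<gamma>" by blast
    have "f x = h x" for x
    proof -
      have "?f (\<gamma> x) = (\<gamma> \<circ> h \<circ> invf \<gamma>) (\<gamma> x)" by (simp only: h(2))
      then have "\<gamma> (f x) = \<gamma> (h x)" using i by (simp add: inv inv_inv_eq isom_bij)
      then show ?thesis by (metis inv(1))
    qed
    then show False using f(2) h(1) by (metis ext)
  qed
  ultimately show ?thesis by blast
qed

lemma sym_adjust:
  assumes f: "gam m f" "m > 0" "lv m f \<in> L m"
  obtains k where "k \<in> G" "gam (Suc m) (invf k \<circ> f)"
proof -
  from f(3) obtain k where k: "k \<in> G" "gam m k" "lv m f = lv m k" by (rule L_E)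
  then show ?thesis using that gam_Suc_if_lv_eq[OF f(1) k(2) f(2) k(3)] by blast
qed

end

context odd_frame
begin

lemma exact_conjugate:
  assumes g: "gam 1 \<gamma>" and G: "\<And>h. h \<in> G \<Longrightarrow> isom h"
    and exact: "\<And>h. h \<in> G \<Longrightarrow> \<exists>\<sigma>. \<sigma> permutes {1..D} \<and> lifts h \<sigma>"
    and f: "f \<in> (\<lambda>h. \<gamma> \<circ> h \<circ> invf \<gamma>) ` G"
  shows "\<exists>\<sigma>. \<sigma> permutes {1..D} \<and> lifts f \<sigma>"
proof -
  from f obtain h where h: "h \<in> G" "f = \<gamma> \<circ> h \<circ> invf \<gamma>" by blast
  obtain \<sigma> where \<sigma>: "\<sigma> permutes {1..D}" "lifts h \<sigma>" using exact[OF h(1)] by blast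
  have "pr (h (invf \<gamma> x)) y = pr (h x) y" for x y
    using pr_inv_adjoint[OF G[OF h(1)], of y] gam_pr[OF gam_inv[OF g]]
    by (metis pr_commute zero_less_one)
  then have "lifts f \<sigma>" using \<sigma>(2) by (simp add: h(2) lifts_def gam_pr[OF g])
  then show ?thesis using \<sigma>(1) by blast
qed

lemma lifts_agree:
  assumes "isom g" "isom h" "lifts g \<sigma>" "lifts h \<sigma>"
  shows "gam 1 (invf g \<circ> h)" "gam 1 (h \<circ> invf g)"
proof -
  have "sim h g" by (rule simI) (use assms in \<open>auto simp: lifts_def\<close>)
  then show c: "gam 1 (invf g \<circ> h)" by (intro gam_1_if_sim assms)
  have "invf (invf g) \<circ> (invf g \<circ> h) \<circ> invf g = h \<circ> invf g"
    using assms(1) by (simp add: fun_eq_iff inv_inv_eq isom_bij isom_inv_apply)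
  then show "gam 1 (h \<circ> invf g)" using gam_conj(1)[OF isom_inv[OF assms(1)] c] by simp
qed

text \<open>An element of \<open>H\<close> is corrected by \<open>G\<close> modulo 2, 4 and 8 in
  turn: both groups have the same level forms at levels 1 and 2, and \<open>G\<close> contains all
  of level 3.\<close>

lemma frame_group_subset_eq:
  assumes G: "frame_group scale form D E G" and H: "frame_group scale form D E H"
    and nG: "\<not> (\<forall>f. gam 2 f \<longrightarrow> f \<in> G)" and nH: "\<not> (\<forall>f. gam 2 f \<longrightarrow> f \<in> H)"
    and exact: "\<And>h. h \<in> H \<Longrightarrow> \<exists>\<sigma>. \<sigma> permutes {1..D} \<and> lifts h \<sigma>" and sub: "G \<subseteq> H"
  shows "H \<subseteq> G"
proof
  interpret G: frame_group scale form D E G by (fact G)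
  interpret H: frame_group scale form D E H by (fact H)
  note LG = G.L_eq_alt[OF nG] and LH = H.L_eq_alt[OF nH]
  fix h assume h: "h \<in> H"
  obtain \<sigma> where \<sigma>: "\<sigma> permutes {1..D}" "lifts h \<sigma>" using exact[OF h] by blast
  obtain g where g: "g \<in> G" "lifts g \<sigma>" using G.G_lift[OF \<sigma>(1)] by blast
  let ?f1 = "invf g \<circ> h"
  have f1: "gam 1 ?f1" by (rule lifts_agree(1)) (use g h \<sigma> G.G_isom H.G_isom in auto)
  have f1H: "?f1 \<in> H" by (intro H.G_comp H.G_inv h subsetD[OF sub] g)
  have "lv 1 ?f1 \<in> G.L 1" using H.L_I[OF f1H f1] LG LH by simp
  then obtain k where k: "k \<in> G" "gam (Suc 1) (invf k \<circ> ?f1)" using G.sym_adjust[OF f1] by auto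
  let ?f2 = "invf k \<circ> ?f1"
  have f2: "gam 2 ?f2" using k(2) by (simp add: numeral_2_eq_2)
  have f2H: "?f2 \<in> H" by (intro H.G_comp[OF _ f1H] H.G_inv subsetD[OF sub] k)
  have "lv 2 ?f2 \<in> G.L 2" using H.L_I[OF f2H f2] LG LH by simp
  then obtain l where l: "l \<in> G" "gam (Suc 2) (invf l \<circ> ?f2)" using G.sym_adjust[OF f2] by auto
  have f3: "invf l \<circ> ?f2 \<in> G" using G.gam3_subset_G l(2) by (simp add: numeral_3_eq_3 numeral_2_eq_2)
  have "g \<circ> (k \<circ> (l \<circ> (invf l \<circ> ?f2))) \<in> G" by (rule G.G_comp[OF g(1) G.G_comp[OF k(1) G.G_comp[OF l(1) f3]]])
  moreover have "g \<circ> (k \<circ> (l \<circ> (invf l \<circ> ?f2))) = h"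
    using isom_inv_apply(2)[OF G.G_isom[OF g(1)]] isom_inv_apply(2)[OF G.G_isom[OF k(1)]]
      isom_inv_apply(2)[OF G.G_isom[OF l(1)]] by (simp add: fun_eq_iff)
  ultimately show "h \<in> G" by simp
qed

theorem frame_groups_conjugate:
  assumes G: "frame_group scale form D E G" and H: "frame_group scale form D E H"
    and nG: "\<not> (\<forall>f. gam 2 f \<longrightarrow> f \<in> G)" and nH: "\<not> (\<forall>f. gam 2 f \<longrightarrow> f \<in> H)"
    and exG: "\<And>h. h \<in> G \<Longrightarrow> \<exists>\<sigma>. \<sigma> permutes {1..D} \<and> lifts h \<sigma>"
    and exH: "\<And>h. h \<in> H \<Longrightarrow> \<exists>\<sigma>. \<sigma> permutes {1..D} \<and> lifts h \<sigma>"
  shows "\<exists>\<gamma>. gam 1 \<gamma> \<and> G = (\<lambda>h. \<gamma> \<circ> h \<circ> invf \<gamma>) ` H"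
proof -
  interpret G: frame_group scale form D E G by (fact G)
  interpret H: frame_group scale form D E H by (fact H)
  note LG = G.L_eq_alt[OF nG] and LH = H.L_eq_alt[OF nH]
  interpret P1: group_pair scale form D E G H 1
  proof unfold_locales
    fix g assume g: "g \<in> G"
    obtain \<sigma> where \<sigma>: "\<sigma> permutes {1..D}" "lifts g \<sigma>" using exG[OF g] by blast
    obtain h where h: "h \<in> H" "lifts h \<sigma>" using H.G_lift[OF \<sigma>(1)] by blast
    show "\<exists>h\<in>H. gam 1 (h \<circ> invf g)"
      using lifts_agree(2)[OF G.G_isom[OF g] H.G_isom[OF h(1)] \<sigma>(2) h(2)] h(1) by blast
  qed (use LG(1) LH(1) in \<open>auto simp: alt_form_def\<close>)
  \<comment> \<open>For \<open>n = 1\<close> the defect vanishes on elements of level 1, because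
    their own level forms are alternating.\<close>
  obtain \<gamma> where \<gamma>: "gam 1 \<gamma>" and ag1: "\<And>g. g \<in> G \<Longrightarrow> \<exists>h\<in>H. gam 1 (\<gamma> \<circ> h \<circ> invf \<gamma> \<circ> invf g) \<and>
      alt_form (lv 1 (\<gamma> \<circ> h \<circ> invf \<gamma> \<circ> invf g))"
    using P1.conjugate_agree[OF P1.defect_gam exG] by blast
  define H1 where "H1 = (\<lambda>h. \<gamma> \<circ> h \<circ> invf \<gamma>) ` H"
  have fH1: "frame_group scale form D E H1" unfolding H1_def by (rule H.frame_group_conjugate[OF \<gamma>])
  have nH1: "\<not> (\<forall>f. gam 2 f \<longrightarrow> f \<in> H1)" unfolding H1_def by (rule H.not_gam2_conjugate[OF \<gamma> nH])
  have exH1: "\<exists>\<sigma>. \<sigma> permutes {1..D} \<and> lifts h \<sigma>" if "h \<in> H1" for h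
    using exact_conjugate[OF \<gamma> H.G_isom exH] that unfolding H1_def by blast
  interpret H1: frame_group scale form D E H1 by (fact fH1)
  note LH1 = H1.L_eq_alt[OF nH1]
  \<comment> \<open>An alternating discrepancy at level 1 is absorbed by an element of
    \<open>H1\<close>, which gives agreement modulo 4. For \<open>n = 2\<close>, elements of level 1
    need \<open>defect_zero\<close>.\<close>
  interpret P2: group_pair scale form D E G H1 2
  proof unfold_locales
    fix g assume g: "g \<in> G"
    obtain h where h: "h \<in> H1" "gam 1 (h \<circ> invf g)" "alt_form (lv 1 (h \<circ> invf g))"
      using ag1[OF g] unfolding H1_def by blast
    obtain k where k: "k \<in> H1" "gam (Suc 1) (invf k \<circ> (h \<circ> invf g))"
      using H1.sym_adjust[OF h(2)] h(3) LH1(1) by auto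
    have "gam 2 (invf k \<circ> h \<circ> invf g)" using k(2) by (simp add: numeral_2_eq_2 o_assoc)
    then show "\<exists>h\<in>H1. gam 2 (h \<circ> invf g)" using H1.G_comp[OF H1.G_inv[OF k(1)] h(1)] by blast
  qed (use LG(2) LH1(2) in \<open>auto simp: alt_form_def\<close>)
  obtain \<delta> where \<delta>: "gam 2 \<delta>" and ag2: "\<And>g. g \<in> G \<Longrightarrow> \<exists>h\<in>H1. gam 2 (\<delta> \<circ> h \<circ> invf \<delta> \<circ> invf g) \<and>
      alt_form (lv 2 (\<delta> \<circ> h \<circ> invf \<delta> \<circ> invf g))"
    using P2.conjugate_agree[OF P2.defect_zero[OF refl LG(1)] exG] by blast
  have \<delta>1: "gam 1 \<delta>" by (rule gam_antimono[OF \<delta>]) simp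
  define H2 where "H2 = (\<lambda>h. \<delta> \<circ> h \<circ> invf \<delta>) ` H1"
  have fH2: "frame_group scale form D E H2" unfolding H2_def by (rule H1.frame_group_conjugate[OF \<delta>1])
  have nH2: "\<not> (\<forall>f. gam 2 f \<longrightarrow> f \<in> H2)" unfolding H2_def by (rule H1.not_gam2_conjugate[OF \<delta>1 nH1])
  have exH2: "\<exists>\<sigma>. \<sigma> permutes {1..D} \<and> lifts h \<sigma>" if "h \<in> H2" for h
    using exact_conjugate[OF \<delta>1 H1.G_isom exH1] that unfolding H2_def by blast
  interpret H2: frame_group scale form D E H2 by (fact fH2)
  note LH2 = H2.L_eq_alt[OF nH2]
  \<comment> \<open>The discrepancies at level 2 are alternating too, hence absorbed, and the rest
    has level 3.\<close>
  have "G \<subseteq> H2"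
  proof
    fix g assume g: "g \<in> G"
    obtain h where h: "h \<in> H2" "gam 2 (h \<circ> invf g)" "alt_form (lv 2 (h \<circ> invf g))"
      using ag2[OF g] unfolding H2_def by blast
    obtain k where k: "k \<in> H2" "gam (Suc 2) (invf k \<circ> (h \<circ> invf g))"
      using H2.sym_adjust[OF h(2)] h(3) LH2(2) by auto
    let ?f = "invf k \<circ> (h \<circ> invf g)"
    have f: "?f \<in> H2" using H2.gam3_subset_G k(2) by (simp add: numeral_3_eq_3 numeral_2_eq_2)
    have "invf ?f \<circ> (invf k \<circ> h) \<in> H2"
      by (rule H2.G_comp[OF H2.G_inv[OF f] H2.G_comp[OF H2.G_inv[OF k(1)] h(1)]])
    moreover have "invf ?f \<circ> (invf k \<circ> h) = g"
      using isom_inv_apply[OF G.G_isom[OF g]] isom_inv_apply[OF H2.G_isom[OF k(1)]]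
        isom_inv_apply[OF H2.G_isom[OF h(1)]] G.G_isom[OF g] H2.G_isom[OF k(1)] H2.G_isom[OF h(1)]
      by (simp add: isom_inv_comp isom_comp isom_inv fun_eq_iff inv_inv_eq isom_bij)
    ultimately show "g \<in> H2" by simp
  qed
  with frame_group_subset_eq[OF G fH2 nG nH2 exH2 this] have "G = H2" by blast
  also have "H2 = (\<lambda>h. (\<delta> \<circ> \<gamma>) \<circ> h \<circ> invf (\<delta> \<circ> \<gamma>)) ` H"
    using gam_isom[OF \<gamma>] gam_isom[OF \<delta>]
    by (simp add: H2_def H1_def image_image isom_inv_comp o_assoc)
  finally show ?thesis using gam_comp(1)[OF \<delta>1 \<gamma>] by blast
qed

end

section \<open>Symplectic lattices\<close>

lemma (in two_adic_module) multiples_power: "x \<in> multiples scale (2 ^ n) \<longleftrightarrow> (\<exists>z. x = scale (2 ^ n) z)"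
  by (auto simp: multiples_def)

lemma (in two_adic_module) coset_power_eq_iff:
  "x +o multiples scale (2 ^ n) = y +o multiples scale (2 ^ n) \<longleftrightarrow> (\<exists>z. x = y + scale (2 ^ n) z)"
  unfolding multiples_coset_eq_iff multiples_power by (metis add_diff_cancel_left' add_diff_eq diff_add_cancel add.commute)

lemma elt_set_plus_image: "a +o B = (\<lambda>b. a + b) ` B"
  by (auto simp: elt_set_plus_def)

section \<open>The standard representation on the classes \<open>vbar d I\<close>\<close>

lemma perm_act_add: "perm_act d \<sigma> (u + w) = perm_act d \<sigma> u + perm_act d \<sigma> w"
  by (simp add: perm_act_def lookup_add single_add sum.distrib)

lemma perm_act_sum_e_basis:
  assumes "\<sigma> permutes {1..d}" "I \<subseteq> {1..d}"
  shows "perm_act d \<sigma> (\<Sum>i\<in>I. e_basis i) = (\<Sum>i\<in>\<sigma> ` I. e_basis i)"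
proof -
  have fin: "finite I" using assms(2) finite_subset by blast
  have "perm_act d \<sigma> (\<Sum>i\<in>I. e_basis i) = (\<Sum>i\<in>{1..d}. if i \<in> I then e_basis (\<sigma> i) else 0)"
    unfolding perm_act_def by (rule sum.cong) (auto simp: lookup_sum_e_basis[OF fin])
  also have "\<dots> = (\<Sum>i\<in>I. e_basis (\<sigma> i))"
    using assms(2) by (simp flip: sum.inter_restrict add: Int_absorb1)
  also have "\<dots> = (\<Sum>i\<in>\<sigma> ` I. e_basis i)"
    using permutes_inj_on[OF assms(1)] by (simp add: sum.reindex)
  finally show ?thesis .
qed

lemma perm_act_radical:
  assumes "\<sigma> permutes {1..d}" shows "perm_act d \<sigma> ` W0_radical d = W0_radical d"
proof -
  have "perm_act d \<sigma> 0 = 0" by (simp add: perm_act_def)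
  moreover have "perm_act d \<sigma> (\<Sum>i\<in>{1..d}. e_basis i) = (\<Sum>i\<in>{1..d}. e_basis i)"
    using perm_act_sum_e_basis[OF assms order_refl] permutes_image[OF assms] by simp
  ultimately show ?thesis by (simp add: W0_radical_def)
qed

lemma Vbar_eq_vbar: "Vbar d = vbar d ` {I. I \<subseteq> {1..d} \<and> even (card I)}"
proof -
  have sum_card: "(\<Sum>i\<in>{1..d}. if i \<in> I then 1 else 0 :: bit) = of_nat (card I)" if "I \<subseteq> {1..d}" for I
    using that by (simp flip: sum.inter_restrict add: Int_absorb1)
  have "W0_space d = (\<lambda>I. \<Sum>i\<in>I. e_basis i) ` {I. I \<subseteq> {1..d} \<and> even (card I)}"
  proof (intro Set.set_eqI iffI)
    fix w assume "w \<in> W0_space d"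
    then have w: "Poly_Mapping.keys w \<subseteq> {1..d}" "(\<Sum>i = 1..d. Poly_Mapping.lookup w i) = 0"
      by (auto simp: W0_space_def W_space_def)
    let ?I = "Poly_Mapping.keys w"
    have lk: "Poly_Mapping.lookup w k = (if k \<in> ?I then 1 else 0)" for k by (simp add: in_keys_iff)
    have "w = (\<Sum>i\<in>?I. e_basis i)"
      by (rule poly_mapping_eqI) (simp only: lookup_sum_e_basis[OF finite_keys] lk)
    moreover have "even (card ?I)"
      using w(2) sum_card[OF w(1)] unfolding lk by (simp add: of_nat_bit split: if_splits)
    ultimately show "w \<in> (\<lambda>I. \<Sum>i\<in>I. e_basis i) ` {I. I \<subseteq> {1..d} \<and> even (card I)}" using w(1) by blast
  next
    fix w assume "w \<in> (\<lambda>I. \<Sum>i\<in>I. e_basis i) ` {I. I \<subseteq> {1..d} \<and> even (card I)}"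
    then obtain I where I: "I \<subseteq> {1..d}" "even (card I)" "w = (\<Sum>i\<in>I. e_basis i)" by blast
    have fin: "finite I" using I(1) finite_subset by blast
    have lk: "Poly_Mapping.lookup w k = (if k \<in> I then 1 else 0)" for k
      by (simp add: I(3) lookup_sum_e_basis[OF fin])
    have "Poly_Mapping.keys w \<subseteq> {1..d}" using I(1) lk by (auto simp: in_keys_iff split: if_splits)
    moreover have "(\<Sum>i = 1..d. Poly_Mapping.lookup w i) = 0"
      unfolding lk using sum_card[OF I(1)] I(2) by (simp add: of_nat_bit)
    ultimately show "w \<in> W0_space d" by (simp add: W0_space_def W_space_def)
  qed
  then show ?thesis unfolding Vbar_def by (simp add: image_image vbar_def)
qed

lemma std_rep_vbar:
  assumes \<sigma>: "\<sigma> permutes {1..d}" and I: "I \<subseteq> {1..d}" "even (card I)"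
  shows "std_rep d \<sigma> (vbar d I) = vbar d (\<sigma> ` I)"
proof -
  have "vbar d I \<in> Vbar d" using I by (auto simp: Vbar_eq_vbar)
  then have "std_rep d \<sigma> (vbar d I) = perm_act d \<sigma> ` vbar d I" by (simp add: std_rep_def)
  also have "\<dots> = perm_act d \<sigma> (\<Sum>i\<in>I. e_basis i) +o perm_act d \<sigma> ` W0_radical d"
    by (simp add: vbar_def elt_set_plus_image image_image perm_act_add)
  also have "\<dots> = vbar d (\<sigma> ` I)"
    by (simp add: perm_act_radical[OF \<sigma>] perm_act_sum_e_basis[OF \<sigma> I(1)] vbar_def)
  finally show ?thesis .
qed

locale large_symplectic_lattice = symplectic_lattice +
  assumes d_ge: "d \<ge> 5"
begin

abbreviation D :: nat where "D \<equiv> 2 * genus d + 1"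

abbreviation cls :: "'a \<Rightarrow> 'a set" where "cls x \<equiv> x +o multiples scale 2"

text \<open>The complement of a point in \<open>{1..D}\<close> has even size, unlike the point
  itself, and two such complements meet in \<open>D - 2\<close> points, an odd number.\<close>

definition E :: "nat \<Rightarrow> 'a" where
  "E i = (SOME x. ident (cls x) = vbar d ({1..D} - {i}))"

lemma D_cases: "odd d \<Longrightarrow> D = d" "even d \<Longrightarrow> d = Suc D"
  using d_ge by (auto simp: genus_def elim!: oddE evenE)

lemma D_le: "{1..D} \<subseteq> {1..d}" "D \<ge> 5"
  using d_ge by (auto simp: genus_def)

lemma cls_eq_iff: "cls x = cls y \<longleftrightarrow> (\<exists>z. x = y + scale 2 z)"
  using coset_power_eq_iff[of x 1 y] by simp

lemma cls_mem: "cls x \<in> quot_mod scale 2"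
  by (simp add: quot_mod_def)

lemma ident_eq_iff: "ident (cls x) = ident (cls y) \<longleftrightarrow> cls x = cls y"
  by (rule inj_on_eq_iff[OF bij_betw_imp_inj_on[OF ident_bij] cls_mem cls_mem])

lemma ident_surj:
  assumes "A \<in> Vbar d" shows "\<exists>x. ident (cls x) = A"
proof -
  have "A \<in> ident ` quot_mod scale 2" using assms by (simp only: bij_betw_imp_surj_on[OF ident_bij])
  then obtain q where q: "q \<in> quot_mod scale 2" "A = ident q" by (elim imageE)
  then obtain x where "q = cls x" unfolding quot_mod_def by (elim imageE)
  with q(2) show ?thesis by (intro exI[of _ x]) simp
qed

lemma ident_E:
  assumes "i \<in> {1..D}" shows "ident (cls (E i)) = vbar d ({1..D} - {i})"
proof -
  have "{1..D} - {i} \<subseteq> {1..d}" using D_le(1) by blast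
  moreover have "even (card ({1..D} - {i}))" using assms by simp
  ultimately have "vbar d ({1..D} - {i}) \<in> Vbar d" unfolding Vbar_eq_vbar by blast
  then show ?thesis unfolding E_def by (rule someI_ex[OF ident_surj])
qed

text \<open>For even \<open>d\<close> a set and its complement have the same class, and one of the
  two avoids \<open>d\<close>.\<close>

lemma ident_representation: "\<exists>I. I \<subseteq> {1..D} \<and> even (card I) \<and> ident (cls x) = vbar d I"
proof -
  have "ident (cls x) \<in> Vbar d" using ident_bij cls_mem by (meson bij_betwE)
  then obtain I where I: "I \<subseteq> {1..d}" "even (card I)" "ident (cls x) = vbar d I"
    by (auto simp: Vbar_eq_vbar)
  show ?thesis
  proof (cases "even d \<and> d \<in> I")
    case True
    have "{1..d} - I \<subseteq> {1..D}"
    proof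
      fix x assume "x \<in> {1..d} - I"
      then have "x \<noteq> d" "1 \<le> x" "x \<le> d" using True by auto
      moreover have "d = Suc D" using D_cases(2) True by blast
      ultimately show "x \<in> {1..D}" unfolding atLeastAtMost_iff by linarith
    qed
    moreover have "even (card ({1..d} - I))"
      using True I finite_subset[OF I(1)] card_mono[OF _ I(1)] by (simp add: card_Diff_subset)
    moreover have "vbar d ({1..d} - I) = vbar d I"
      using True I(1) by (subst vbar_eq_iff) auto
    ultimately show ?thesis using I(3) by metis
  next
    case False
    have "I \<subseteq> {1..D}"
    proof
      fix x assume x: "x \<in> I"
      then have "1 \<le> x" "x \<le> d" "odd d \<or> x \<noteq> d" using I(1) False by auto
      moreover have "odd d \<Longrightarrow> D = d" "even d \<Longrightarrow> d = Suc D" using D_cases by blast+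
      ultimately show "x \<in> {1..D}" unfolding atLeastAtMost_iff by linarith
    qed
    then show ?thesis using I by blast
  qed
qed

lemma residue_form:
  assumes "I \<subseteq> {1..d}" "even (card I)" "J \<subseteq> {1..d}" "even (card J)"
    and "ident (cls x) = vbar d I" "ident (cls y) = vbar d J"
  shows "residue_bit (form x y) = of_nat (card (I \<inter> J))"
  using ident_form[of x y] Vbar_form_vbar[OF assms(1-4)] assms(5,6) by simp

lemma residue_form_E:
  assumes "I \<subseteq> {1..d}" "even (card I)" "ident (cls x) = vbar d I" "i \<in> {1..D}"
  shows "residue_bit (form x (E i)) = of_nat (card (I \<inter> ({1..D} - {i})))"
  using assms D_le by (intro residue_form[OF assms(1,2) _ _ assms(3) ident_E]) auto

lemma residue_form_E':
  assumes I: "I \<subseteq> {1..D}" "even (card I)" "ident (cls x) = vbar d I" and i: "i \<in> {1..D}"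
  shows "residue_bit (form x (E i)) = (if i \<in> I then 1 else 0)"
proof -
  have fin: "finite I" using I(1) finite_subset by blast
  have "I \<inter> ({1..D} - {i}) = I - {i}" using I(1) by blast
  then have "residue_bit (form x (E i)) = of_nat (card (I - {i}))"
    using residue_form_E[OF order_trans[OF I(1) D_le(1)] I(2,3) i] by simp
  also have "\<dots> = (if i \<in> I then 1 else 0)"
  proof (cases "i \<in> I")
    case True
    then have "card I = Suc (card (I - {i}))" using fin by (rule card.remove[rotated])
    then show ?thesis using True I(2) by (simp add: of_nat_bit)
  qed (use I(2) in \<open>simp add: of_nat_bit\<close>)
  finally show ?thesis .
qed

lemma torsion_free:
  assumes "scale 2 x = 0" shows "x = 0"
proof -
  obtain B where B: "finite B" "independent B" "span B = UNIV" using free_of_rank_2g by blast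
  then obtain u where u: "x = (\<Sum>v\<in>B. scale (u v) v)" using span_finite[OF B(1)] by auto
  have "(\<Sum>v\<in>B. scale (2 * u v) v) = 0"
    using assms unfolding u by (simp add: scale_sum_right)
  then have "2 * u v = 0" if "v \<in> B" for v
    using independentD[OF B(2,1) order_refl, of "\<lambda>v. 2 * u v" v] that by simp
  then have "u v = 0" if "v \<in> B" for v using that two_adic_double_eq_0 by blast
  then show ?thesis unfolding u by (intro sum.neutral) simp
qed

sublocale F: odd_frame scale form D E
proof (intro odd_frame.intro odd_frame_axioms.intro)
  fix x assume z: "\<And>i. i \<in> {1..D} \<Longrightarrow> residue_bit (form x (E i)) = 0"
  \<comment> \<open>Pairing with \<open>E i\<close> tests membership of \<open>i\<close>, so only
    the empty set can represent such a vector.\<close>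
  have e: "ident (cls y) = vbar d {}" if "\<And>i. i \<in> {1..D} \<Longrightarrow> residue_bit (form y (E i)) = 0" for y
  proof -
    obtain I where I: "I \<subseteq> {1..D}" "even (card I)" "ident (cls y) = vbar d I"
      using ident_representation by blast
    have "i \<notin> I" if "i \<in> {1..D}" for i
      using residue_form_E'[OF I that] \<open>\<And>i. i \<in> {1..D} \<Longrightarrow> residue_bit (form y (E i)) = 0\<close>[OF that] by auto
    then have "I = {}" using I(1) by blast
    then show ?thesis using I(3) by simp
  qed
  have "form 0 y = 0" for y using module_hom.zero[OF form_linear_left] by simp
  then have "ident (cls x) = ident (cls 0)" using e[of x] e[of 0] z by simp
  then show "\<exists>z. x = scale 2 z" unfolding ident_eq_iff cls_eq_iff by simp
next
  fix i j assume ij: "i \<in> {1..D}" "j \<in> {1..D}"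
  have c: "{1..D} - {i} \<subseteq> {1..D}" "even (card ({1..D} - {i}))" using ij by auto
  show "residue_bit (form (E i) (E j)) = (if i = j then 0 else 1)"
    using residue_form_E'[OF c ident_E[OF ij(1)] ij(2)] ij by auto
qed (fact two_adic_module_axioms form_linear_left form_linear_right form_alternating torsion_free D_le(2) | simp)+

section \<open>Symplectic groups and reduction maps in terms of isometries\<close>

lemma carrier_Sp: "carrier (Sp scale form) = {f. F.isom f}"
  by (auto simp: Sp_def F.isom_def Bij_def bij_def bij_betw_def)

lemma mult_Sp: "F.isom f \<Longrightarrow> F.isom g \<Longrightarrow> f \<otimes>\<^bsub>Sp scale form\<^esub> g = f \<circ> g"
  by (simp add: Sp_def BijGroup_def Bij_def F.isom_def bij_def bij_betw_def compose_def fun_eq_iff)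

lemma one_Sp: "\<one>\<^bsub>Sp scale form\<^esub> = id"
  by (simp add: Sp_def BijGroup_def fun_eq_iff)

lemma inv_Sp:
  assumes f: "F.isom f" shows "inv\<^bsub>Sp scale form\<^esub> f = invf f"
  unfolding m_inv_def
proof (rule the_equality)
  note i = F.isom_inv[OF f]
  show "invf f \<in> carrier (Sp scale form) \<and> f \<otimes>\<^bsub>Sp scale form\<^esub> invf f = \<one>\<^bsub>Sp scale form\<^esub> \<and>
      invf f \<otimes>\<^bsub>Sp scale form\<^esub> f = \<one>\<^bsub>Sp scale form\<^esub>"
    using f i by (simp add: carrier_Sp mult_Sp one_Sp fun_eq_iff F.isom_inv_apply)
  fix y assume y: "y \<in> carrier (Sp scale form) \<and> f \<otimes>\<^bsub>Sp scale form\<^esub> y = \<one>\<^bsub>Sp scale form\<^esub> \<and>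
      y \<otimes>\<^bsub>Sp scale form\<^esub> f = \<one>\<^bsub>Sp scale form\<^esub>"
  then have "f (y x) = x" for x
    using f by (auto simp: carrier_Sp mult_Sp one_Sp fun_eq_iff)
  then show "y = invf f" by (metis F.isom_inv_apply(1)[OF f] ext)
qed

lemma image_coset:
  assumes f: "F.isom f" shows "f ` (x +o multiples scale m) = f x +o multiples scale m"
proof (intro Set.set_eqI iffI)
  fix y assume "y \<in> f ` (x +o multiples scale m)"
  then show "y \<in> f x +o multiples scale m"
    by (auto simp: elt_set_plus_def multiples_def F.isom_add[OF f] F.isom_scale[OF f])
next
  fix y assume "y \<in> f x +o multiples scale m"
  then obtain z where z: "y = f x + scale (of_nat m) z" by (auto simp: elt_set_plus_def multiples_def)
  then have "y = f (x + scale (of_nat m) (invf f z))"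
    by (simp add: F.isom_add[OF f] F.isom_scale[OF f] F.isom_inv_apply[OF f])
  then show "y \<in> f ` (x +o multiples scale m)" by (auto simp: elt_set_plus_def multiples_def)
qed

lemma reduction_coset:
  "F.isom f \<Longrightarrow> reduction scale m f (x +o multiples scale m) = f x +o multiples scale m"
  by (simp add: reduction_def quot_mod_def image_coset)

lemma reduction_eq_iff_coset:
  "F.isom f \<Longrightarrow> F.isom g \<Longrightarrow> reduction scale m f = reduction scale m g \<longleftrightarrow>
    (\<forall>x. f x +o multiples scale m = g x +o multiples scale m)"
proof
  assume "F.isom f" "F.isom g" "reduction scale m f = reduction scale m g"
  then show "\<forall>x. f x +o multiples scale m = g x +o multiples scale m"
    by (metis reduction_coset)
next
  assume f: "F.isom f" "F.isom g" and eq: "\<forall>x. f x +o multiples scale m = g x +o multiples scale m"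
  show "reduction scale m f = reduction scale m g"
    unfolding reduction_def
  proof (rule restrict_ext)
    fix A assume "A \<in> quot_mod scale m"
    then obtain x where "A = x +o multiples scale m" by (auto simp: quot_mod_def)
    then show "f ` A = g ` A" using image_coset[OF f(1)] image_coset[OF f(2)] eq by simp
  qed
qed

lemma reduction_eq_iff:
  assumes f: "F.isom f" and g: "F.isom g"
  shows "reduction scale (2 ^ n) f = reduction scale (2 ^ n) g \<longleftrightarrow> F.gam n (invf g \<circ> f)"
proof -
  note i = F.isom_inv[OF g]
  have "(\<exists>z. f x = g x + scale (2 ^ n) z) \<longleftrightarrow> (\<exists>z. (invf g \<circ> f) x = x + scale (2 ^ n) z)" for x
  proof
    assume "\<exists>z. f x = g x + scale (2 ^ n) z"
    then show "\<exists>z. (invf g \<circ> f) x = x + scale (2 ^ n) z"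
      by (auto simp: F.isom_add[OF i] F.isom_scale[OF i] F.isom_inv_apply[OF g])
  next
    assume "\<exists>z. (invf g \<circ> f) x = x + scale (2 ^ n) z"
    then obtain z where "invf g (f x) = x + scale (2 ^ n) z" by auto
    then have "g (invf g (f x)) = g (x + scale (2 ^ n) z)" by simp
    then show "\<exists>z. f x = g x + scale (2 ^ n) z"
      by (auto simp: F.isom_add[OF g] F.isom_scale[OF g] F.isom_inv_apply[OF g])
  qed
  then show ?thesis
    unfolding reduction_eq_iff_coset[OF f g] coset_power_eq_iff F.gam_def
    using F.isom_comp[OF i f] by simp
qed

lemma cong_subgroup_eq: "cong_subgroup scale form (2 ^ n) = {f. F.gam n f}"
proof -
  have "\<one>\<^bsub>Sp_quot scale form (2 ^ n)\<^esub> = reduction scale (2 ^ n) id"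
    by (simp add: Sp_quot_def BijGroup_def reduction_def)
  then have "cong_subgroup scale form (2 ^ n) =
      {f. F.isom f \<and> reduction scale (2 ^ n) f = reduction scale (2 ^ n) id}"
    by (simp add: cong_subgroup_def kernel_def carrier_Sp)
  then show ?thesis
    using reduction_eq_iff[OF _ F.isom_id, of _ n] F.gam_isom by (auto simp: inv_id)
qed

abbreviation perm_map :: "(nat \<Rightarrow> nat) \<Rightarrow> 'a set \<Rightarrow> 'a set" where
  "perm_map \<sigma> \<equiv>
    \<lambda>A\<in>quot_mod scale 2. inv_into (quot_mod scale 2) ident (std_rep d \<sigma> (ident A))"

lemma reduction_vbar:
  assumes g: "F.isom g" and \<sigma>: "\<sigma> permutes {1..d}"
    and red: "reduction scale 2 g = perm_map \<sigma>"
    and x: "ident (cls x) = vbar d I" "I \<subseteq> {1..d}" "even (card I)"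
  shows "ident (cls (g x)) = vbar d (\<sigma> ` I)"
proof -
  have c: "card (\<sigma> ` I) = card I" using permutes_inj_on[OF \<sigma>] by (simp add: card_image)
  have "\<sigma> ` I \<subseteq> {1..d}" using x(2) permutes_image[OF \<sigma>] by blast
  then have m: "vbar d (\<sigma> ` I) \<in> Vbar d" using c x(3) by (auto simp: Vbar_eq_vbar)
  have "cls (g x) = reduction scale 2 g (cls x)" by (simp add: reduction_coset[OF g])
  also have "\<dots> = inv_into (quot_mod scale 2) ident (vbar d (\<sigma> ` I))"
    by (simp add: red cls_mem x std_rep_vbar[OF \<sigma> x(2,3)])
  finally show ?thesis
    using m ident_bij by (simp add: bij_betw_inv_into_right)
qed

lemma pr_eq_if_cls_eq: "cls x = cls y \<Longrightarrow> F.pr x z = F.pr y z"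
  unfolding cls_eq_iff by auto

lemma reduction_lifts:
  assumes g: "F.isom g" and \<sigma>: "\<sigma> permutes {1..D}"
    and red: "reduction scale 2 g = perm_map \<sigma>"
  shows "F.lifts g \<sigma>"
  unfolding F.lifts_def
proof (intro ballI allI)
  fix i y assume i: "i \<in> {1..D}"
  have \<sigma>': "\<sigma> permutes {1..d}" by (rule permutes_subset[OF \<sigma> D_le(1)])
  have si: "\<sigma> i \<in> {1..D}" using permutes_in_image[OF \<sigma>, of i] i by blast
  have "\<sigma> ` ({1..D} - {i}) = {1..D} - {\<sigma> i}"
    using permutes_image[OF \<sigma>] permutes_inj[OF \<sigma>] by (simp add: image_set_diff)
  moreover have "{1..D} - {i} \<subseteq> {1..d}" "even (card ({1..D} - {i}))" using i D_le(1) by auto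
  ultimately have "ident (cls (g (E i))) = ident (cls (E (\<sigma> i)))"
    using reduction_vbar[OF g \<sigma>' red ident_E[OF i]] ident_E[OF si] by simp
  then show "F.pr (g (E i)) y = F.pr (E (\<sigma> i)) y"
    unfolding ident_eq_iff by (rule pr_eq_if_cls_eq)
qed

text \<open>For \<open>i\<close> other than \<open>D\<close>, exchanging \<open>D\<close> and
  \<open>d\<close> turns \<open>{1..D} - {i}\<close> into the complement of \<open>{i, D}\<close>,
  which has the class of \<open>E i + E D\<close>. So this transposition is the transvection along
  the single vector \<open>E D\<close>.\<close>

lemma reduction_last_transposition:
  assumes ev: "even d" and g: "F.isom g"
    and red: "reduction scale 2 g = perm_map (Transposition.transpose D d)"
  shows "F.sim g (F.tv 1 (E D))"
proof (rule F.simI[OF g F.isom_tv])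
  fix i y assume i: "i \<in> {1..D}"
  let ?\<tau> = "Transposition.transpose D d"
  have dD: "d = Suc D" using D_cases(2)[OF ev] .
  have \<tau>: "?\<tau> permutes {1..d}" by (rule permutes_swap_id) (use dD in auto)
  let ?I = "{1..D} - {i}"
  have I: "?I \<subseteq> {1..d}" "even (card ?I)" using i D_le(1) by auto
  have c: "card (?\<tau> ` ?I) = card ?I" using permutes_inj_on[OF \<tau>] by (simp add: card_image)
  have v: "ident (cls (g (E i))) = vbar d (?\<tau> ` ?I)"
    by (rule reduction_vbar[OF g \<tau> red ident_E[OF i] I])
  have DD: "D \<in> {1..D}" by simp
  have k: "F.pr (g (E i)) (E k) = F.pr (F.tv 1 (E D) (E i)) (E k)" if k: "k \<in> {1..D}" for k
  proof -
    have s: "?\<tau> ` ?I \<subseteq> {1..d}" using permutes_image[OF \<tau>] I(1) by blast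
    have l: "F.pr (g (E i)) (E k) = of_nat (card (?\<tau> ` ?I \<inter> ({1..D} - {k})))"
      unfolding F.pr_def by (rule residue_form_E[OF s _ v k]) (use c I(2) in simp)
    have "?\<tau> ` ?I \<inter> ({1..D} - {k}) = {1..D} - {i, D, k}"
      using dD i k by (auto simp: transpose_def image_iff split: if_splits)
    moreover have "card ({1..D} - {i, D, k}) = D - card {i, D, k}"
      using i k by (subst card_Diff_subset) auto
    ultimately have l': "F.pr (g (E i)) (E k) = of_nat (D - card {i, D, k})" using l by simp
    have r: "F.pr (F.tv 1 (E D) (E i)) (E k) = F.pr (E i) (E k) + F.pr (E i) (E D) * F.pr (E D) (E k)"
      by (simp add: F.pr_tv)
    show ?thesis
    proof (cases "i = D")
      case True
      then show ?thesis
        unfolding l' r F.pr_E[OF i k] F.pr_E[OF i DD] F.pr_E[OF DD k] using D_le(2)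
        by (cases "k = D") (simp_all add: of_nat_bit card_insert_if del: of_nat_mult of_nat_add of_nat_numeral)
    next
      case False
      then show ?thesis
        unfolding l' r F.pr_E[OF i k] F.pr_E[OF i DD] F.pr_E[OF DD k] using D_le(2)
        by (cases "k = D"; cases "k = i") (auto simp: of_nat_bit card_insert_if simp del: of_nat_mult of_nat_add of_nat_numeral)
    qed
  qed
  show "F.pr (g (E i)) y = F.pr (F.tv 1 (E D) (E i)) y"
    using F.bit_functional_expand[OF F.pr_functional(1), of "g (E i)" y]
      F.bit_functional_expand[OF F.pr_functional(1), of "F.tv 1 (E D) (E i)" y] k by simp
qed

section \<open>The 2-adic topology\<close>

lemma topspace_Sp: "topspace (Sp_topology scale form) = carrier (Sp scale form)"
proof
  have "openin (Sp_topology scale form) (carrier (Sp scale form))"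
    by (auto simp: openin_Sp_topology)
  then show "carrier (Sp scale form) \<subseteq> topspace (Sp_topology scale form)" by (rule openin_subset)
  show "topspace (Sp_topology scale form) \<subseteq> carrier (Sp scale form)"
    using openin_topspace[of "Sp_topology scale form"] unfolding openin_Sp_topology by blast
qed

lemma closed_approximation:
  assumes cl: "closedin (Sp_topology scale form) G" and f: "F.isom f"
    and ap: "\<And>n. \<exists>g\<in>G. \<forall>x. \<exists>z. f x = g x + scale (2 ^ n) z"
  shows "f \<in> G"
proof (rule ccontr)
  assume nf: "f \<notin> G"
  have "openin (Sp_topology scale form) (carrier (Sp scale form) - G)"
    using cl by (simp add: closedin_def topspace_Sp)
  then obtain n where n: "{h \<in> carrier (Sp scale form). \<forall>x. h x - f x \<in> multiples scale (2 ^ n)}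
      \<subseteq> carrier (Sp scale form) - G"
    using nf f unfolding openin_Sp_topology carrier_Sp by blast
  obtain g where g: "g \<in> G" "\<forall>x. \<exists>z. f x = g x + scale (2 ^ n) z" using ap by blast
  have "g x - f x \<in> multiples scale (2 ^ n)" for x
  proof -
    obtain z where "f x = g x + scale (2 ^ n) z" using g(2) by blast
    then have "g x - f x = scale (2 ^ n) (- z)" by simp
    then show ?thesis unfolding multiples_power by blast
  qed
  moreover have "G \<subseteq> carrier (Sp scale form)" using cl by (simp add: closedin_def topspace_Sp)
  ultimately show False using n g(1) by blast
qed

lemma openin_if_gam_subset:
  assumes G: "G \<subseteq> {f. F.isom f}" "\<And>f g. f \<in> G \<Longrightarrow> g \<in> G \<Longrightarrow> f \<circ> g \<in> G"
    and sub: "\<And>f. F.gam n f \<Longrightarrow> f \<in> G"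
  shows "openin (Sp_topology scale form) G"
  unfolding openin_Sp_topology
proof (intro conjI ballI)
  show "G \<subseteq> carrier (Sp scale form)" using G(1) by (simp add: carrier_Sp)
  fix f assume f: "f \<in> G"
  have "h \<in> G" if h: "F.isom h" "\<forall>x. h x - f x \<in> multiples scale (2 ^ n)" for h
  proof -
    have iso: "F.isom f" using f G(1) by blast
    have "h x +o multiples scale (2 ^ n) = f x +o multiples scale (2 ^ n)" for x
      using h(2) multiples_coset_eq_iff by blast
    then have "reduction scale (2 ^ n) h = reduction scale (2 ^ n) f"
      using reduction_eq_iff_coset[OF h(1) iso] by blast
    then have "invf f \<circ> h \<in> G" using reduction_eq_iff[OF h(1) iso] sub by blast
    then have "f \<circ> (invf f \<circ> h) \<in> G" by (rule G(2)[OF f])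
    moreover have "f \<circ> (invf f \<circ> h) = h" by (simp add: fun_eq_iff F.isom_inv_apply[OF iso])
    ultimately show "h \<in> G" by simp
  qed
  then show "\<exists>n. {h \<in> carrier (Sp scale form). \<forall>x. h x - f x \<in> multiples scale (2 ^ n)} \<subseteq> G"
    by (auto simp: carrier_Sp)
qed

lemma frame_group_if_closed_subgroup:
  assumes sub: "subgroup G (Sp scale form)" and cl: "closedin (Sp_topology scale form) G"
    and perm: "perm_image scale d ident \<subseteq> reduction scale 2 ` G"
  shows "frame_group scale form D E G"
proof unfold_locales
  have GS: "G \<subseteq> {f. F.isom f}" using subgroup.subset[OF sub] by (simp add: carrier_Sp)
  show "F.isom f" if "f \<in> G" for f using that GS by blast
  show "id \<in> G" using subgroup.one_closed[OF sub] by (simp add: one_Sp)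
  show "f \<circ> g \<in> G" if "f \<in> G" "g \<in> G" for f g
  proof -
    have "F.isom f" "F.isom g" using that GS by blast+
    then show ?thesis using subgroup.m_closed[OF sub that] by (simp only: mult_Sp)
  qed
  show "invf f \<in> G" if "f \<in> G" for f
  proof -
    have "F.isom f" using that GS by blast
    then show ?thesis using subgroup.m_inv_closed[OF sub that] by (simp only: inv_Sp)
  qed
  show "\<exists>g\<in>G. F.lifts g \<sigma>" if \<sigma>: "\<sigma> permutes {1..D}" for \<sigma>
  proof -
    let ?F = "perm_map \<sigma>"
    have "\<sigma> permutes {1..d}" by (rule permutes_subset[OF \<sigma> D_le(1)])
    then have "?F \<in> perm_image scale d ident" unfolding perm_image_def by (intro imageI) simp
    then have "?F \<in> reduction scale 2 ` G" using perm by (rule rev_subsetD)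
    then obtain g where g: "?F = reduction scale 2 g" "g \<in> G" by (elim imageE)
    then show ?thesis using reduction_lifts[OF _ \<sigma> g(1)[symmetric]] GS by blast
  qed
qed (use closed_approximation[OF cl] in blast)

text \<open>For odd \<open>d\<close> distinct sets have distinct classes, so the complements of
  points recover the permutation.\<close>

lemma card_perm_image:
  assumes odd: "odd d" shows "card (perm_image scale d ident) = fact d"
proof -
  let ?F = perm_map
  have D: "D = d" by (rule D_cases(1)[OF odd])
  have val: "ident (?F \<sigma> (cls (E i))) = vbar d ({1..d} - {\<sigma> i})"
    if \<sigma>: "\<sigma> permutes {1..d}" and i: "i \<in> {1..d}" for \<sigma> i
  proof -
    have i': "i \<in> {1..D}" using i unfolding D .
    then have I: "{1..D} - {i} \<subseteq> {1..d}" "even (card ({1..D} - {i}))" using D_le(1) by auto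
    have im: "\<sigma> ` ({1..D} - {i}) = {1..d} - {\<sigma> i}"
      using permutes_image[OF \<sigma>] permutes_inj[OF \<sigma>] D by (simp add: image_set_diff)
    have si: "\<sigma> i \<in> {1..d}" using permutes_in_image[OF \<sigma>, of i] i by blast
    have "vbar d ({1..d} - {\<sigma> i}) \<in> Vbar d" using si odd by (auto simp: Vbar_eq_vbar)
    moreover have "std_rep d \<sigma> (vbar d ({1..D} - {i})) = vbar d ({1..d} - {\<sigma> i})"
      by (simp only: std_rep_vbar[OF \<sigma> I] im)
    ultimately show ?thesis
      by (simp only: restrict_apply'[OF cls_mem] ident_E[OF i'] bij_betw_inv_into_right[OF ident_bij])
  qed
  have "inj_on ?F {\<sigma>. \<sigma> permutes {1..d}}"
  proof (rule inj_onI)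
    fix \<sigma> \<rho> assume "\<sigma> \<in> {\<sigma>. \<sigma> permutes {1..d}}" "\<rho> \<in> {\<sigma>. \<sigma> permutes {1..d}}" and eq: "?F \<sigma> = ?F \<rho>"
    then have p: "\<sigma> permutes {1..d}" "\<rho> permutes {1..d}" by auto
    show "\<sigma> = \<rho>"
    proof
      fix i show "\<sigma> i = \<rho> i"
      proof (cases "i \<in> {1..d}")
        case True
        have "vbar d ({1..d} - {\<sigma> i}) = vbar d ({1..d} - {\<rho> i})"
          using val[OF p(1) True] val[OF p(2) True] unfolding eq by metis
        then have "{1..d} - {\<sigma> i} = {1..d} - {\<rho> i}" using odd by (subst (asm) vbar_eq_iff) auto
        moreover have "\<sigma> i \<in> {1..d}" using permutes_in_image[OF p(1), of i] True by blast
        ultimately show ?thesis by blast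
      qed (use p permutes_not_in in metis)
    qed
  qed
  then show ?thesis by (simp add: perm_image_def card_image card_permutations)
qed

end

context large_symplectic_lattice
begin

lemma last_transposition_in_G:
  assumes ev: "even d" and G: "\<And>g. g \<in> G \<Longrightarrow> F.isom g"
    and perm: "perm_image scale d ident \<subseteq> reduction scale 2 ` G"
  shows "\<exists>t\<in>G. F.sim t (F.tv 1 (E D))"
proof -
  let ?\<tau> = "Transposition.transpose D d"
  let ?F = "perm_map ?\<tau>"
  have "D \<in> {1..d}" "d \<in> {1..d}" using D_le d_ge by auto
  then have "?\<tau> permutes {1..d}" by (rule permutes_swap_id)
  then have "?F \<in> perm_image scale d ident" unfolding perm_image_def by (intro imageI) simp
  then have "?F \<in> reduction scale 2 ` G" using perm by (rule rev_subsetD)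
  then obtain t where t: "?F = reduction scale 2 t" "t \<in> G" by (elim imageE)
  then show ?thesis using reduction_last_transposition[OF ev G[OF t(2)] t(1)[symmetric]] by blast
qed

lemma eq_reduction_preimage:
  assumes "frame_group scale form D E G" and sub: "\<And>f. F.gam 1 f \<Longrightarrow> f \<in> G"
  shows "G = reduction_preimage scale form 2 (reduction scale 2 ` G)"
proof -
  interpret G: frame_group scale form D E G by fact
  have "f \<in> G" if f: "F.isom f" "g \<in> G" "reduction scale 2 f = reduction scale 2 g" for f g
  proof -
    note g = G.G_isom[OF f(2)]
    have "invf g \<circ> f \<in> G" using reduction_eq_iff[OF f(1) g, of 1] f(3) by (intro sub) simp
    from G.G_comp[OF f(2) this] show "f \<in> G"
      using F.isom_inv_apply(2)[OF g] by (simp add: o_def)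
  qed
  then show ?thesis unfolding reduction_preimage_def carrier_Sp using G.G_isom by blast
qed

lemma exact_lifts:
  assumes odd: "odd d" and G: "\<And>g. g \<in> G \<Longrightarrow> F.isom g"
    and red: "reduction scale 2 ` G = perm_image scale d ident" and g: "g \<in> G"
  shows "\<exists>\<sigma>. \<sigma> permutes {1..D} \<and> F.lifts g \<sigma>"
proof -
  have "reduction scale 2 g \<in> perm_image scale d ident" using red g by blast
  then obtain \<sigma> where \<sigma>: "\<sigma> permutes {1..d}" "reduction scale 2 g = perm_map \<sigma>"
    unfolding perm_image_def by (elim imageE) simp
  have "\<sigma> permutes {1..D}" using \<sigma>(1) unfolding D_cases(1)[OF odd] .
  then show ?thesis using reduction_lifts[OF G[OF g] _ \<sigma>(2)] by blast
qed

lemma card_reduction_8: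
  assumes odd: "odd d" and fG: "frame_group scale form D E G"
    and red: "reduction scale 2 ` G = perm_image scale d ident"
    and n4: "\<not> cong_subgroup scale form 4 \<subseteq> G"
  shows "card (reduction scale 8 ` G) = fact d * 2 ^ (4 * (genus d)\<^sup>2 - 2 * genus d)"
proof -
  interpret G: frame_group scale form D E G by fact
  have "\<not> (\<forall>f. F.gam 2 f \<longrightarrow> f \<in> G)" using n4 cong_subgroup_eq[of 2] by auto
  note L = G.L_eq_alt[OF this]
  have step: "card (reduction scale (2 ^ Suc n) ` G) = card (reduction scale (2 ^ n) ` G) * card (G.L n)" if "n > 0" for n
    by (rule G.card_step[OF that]) (intro reduction_eq_iff G.G_isom; assumption)+
  let ?g = "genus d"
  have c: "card {\<beta> :: 'a \<Rightarrow> 'a \<Rightarrow> bit. alt_form \<beta>} = 2 ^ (2 * ?g\<^sup>2 - ?g)"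
  proof -
    \<comment> \<open>Here \<open>D - 1\<close> is \<open>2g\<close> and \<open>D - 2\<close> is
      \<open>2g - 1\<close>. Levels 1 and 2 contribute one such factor each.\<close>
    have "(D - 1) * (D - 2) div 2 = ?g * (2 * ?g - 1)" by (simp add: mult.assoc One_nat_def)
    also have "\<dots> = 2 * ?g\<^sup>2 - ?g" by (simp add: power2_eq_square diff_mult_distrib2 mult.left_commute)
    finally show ?thesis unfolding F.card_alt_forms by simp
  qed
  have "card (reduction scale 8 ` G) = card (reduction scale 4 ` G) * card (G.L 2)"
    using step[of 2] by simp
  also have "card (reduction scale 4 ` G) = card (reduction scale 2 ` G) * card (G.L 1)"
    using step[of 1] by simp
  also have "card (reduction scale 2 ` G) = fact d" unfolding red by (rule card_perm_image[OF odd])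
  also have "fact d * card (G.L 1) * card (G.L 2) = fact d * (2 ^ (2 * ?g\<^sup>2 - ?g) * 2 ^ (2 * ?g\<^sup>2 - ?g))"
    unfolding L c by simp
  also have "\<dots> = fact d * 2 ^ (4 * ?g\<^sup>2 - 2 * ?g)"
    by (simp flip: power_add add: mult_2[symmetric] diff_mult_distrib2)
  finally show ?thesis .
qed

lemma conjugate_coset:
  assumes \<gamma>: "F.isom \<gamma>" and G: "\<And>g. g \<in> G \<Longrightarrow> F.isom g"
  shows "(\<gamma> <#\<^bsub>Sp scale form\<^esub> G) #>\<^bsub>Sp scale form\<^esub> inv\<^bsub>Sp scale form\<^esub> \<gamma> = (\<lambda>g. \<gamma> \<circ> g \<circ> invf \<gamma>) ` G"
proof -
  have "\<gamma> <#\<^bsub>Sp scale form\<^esub> G = (\<lambda>g. \<gamma> \<circ> g) ` G"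
    using mult_Sp[OF \<gamma> G] by (auto simp: l_coset_def)
  moreover have "(\<lambda>g. \<gamma> \<circ> g) ` G #>\<^bsub>Sp scale form\<^esub> invf \<gamma> = (\<lambda>g. \<gamma> \<circ> g \<circ> invf \<gamma>) ` G"
    using mult_Sp[OF F.isom_comp[OF \<gamma> G] F.isom_inv[OF \<gamma>]] by (auto simp: r_coset_def)
  ultimately show ?thesis by (simp add: inv_Sp[OF \<gamma>])
qed

end

section \<open>The main theorem\<close>

theorem theorem1p1:
  fixes d :: nat
    and scale :: "two_adic \<Rightarrow> 'v::ab_group_add \<Rightarrow> 'v"
    and form :: "'v \<Rightarrow> 'v \<Rightarrow> two_adic"
    and ident :: "'v set \<Rightarrow> (nat \<Rightarrow>\<^sub>0 bit) set"
    and G :: "('v \<Rightarrow> 'v) set"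
  assumes "d \<ge> 3"
    and "symplectic_lattice scale d form ident"
    and "subgroup G (Sp scale form)"
    and "closedin (Sp_topology scale form) G"
    and "perm_image scale d ident \<subseteq> reduction scale 2 ` G"
  shows
    "(d \<ge> 6 \<and> even d \<longrightarrow>
        G = reduction_preimage scale form 2 (reduction scale 2 ` G) \<and>
        openin (Sp_topology scale form) G \<and>
        cong_subgroup scale form 2 \<subseteq> G) \<and>
     (d \<ge> 5 \<and> odd d \<longrightarrow>
        cong_subgroup scale form 8 \<subseteq> G \<and>
        openin (Sp_topology scale form) G \<and>
        (reduction scale 2 ` G = perm_image scale d ident \<and> \<not> cong_subgroup scale form 4 \<subseteq> G \<longrightarrow>
           card (reduction scale 8 ` G) = fact d * 2 ^ (4 * (genus d)\<^sup>2 - 2 * genus d) \<and>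
           (\<forall>G'. subgroup G' (Sp scale form) \<and>
                 closedin (Sp_topology scale form) G' \<and>
                 reduction scale 2 ` G' = perm_image scale d ident \<and>
                 \<not> cong_subgroup scale form 4 \<subseteq> G' \<longrightarrow>
              (\<exists>h \<in> reduction_preimage scale form 2 (perm_image scale d ident).
                 G' = (h <#\<^bsub>Sp scale form\<^esub> G) #>\<^bsub>Sp scale form\<^esub> inv\<^bsub>Sp scale form\<^esub> h))))"
proof (cases "d \<ge> 5")
  case True
  interpret S: large_symplectic_lattice scale d form ident
    using assms(2) True by (simp add: large_symplectic_lattice_def large_symplectic_lattice_axioms_def)
  have fG: "frame_group scale form S.D S.E G"
    by (rule S.frame_group_if_closed_subgroup[OF assms(3-5)])
  interpret G: frame_group scale form S.D S.E G by (rule fG)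
  have G_sub: "G \<subseteq> {f. S.F.isom f}" using G.G_isom by blast
  show ?thesis
  proof (intro conjI impI)
    assume ev: "d \<ge> 6 \<and> even d"
    obtain t where t: "t \<in> G" "S.F.sim t (S.F.tv 1 (S.E S.D))"
      using S.last_transposition_in_G[OF _ G.G_isom assms(5)] ev by blast
    note gam1 = G.gam1_subset_G_if_extra_transvection[OF t]
    show "G = reduction_preimage scale form 2 (reduction scale 2 ` G)"
      by (rule S.eq_reduction_preimage[OF fG gam1])
    show "openin (Sp_topology scale form) G"
      by (rule S.openin_if_gam_subset[OF G_sub G.G_comp gam1])
    show "cong_subgroup scale form 2 \<subseteq> G"
      using gam1 S.cong_subgroup_eq[of 1] by auto
  next
    assume "d \<ge> 5 \<and> odd d"
    then have odd: "odd d" ..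
    show "cong_subgroup scale form 8 \<subseteq> G"
      using G.gam3_subset_G S.cong_subgroup_eq[of 3] by auto
    show "openin (Sp_topology scale form) G"
      by (rule S.openin_if_gam_subset[OF G_sub G.G_comp G.gam3_subset_G])
    assume a: "reduction scale 2 ` G = perm_image scale d ident \<and> \<not> cong_subgroup scale form 4 \<subseteq> G"
    show "card (reduction scale 8 ` G) = fact d * 2 ^ (4 * (genus d)\<^sup>2 - 2 * genus d)"
      using S.card_reduction_8[OF odd fG] a by blast
    show "\<forall>G'. subgroup G' (Sp scale form) \<and> closedin (Sp_topology scale form) G' \<and>
        reduction scale 2 ` G' = perm_image scale d ident \<and> \<not> cong_subgroup scale form 4 \<subseteq> G' \<longrightarrow>
        (\<exists>h \<in> reduction_preimage scale form 2 (perm_image scale d ident).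
           G' = (h <#\<^bsub>Sp scale form\<^esub> G) #>\<^bsub>Sp scale form\<^esub> inv\<^bsub>Sp scale form\<^esub> h)"
    proof (intro allI impI)
      fix H
      assume H: "subgroup H (Sp scale form) \<and> closedin (Sp_topology scale form) H \<and>
        reduction scale 2 ` H = perm_image scale d ident \<and> \<not> cong_subgroup scale form 4 \<subseteq> H"
      then have fH: "frame_group scale form S.D S.E H"
        by (intro S.frame_group_if_closed_subgroup) auto
      interpret H: frame_group scale form S.D S.E H by (rule fH)
      have "\<exists>\<gamma>. S.F.gam 1 \<gamma> \<and> H = (\<lambda>h. \<gamma> \<circ> h \<circ> invf \<gamma>) ` G"
      proof (rule S.F.frame_groups_conjugate[OF fH fG])
        show "\<not> (\<forall>f. S.F.gam 2 f \<longrightarrow> f \<in> H)" "\<not> (\<forall>f. S.F.gam 2 f \<longrightarrow> f \<in> G)"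
          using a H S.cong_subgroup_eq[of 2] by auto
        show "\<exists>\<sigma>. \<sigma> permutes {1..S.D} \<and> S.F.lifts h \<sigma>" if "h \<in> H" for h
          using S.exact_lifts[OF odd H.G_isom _ that] H by blast
        show "\<exists>\<sigma>. \<sigma> permutes {1..S.D} \<and> S.F.lifts h \<sigma>" if "h \<in> G" for h
          using S.exact_lifts[OF odd G.G_isom _ that] a by blast
      qed
      then obtain \<gamma> where \<gamma>: "S.F.gam 1 \<gamma>" "H = (\<lambda>h. \<gamma> \<circ> h \<circ> invf \<gamma>) ` G" by blast
      note iso = S.F.gam_isom[OF \<gamma>(1)]
      have "reduction scale 2 \<gamma> = reduction scale 2 id"
        using S.reduction_eq_iff[OF iso S.F.isom_id, of 1] \<gamma>(1) by (simp add: inv_id)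
      \<comment> \<open>\<open>id\<close> lies in \<open>G\<close>, so its reduction belongs to the
        permutation group.\<close>
      then have "reduction scale 2 \<gamma> \<in> perm_image scale d ident"
        using a G.G_id by (metis imageI)
      then have "\<gamma> \<in> reduction_preimage scale form 2 (perm_image scale d ident)"
        using iso by (simp add: reduction_preimage_def S.carrier_Sp)
      then show "\<exists>h \<in> reduction_preimage scale form 2 (perm_image scale d ident).
           H = (h <#\<^bsub>Sp scale form\<^esub> G) #>\<^bsub>Sp scale form\<^esub> inv\<^bsub>Sp scale form\<^esub> h"
        using \<gamma>(2) S.conjugate_coset[OF iso G.G_isom] by (intro bexI[of _ \<gamma>]) auto
    qed
  qed
\<comment> \<open>For \<open>d < 5\<close> both implications are vacuous.\<close>
qed simp

end
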